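(* Let $c\in(0,1)$ be a constant and let $w(n)$ satisfy $n^{2/3}\ll w(n)\le cn$. Let $p=w(n)/n$ and $k\ge\frac{5}{1-p}w(n)^{1/2}$. There is an explicitly described algorithm running in time $n^{O(1)}$ such that for every adversarial planting strategy, when $G\sim AG(n,p,k)$ is generated with that strategy, the algorithm outputs a maximum clique of $G$ with probability tending to $1$ as $n\to\infty$.
   Context: $AG(n,p,k)$: sample $G'\sim G(n,p)$ (Erdős–Rényi random graph with edge probability $p$); a computationally unbounded adversary, as an arbitrary function of $G'$ (its strategy), selects a set $K$ of $k$ vertices; all missing edges inside $K$ are added, giving $G$. $f\ll g$ means $f/g\to0$. *)

theory Defs
  imports "HOL-Probability.Probability"
begin

text \<open>A graph on {0..<n} is its edge set; edges are two-element sets.\<close>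

definition all_pairs :: "nat \<Rightarrow> nat set set" where
  "all_pairs n = {e. \<exists>i j. i < n \<and> j < n \<and> i \<noteq> j \<and> e = {i, j}}"

definition is_clique :: "nat \<Rightarrow> nat set set \<Rightarrow> nat set \<Rightarrow> bool" where
  "is_clique n E C \<longleftrightarrow> C \<subseteq> {..<n} \<and> (\<forall>i\<in>C. \<forall>j\<in>C. i \<noteq> j \<longrightarrow> {i, j} \<in> E)"

definition is_max_clique :: "nat \<Rightarrow> nat set set \<Rightarrow> nat set \<Rightarrow> bool" where
  "is_max_clique n E C \<longleftrightarrow> is_clique n E C \<and> (\<forall>D. is_clique n E D \<longrightarrow> card D \<le> card C)"

definition gnp :: "nat \<Rightarrow> real \<Rightarrow> nat set set pmf" where
  "gnp n p = map_pmf (\<lambda>b. {e \<in> all_pairs n. b e})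
                     (Pi_pmf (all_pairs n) False (\<lambda>_. bernoulli_pmf p))"

text \<open>AG(n,p,k) for a given adversary strategy S (a function of G' returning the
  k-set K; validity |K| = k is imposed in the theorem): all missing edges inside K are added.\<close>
definition AG :: "nat \<Rightarrow> real \<Rightarrow> (nat set set \<Rightarrow> nat set) \<Rightarrow> nat set set pmf" where
  "AG n p S = map_pmf (\<lambda>G'. G' \<union> {e \<in> all_pairs n. e \<subseteq> S G'}) (gnp n p)"

definition valid_strategy :: "nat \<Rightarrow> nat \<Rightarrow> (nat set set \<Rightarrow> nat set) \<Rightarrow> bool" where
  "valid_strategy n k S \<longleftrightarrow> (\<forall>G'. S G' \<subseteq> {..<n} \<and> card (S G') = k)"

text \<open>Memory is a function nat => nat; all operands are memory addresses.
  This model is polynomially equivalent to Turing machines.\<close>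
datatype instr =
    LoadC nat nat
  | Add nat nat nat
  | Sub nat nat nat
  | LoadI nat nat
  | StoreI nat nat
  | Jz nat nat
  | Jmp nat
  | Halt

type_synonym config = "nat \<times> (nat \<Rightarrow> nat)"

definition halted :: "instr list \<Rightarrow> config \<Rightarrow> bool" where
  "halted P c \<longleftrightarrow> fst c \<ge> length P \<or> P ! fst c = Halt"

fun exec :: "instr \<Rightarrow> config \<Rightarrow> config" where
  "exec (LoadC a v) (pc, m) = (Suc pc, m(a := v))"
| "exec (Add a b c) (pc, m) = (Suc pc, m(a := m b + m c))"
| "exec (Sub a b c) (pc, m) = (Suc pc, m(a := m b - m c))"
| "exec (LoadI a b) (pc, m) = (Suc pc, m(a := m (m b)))"
| "exec (StoreI a b) (pc, m) = (Suc pc, m(m a := m b))"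
| "exec (Jz a t) (pc, m) = ((if m a = 0 then t else Suc pc), m)"
| "exec (Jmp t) (pc, m) = (t, m)"
| "exec Halt (pc, m) = (pc, m)"

definition step :: "instr list \<Rightarrow> config \<Rightarrow> config" where
  "step P c = (if halted P c then c else exec (P ! fst c) c)"

definition run :: "instr list \<Rightarrow> nat \<Rightarrow> config \<Rightarrow> config" where
  "run P t c = (step P ^^ t) c"

text \<open>Input encoding: M[0] = n, M[1 + i*n + j] = [{i,j} is an edge] for i,j < n,
  all other cells 0.  Output: vertex i < n is output iff M[1 + n*n + i] \<noteq> 0 at halting.\<close>
definition input_mem :: "nat \<Rightarrow> nat set set \<Rightarrow> nat \<Rightarrow> nat" where
  "input_mem n E a =
     (if a = 0 then n
      else if a - 1 < n * n \<and> {(a - 1) div n, (a - 1) mod n} \<in> E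
              \<and> (a - 1) div n \<noteq> (a - 1) mod n then 1
      else 0)"

definition ram_halts_within :: "instr list \<Rightarrow> nat \<Rightarrow> nat \<Rightarrow> nat set set \<Rightarrow> bool" where
  "ram_halts_within P T n E \<longleftrightarrow> halted P (run P T (0, input_mem n E))"

definition ram_output :: "instr list \<Rightarrow> nat \<Rightarrow> nat \<Rightarrow> nat set set \<Rightarrow> nat set" where
  "ram_output P T n E = {i. i < n \<and> snd (run P T (0, input_mem n E)) (1 + n * n + i) \<noteq> 0}"

end

theory Submission
  imports Defs
begin

text \<open>
  Guess t vertices Q of the planted clique K, for a constant t depending on c only. In the planted
  graph the common neighbourhood V of Q contains K - Q, and its other vertices are common neighbours
  of Q in G(n,p), hence there are only about n p^t of them; so k exceeds the square root of |V| by as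
  large a constant factor as desired. Centre the adjacency matrix on V at p (guessed up to 1/n). It is
  then a rank-one matrix supported on K - Q plus noise, and the noise has small norm uniformly in K:
  a union bound over the integer lattice works, because sets K cost n^k only and the edges inside V
  are independent of the edges to Q. Some column of the n-th power of the matrix is therefore almost
  proportional to the indicator of K - Q, and cutting it at one of its own entries yields a set T close
  to K - Q. The vertices adjacent to almost all of T include K and every maximum clique, and at most
  O(log n) vertices outside K, since no O(log n) vertices have high density to a k-set in G(n,p).
  Deleting one endpoint of each remaining non-edge in all n^O(1) possible ways finds a maximum clique.
  All guesses are enumerated and the largest clique found is kept; neither p nor k has to be known.
\<close>

section \<open>A loop language and its compilation to the RAM\<close>

text \<open>The planted set is chosen after the whole random graph is known, so concentration for a
  fixed K says nothing. All randomness is confined to three properties of G(n,p),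
  \<open>norm_ok\<close>, \<open>sparse_ok\<close> and \<open>clique_ok\<close>, each quantified
  over every candidate set; for a graph that has them the analysis is deterministic. Since V depends
  on the graph too, the norm bound also ranges over every possible part B of V outside K, weighted
  by the probability that B is adjacent to all of Q. The number t comes from comparing n p^t with
  k^2: since k^2 is at least 25 n p, the quotient is at most c^(t-1) / 25, which can be made small.
  The growth of w makes k exceed any fixed multiple of ln n, so that the k ln n paid for the choice
  of K is small against k^2 as well. The machine only adds and subtracts natural numbers. Hence the
  matrix is scaled by n to have integer entries, vectors are differences of two natural vectors, and
  products are repeated sums. Every branch of every guess yields a clique, so wrong guesses are
  harmless and one right guess suffices.\<close>

record st =
  vr :: "nat \<Rightarrow> nat"
  ar :: "nat \<Rightarrow> nat \<Rightarrow> nat"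
  rw :: "nat \<Rightarrow> nat"

text \<open>Loops are counted and their bound is read once on entry, so every program terminates and
  its time is bounded by recursion on the syntax. \<open>Get\<close> and \<open>Put\<close> work on
  private arrays of unlimited length; \<open>RawGet\<close> and \<open>RawPut\<close> reach the
  input and output cells themselves.\<close>

datatype com =
    Skip
  | Const nat nat
  | Plus nat nat nat
  | Minus nat nat nat
  | Get nat nat nat
  | Put nat nat nat
  | RawGet nat nat
  | RawPut nat nat
  | Seq com com (infixr \<open>;;\<close> 60)
  | IfZ nat com com
  | For nat nat com

definition setv :: "nat \<Rightarrow> nat \<Rightarrow> st \<Rightarrow> st" where
  "setv v x s = s\<lparr>vr := (vr s)(v := x)\<rparr>"

lemma setv_sel [simp]:
  "vr (setv v x s) = (vr s)(v := x)" "ar (setv v x s) = ar s" "rw (setv v x s) = rw s"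
  by (simp_all add: setv_def)

text \<open>These cells hold rows 1 to n-1 of the adjacency matrix and the output block. Row 0
  occupies cells 1 to n, which the compiled program takes for its registers. Guarding raw access by
  this zone keeps a program from damaging its own memory.\<close>

definition raw_zone :: "nat \<Rightarrow> nat \<Rightarrow> bool" where
  "raw_zone n x \<longleftrightarrow> n < x \<and> x < n * n + n + 1"

primrec sem :: "nat \<Rightarrow> com \<Rightarrow> st \<Rightarrow> st" where
  "sem n Skip = (\<lambda>s. s)"
| "sem n (Const v k) = (\<lambda>s. setv v k s)"
| "sem n (Plus v x y) = (\<lambda>s. setv v (vr s x + vr s y) s)"
| "sem n (Minus v x y) = (\<lambda>s. setv v (vr s x - vr s y) s)"
| "sem n (Get v a x) = (\<lambda>s. setv v (ar s a (vr s x)) s)"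
| "sem n (Put a x y) = (\<lambda>s. s\<lparr>ar := (ar s)(a := (ar s a)(vr s x := vr s y))\<rparr>)"
| "sem n (RawGet v x) = (\<lambda>s. setv v (if raw_zone n (vr s x) then rw s (vr s x) else 0) s)"
| "sem n (RawPut x y) = (\<lambda>s. if raw_zone n (vr s x) then s\<lparr>rw := (rw s)(vr s x := vr s y)\<rparr> else s)"
| "sem n (Seq c1 c2) = (\<lambda>s. sem n c2 (sem n c1 s))"
| "sem n (IfZ x c1 c2) = (\<lambda>s. if vr s x = 0 then sem n c1 s else sem n c2 s)"
| "sem n (For v x c) = (\<lambda>s. fold (\<lambda>i s. sem n c (setv v i s)) [0..<vr s x] s)"

text \<open>Frame sets: what a command may write is computed syntactically by \<open>modv\<close>,
  \<open>moda\<close> and \<open>modr\<close>, so the rest of the state is known to be unchanged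
  without executing the command.\<close>

primrec modv :: "com \<Rightarrow> nat set" where
  "modv Skip = {}"
| "modv (Const v k) = {v}"
| "modv (Plus v x y) = {v}"
| "modv (Minus v x y) = {v}"
| "modv (Get v a x) = {v}"
| "modv (Put a x y) = {}"
| "modv (RawGet v x) = {v}"
| "modv (RawPut x y) = {}"
| "modv (Seq c1 c2) = modv c1 \<union> modv c2"
| "modv (IfZ x c1 c2) = modv c1 \<union> modv c2"
| "modv (For v x c) = insert v (modv c)"

primrec moda :: "com \<Rightarrow> nat set" where
  "moda Skip = {}"
| "moda (Const v k) = {}"
| "moda (Plus v x y) = {}"
| "moda (Minus v x y) = {}"
| "moda (Get v a x) = {}"
| "moda (Put a x y) = {a}"
| "moda (RawGet v x) = {}"
| "moda (RawPut x y) = {}"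
| "moda (Seq c1 c2) = moda c1 \<union> moda c2"
| "moda (IfZ x c1 c2) = moda c1 \<union> moda c2"
| "moda (For v x c) = moda c"

primrec modr :: "com \<Rightarrow> bool" where
  "modr Skip = False"
| "modr (Const v k) = False"
| "modr (Plus v x y) = False"
| "modr (Minus v x y) = False"
| "modr (Get v a x) = False"
| "modr (Put a x y) = False"
| "modr (RawGet v x) = False"
| "modr (RawPut x y) = True"
| "modr (Seq c1 c2) = (modr c1 \<or> modr c2)"
| "modr (IfZ x c1 c2) = (modr c1 \<or> modr c2)"
| "modr (For v x c) = modr c"

lemma fold_keep:
  assumes "\<And>i s. f (g i s) = f s"
  shows "f (fold g xs s) = f s"
  by (induction xs arbitrary: s) (simp_all add: assms)

lemma vr_sem: "u \<notin> modv c \<Longrightarrow> vr (sem n c s) u = vr s u"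
proof (induction c arbitrary: s)
  case (For v x c)
  show ?case using For by (simp add: fold_keep[where f = "\<lambda>s. vr s u"])
qed auto

lemma ar_sem: "a \<notin> moda c \<Longrightarrow> ar (sem n c s) a = ar s a"
proof (induction c arbitrary: s)
  case (For v x c)
  show ?case using For by (simp add: fold_keep[where f = "\<lambda>s. ar s a"])
qed auto

lemma rw_sem: "\<not> modr c \<Longrightarrow> rw (sem n c s) = rw s"
proof (induction c arbitrary: s)
  case (For v x c)
  show ?case using For by (simp add: fold_keep[where f = "\<lambda>s. rw s"])
qed auto

primrec clen :: "com \<Rightarrow> nat" where
  "clen Skip = 0"
| "clen (Const v k) = 1"
| "clen (Plus v x y) = 1"
| "clen (Minus v x y) = 1"
| "clen (Get v a x) = 8"
| "clen (Put a x y) = 8"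
| "clen (RawGet v x) = 7"
| "clen (RawPut x y) = 5"
| "clen (Seq c1 c2) = clen c1 + clen c2"
| "clen (IfZ x c1 c2) = clen c1 + clen c2 + 2"
| "clen (For v x c) = clen c + 7"

text \<open>Cell 0 holds n and doubles as variable 0; cells below N are the variables; N and N+1 hold the
  constants 0 and 1, N+2 and N+3 are scratch, N+4 holds the base of the array zone, and from
  N+5 on each loop depth owns a counter and a bound. The sixteen arrays are interleaved, so
  that none of them needs a size.\<close>

definition addr :: "nat \<Rightarrow> nat \<Rightarrow> nat \<Rightarrow> instr list" where
  "addr N a x = [Add (N+2) x x, Add (N+2) (N+2) (N+2), Add (N+2) (N+2) (N+2), Add (N+2) (N+2) (N+2),
                 LoadC (N+3) a, Add (N+2) (N+2) (N+3), Add (N+2) (N+2) (N+4)]"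

text \<open>Jump targets are absolute, hence the address q of the first instruction is a parameter;
  d is the loop depth and selects the registers of a loop. A loop copies its bound on entry, and its
  private counter into the loop variable in each round, so the compiled body may overwrite either
  variable. Adding cell N, which holds 0, serves as a move.\<close>

primrec compile :: "nat \<Rightarrow> com \<Rightarrow> nat \<Rightarrow> nat \<Rightarrow> instr list" where
  "compile N Skip = (\<lambda>d q. [])"
| "compile N (Const v k) = (\<lambda>d q. [LoadC v k])"
| "compile N (Plus v x y) = (\<lambda>d q. [Add v x y])"
| "compile N (Minus v x y) = (\<lambda>d q. [Sub v x y])"
| "compile N (Get v a x) = (\<lambda>d q. addr N a x @ [LoadI v (N+2)])"
| "compile N (Put a x y) = (\<lambda>d q. addr N a x @ [StoreI (N+2) y])"
| "compile N (RawGet v x) = (\<lambda>d q. [Sub (N+2) x 0, Jz (N+2) (q+6), Sub (N+2) (N+4) x, Jz (N+2) (q+6),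
      LoadI v x, Jmp (q+7), LoadC v 0])"
| "compile N (RawPut x y) = (\<lambda>d q. [Sub (N+2) x 0, Jz (N+2) (q+5), Sub (N+2) (N+4) x, Jz (N+2) (q+5),
      StoreI x y])"
| "compile N (Seq c1 c2) = (\<lambda>d q. compile N c1 d q @ compile N c2 d (q + clen c1))"
| "compile N (IfZ x c1 c2) = (\<lambda>d q. Jz x (q + 2 + clen c2) # compile N c2 d (q + 1)
      @ Jmp (q + 2 + clen c2 + clen c1) # compile N c1 d (q + 2 + clen c2))"
| "compile N (For v x c) = (\<lambda>d q. [Add (N+5+2*d) N N, Add (N+6+2*d) x N,
        Sub (N+2) (N+6+2*d) (N+5+2*d), Jz (N+2) (q + 7 + clen c), Add v (N+5+2*d) N]
      @ compile N c (Suc d) (q + 5)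
      @ [Add (N+5+2*d) (N+5+2*d) (N+1), Jmp (q + 2)])"

lemma length_addr [simp]: "length (addr N a x) = 7"
  by (simp add: addr_def)

lemma length_compile: "length (compile N c d q) = clen c"
  by (induction c arbitrary: d q) (simp_all add: addr_def)

text \<open>The condition \<open>0 < v\<close> protects cell 0 with n in it, \<open>a < 16\<close>
  matches the interleaving factor in \<open>addr\<close>, and D limits the depth for which loop
  registers exist.\<close>

primrec wfc :: "nat \<Rightarrow> nat \<Rightarrow> com \<Rightarrow> nat \<Rightarrow> bool" where
  "wfc N D Skip = (\<lambda>d. True)"
| "wfc N D (Const v k) = (\<lambda>d. 0 < v \<and> v < N)"
| "wfc N D (Plus v x y) = (\<lambda>d. 0 < v \<and> v < N \<and> x < N \<and> y < N)"
| "wfc N D (Minus v x y) = (\<lambda>d. 0 < v \<and> v < N \<and> x < N \<and> y < N)"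
| "wfc N D (Get v a x) = (\<lambda>d. 0 < v \<and> v < N \<and> x < N \<and> a < 16)"
| "wfc N D (Put a x y) = (\<lambda>d. x < N \<and> y < N \<and> a < 16)"
| "wfc N D (RawGet v x) = (\<lambda>d. 0 < v \<and> v < N \<and> x < N)"
| "wfc N D (RawPut x y) = (\<lambda>d. x < N \<and> y < N)"
| "wfc N D (Seq c1 c2) = (\<lambda>d. wfc N D c1 d \<and> wfc N D c2 d)"
| "wfc N D (IfZ x c1 c2) = (\<lambda>d. x < N \<and> wfc N D c1 d \<and> wfc N D c2 d)"
| "wfc N D (For v x c) = (\<lambda>d. 0 < v \<and> v < N \<and> x < N \<and> d < D \<and> wfc N D c (Suc d))"

primrec bounds :: "com \<Rightarrow> nat set" where
  "bounds Skip = {}"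
| "bounds (Const v k) = {}"
| "bounds (Plus v x y) = {}"
| "bounds (Minus v x y) = {}"
| "bounds (Get v a x) = {}"
| "bounds (Put a x y) = {}"
| "bounds (RawGet v x) = {}"
| "bounds (RawPut x y) = {}"
| "bounds (Seq c1 c2) = bounds c1 \<union> bounds c2"
| "bounds (IfZ x c1 c2) = bounds c1 \<union> bounds c2"
| "bounds (For v x c) = insert x (bounds c)"

text \<open>X bounds all loop bounds. The longest basic command takes 8 instructions; a round costs
  5 beyond its body (difference, branch, copy, increment, jump), and entering and leaving a loop
  costs 4.\<close>

primrec tb :: "nat \<Rightarrow> com \<Rightarrow> nat" where
  "tb X Skip = 8"
| "tb X (Const v k) = 8"
| "tb X (Plus v x y) = 8"
| "tb X (Minus v x y) = 8"
| "tb X (Get v a x) = 8"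
| "tb X (Put a x y) = 8"
| "tb X (RawGet v x) = 8"
| "tb X (RawPut x y) = 8"
| "tb X (Seq c1 c2) = tb X c1 + tb X c2"
| "tb X (IfZ x c1 c2) = tb X c1 + tb X c2 + 2"
| "tb X (For v x c) = X * (tb X c + 5) + 4"

lemma tb_poly: "\<exists>C d. \<forall>X. tb X c \<le> C * (X + 1) ^ d"
proof (induction c)
  case (Seq c1 c2)
  then obtain C1 d1 C2 d2 where 1: "\<And>X. tb X c1 \<le> C1 * (X + 1) ^ d1"
    and 2: "\<And>X. tb X c2 \<le> C2 * (X + 1) ^ d2" by blast
  show ?case
  proof (intro exI allI)
    fix X :: nat
    have a: "(X+1) ^ d1 \<le> (X + 1) ^ (d1 + d2)" "(X+1) ^ d2 \<le> (X + 1) ^ (d1 + d2)"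
      by (rule power_increasing; simp)+
    have "C1 * (X + 1) ^ d1 \<le> C1 * (X + 1) ^ (d1 + d2)" "C2 * (X + 1) ^ d2 \<le> C2 * (X + 1) ^ (d1 + d2)"
      using a by (auto intro: mult_left_mono)
    then show "tb X (c1 ;; c2) \<le> (C1 + C2) * (X + 1) ^ (d1 + d2)"
      using 1[of X] 2[of X] by (simp only: tb.simps add_mult_distrib)
  qed
next
  case (IfZ x c1 c2)
  then obtain C1 d1 C2 d2 where 1: "\<And>X. tb X c1 \<le> C1 * (X + 1) ^ d1"
    and 2: "\<And>X. tb X c2 \<le> C2 * (X + 1) ^ d2" by blast
  show ?case
  proof (intro exI allI)
    fix X :: nat
    have a: "(X+1) ^ d1 \<le> (X + 1) ^ (d1 + d2)" "(X+1) ^ d2 \<le> (X + 1) ^ (d1 + d2)"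
      by (rule power_increasing; simp)+
    have "C1 * (X + 1) ^ d1 \<le> C1 * (X + 1) ^ (d1 + d2)" "C2 * (X + 1) ^ d2 \<le> C2 * (X + 1) ^ (d1 + d2)"
      using a by (auto intro: mult_left_mono)
    moreover have "1 \<le> (X + 1) ^ (d1 + d2)" by simp
    ultimately have "tb X c1 + tb X c2 + 2 \<le> C1 * (X + 1) ^ (d1 + d2) + C2 * (X + 1) ^ (d1 + d2) + 2 * (X + 1) ^ (d1 + d2)"
      using 1[of X] 2[of X] by linarith
    then show "tb X (IfZ x c1 c2) \<le> (C1 + C2 + 2) * (X + 1) ^ (d1 + d2)"
      by (simp only: tb.simps add_mult_distrib)
  qed
next
  case (For v x c)
  then obtain C d where 1: "\<And>X. tb X c \<le> C * (X + 1) ^ d" by blast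
  show ?case
  proof (intro exI allI)
    fix X :: nat
    have p: "1 \<le> (X + 1) ^ d" by simp
    have "tb X c + 5 \<le> C * (X + 1) ^ d + 5 * (X + 1) ^ d" using 1[of X] p by linarith
    also have "\<dots> = (C + 5) * (X + 1) ^ d" by (simp only: add_mult_distrib)
    finally have "X * (tb X c + 5) \<le> (X + 1) * ((C + 5) * (X + 1) ^ d)"
      by (intro mult_mono) auto
    also have "\<dots> = (C + 5) * (X + 1) ^ Suc d" by (simp only: power_Suc mult.left_commute)
    finally have "X * (tb X c + 5) \<le> (C + 5) * (X + 1) ^ Suc d" .
    moreover have "1 \<le> (X + 1) ^ Suc d" by (rule one_le_power) simp
    ultimately have "tb X (For v x c) \<le> (C + 5) * (X + 1) ^ Suc d + 4 * (X + 1) ^ Suc d"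
      by (simp only: tb.simps)
    also have "\<dots> = (C + 5 + 4) * (X + 1) ^ Suc d" by (simp only: add_mult_distrib[symmetric])
    finally show "tb X (For v x c) \<le> (C + 5 + 4) * (X + 1) ^ Suc d" .
  qed
qed (rule exI[of _ 8], rule exI[of _ 0], simp)+

section \<open>Simulation of programs by machine code\<close>

definition sim :: "nat \<Rightarrow> nat \<Rightarrow> (nat \<Rightarrow> nat) \<Rightarrow> st \<Rightarrow> bool" where
  "sim N n m s \<longleftrightarrow> (\<forall>u<N. m u = vr s u) \<and> 0 < N \<and> vr s 0 = n \<and> m N = 0 \<and> m (N+1) = 1
     \<and> m (N+4) = n * n + n + 1 \<and> (\<forall>x. raw_zone n x \<longrightarrow> m x = rw s x)
     \<and> (\<forall>a<16. \<forall>x. m (n * n + n + 1 + 16 * x + a) = ar s a x)"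

definition code_at :: "instr list \<Rightarrow> nat \<Rightarrow> instr list \<Rightarrow> bool" where
  "code_at P q cs \<longleftrightarrow> q + length cs \<le> length P \<and> (\<forall>i<length cs. P ! (q + i) = cs ! i)"

lemma code_at_Nil [simp]: "code_at P q [] \<longleftrightarrow> q \<le> length P"
  by (simp add: code_at_def)

lemma code_at_Cons: "code_at P q (c # cs) \<longleftrightarrow> q < length P \<and> P ! q = c \<and> code_at P (Suc q) cs"
  by (auto simp: code_at_def All_less_Suc2 less_Suc_eq_0_disj)

lemma code_at_append: "code_at P q (cs @ ds) \<longleftrightarrow> code_at P q cs \<and> code_at P (q + length cs) ds"
  by (induction cs arbitrary: q) (auto simp: code_at_Cons, auto simp: code_at_def)

lemma run_add: "run P (a + b) c = run P b (run P a c)"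
  by (simp add: run_def funpow_add add.commute[of a])

lemma run_0 [simp]: "run P 0 c = c"
  by (simp add: run_def)

lemma run_Suc: "run P (Suc t) c = run P t (step P c)"
  by (simp add: run_def funpow_swap1)

lemma step_instr: "q < length P \<Longrightarrow> P ! q = i \<Longrightarrow> i \<noteq> Halt \<Longrightarrow> step P (q, m) = exec i (q, m)"
  by (simp add: step_def halted_def)

lemma sim_var: "sim N n m s \<Longrightarrow> x < N \<Longrightarrow> m x = vr s x"
  by (simp add: sim_def)

lemma sim_setv:
  assumes "sim N n m s" "0 < v" "v < N" "N \<le> n"
  shows "sim N n (m(v := x)) (setv v x s)"
  using assms by (auto simp: sim_def raw_zone_def)

lemma sim_reg:
  assumes "sim N n m s" "N < r" "r \<noteq> N + 1" "r \<noteq> N + 4" "r \<le> n"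
  shows "sim N n (m(r := x)) s"
  using assms by (auto simp: sim_def raw_zone_def)

lemma interleave_inj:
  fixes a b x y :: nat
  assumes "a < 16" "b < 16"
  shows "16 * x + a = 16 * y + b \<longleftrightarrow> x = y \<and> a = b"
proof
  assume eq: "16 * x + a = 16 * y + b"
  then have "(16 * x + a) div 16 = (16 * y + b) div 16" by simp
  then have "x = y" using assms by simp
  then show "x = y \<and> a = b" using eq by simp
qed simp

lemma sim_put:
  assumes "sim N n m s" "N + 5 \<le> n" "a < 16"
  shows "sim N n (m(n * n + n + 1 + 16 * x + a := y)) (s\<lparr>ar := (ar s)(a := (ar s a)(x := y))\<rparr>)"
proof -
  have "n * n + n + 1 + 16 * x' + a' = n * n + n + 1 + 16 * x + a \<longleftrightarrow> x' = x \<and> a' = a" if "a' < 16" for x' a'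
    using interleave_inj[OF that assms(3), of x' x] by linarith
  then show ?thesis using assms by (auto simp: sim_def raw_zone_def fun_upd_def)
qed

lemma sim_raw:
  assumes "sim N n m s" "N + 5 \<le> n" "raw_zone n x"
  shows "sim N n (m(x := y)) (s\<lparr>rw := (rw s)(x := y)\<rparr>)"
  using assms by (auto simp: sim_def raw_zone_def)

lemma run_addr:
  assumes "sim N n m s" "x < N" "N + 5 \<le> n" "code_at P q (addr N a x)"
  shows "run P 7 (q, m) = (q + 7, m(N+3 := a, N+2 := n * n + n + 1 + 16 * vr s x + a))"
proof -
  have m: "m x = vr s x" "m (N+4) = n * n + n + 1" using assms by (auto simp: sim_def)
  have *: "run P 7 (q, m) = run P (Suc (Suc (Suc (Suc (Suc (Suc (Suc 0))))))) (q, m)"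
    by (simp add: eval_nat_numeral)
  show ?thesis unfolding * using assms(4) assms(2)
    by (simp add: addr_def code_at_Cons run_Suc step_instr m fun_upd_twist) (simp add: fun_eq_iff)
qed

lemma compile_correctI:
  assumes "run P t (q, m) = (q', m')" "sim N n m' s'" "t \<le> T" "\<And>i. i < 2 * d \<Longrightarrow> m' (N + 5 + i) = m (N + 5 + i)"
  shows "\<exists>t m'. run P t (q, m) = (q', m') \<and> sim N n m' s' \<and> t \<le> T \<and> (\<forall>i<2*d. m' (N + 5 + i) = m (N + 5 + i))"
  using assms by blast

text \<open>The last conjunct, that the registers of all enclosing loops survive, is what carries
  the induction through a loop body. The assumption \<open>bounds c \<inter> modv c = {}\<close>
  keeps X valid for inner loops after any number of rounds.\<close>

theorem compile_correct:
  assumes "wfc N D c d" "N + 5 + 2 * D \<le> n" "d \<le> D" "sim N n m s" "code_at P q (compile N c d q)"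
    and "bounds c \<inter> modv c = {}" "\<And>x. x \<in> bounds c \<Longrightarrow> vr s x \<le> X"
  shows "\<exists>t m'. run P t (q, m) = (q + clen c, m') \<and> sim N n m' (sem n c s)
           \<and> t \<le> tb X c \<and> (\<forall>i<2*d. m' (N + 5 + i) = m (N + 5 + i))"
  using assms
proof (induction c arbitrary: d q m s)
  case Skip
  then show ?case by (intro compile_correctI[where t = 0 and m' = m]) simp_all
next
  case (Const v k)
  have "run P (Suc 0) (q, m) = (q + 1, m(v := k))"
    using Const(5) by (simp add: code_at_Cons run_Suc step_instr)
  with Const show ?case
    by (intro compile_correctI[where t = "Suc 0" and m' = "m(v := k)"]) (simp_all add: sim_setv)
next
  case (Plus v x y)
  have "run P (Suc 0) (q, m) = (q + 1, m(v := m x + m y))"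
    using Plus(5) by (simp add: code_at_Cons run_Suc step_instr)
  with Plus show ?case
    by (intro compile_correctI[where t = "Suc 0" and m' = "m(v := m x + m y)"]) (simp_all add: sim_setv sim_var)
next
  case (Minus v x y)
  have "run P (Suc 0) (q, m) = (q + 1, m(v := m x - m y))"
    using Minus(5) by (simp add: code_at_Cons run_Suc step_instr)
  with Minus show ?case
    by (intro compile_correctI[where t = "Suc 0" and m' = "m(v := m x - m y)"]) (simp_all add: sim_setv sim_var)
next
  case (Get v a x)
  let ?m = "m(N+3 := a, N+2 := n * n + n + 1 + 16 * vr s x + a)"
  have c: "code_at P q (addr N a x)" "q + 7 < length P" "P ! (q + 7) = LoadI v (N+2)"
    using Get(5) by (auto simp: code_at_append code_at_Cons)
  have s: "sim N n ?m s" using Get(1-4) by (intro sim_reg) auto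
  have "run P 7 (q, m) = (q + 7, ?m)" by (rule run_addr[OF Get(4) _ _ c(1)]) (use Get in auto)
  then have "run P (7 + 1) (q, m) = (q + 8, ?m(v := ?m (n * n + n + 1 + 16 * vr s x + a)))"
    unfolding run_add by (simp add: run_Suc step_instr c)
  moreover have "?m (n * n + n + 1 + 16 * vr s x + a) = ar s a (vr s x)"
    using s Get(1) unfolding sim_def by auto
  ultimately show ?case using sim_setv[OF s, of v] Get(1,2)
    by (intro compile_correctI[where t = "7+1" and m' = "?m(v := ar s a (vr s x))"]) auto
next
  case (Put a x y)
  let ?m = "m(N+3 := a, N+2 := n * n + n + 1 + 16 * vr s x + a)"
  let ?m' = "?m(n * n + n + 1 + 16 * vr s x + a := vr s y)"
  have c: "code_at P q (addr N a x)" "q + 7 < length P" "P ! (q + 7) = StoreI (N+2) y"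
    using Put(5) by (auto simp: code_at_append code_at_Cons)
  have s: "sim N n ?m s" using Put(1-4) by (intro sim_reg) auto
  have y: "?m y = vr s y" using sim_var[OF s, of y] Put(1) by auto
  have "run P 7 (q, m) = (q + 7, ?m)" by (rule run_addr[OF Put(4) _ _ c(1)]) (use Put in auto)
  then have r: "run P (7 + 1) (q, m) = (q + 8, ?m')"
    unfolding run_add using y by (simp add: run_Suc step_instr c)
  have "N + 5 + i \<noteq> n * n + n + 1 + 16 * vr s x + a" if "i < 2 * d" for i
    using Put(2,3) that by simp
  then have "\<forall>i<2*d. ?m' (N + 5 + i) = m (N + 5 + i)" by simp
  moreover have "sim N n ?m' (sem n (Put a x y) s)"
    using sim_put[OF s, of a "vr s x" "vr s y"] Put(1,2) by simp
  ultimately show ?case using r by (intro compile_correctI[where t = "7+1" and m' = ?m']) simp_all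
next
  case (RawGet v x)
  let ?m1 = "m(N+2 := vr s x - n)" and ?m2 = "m(N+2 := n * n + n + 1 - vr s x)"
  note x = sim_var[OF RawGet(4), of x]
  have c6: "q + 6 < length P" "P ! (q + 6) = LoadC v 0"
    using RawGet(5) by (auto simp: code_at_Cons eval_nat_numeral)
  have m: "m 0 = n" "m (N + 4) = n * n + n + 1" using RawGet(4) by (auto simp: sim_def)
  have s: "sim N n ?m1 s" "sim N n ?m2 s" using RawGet(1-4) by (auto intro!: sim_reg)
  have z: "m (vr s x) = rw s (vr s x)" if "raw_zone n (vr s x)" using that RawGet(4) by (auto simp: sim_def)
  consider "vr s x \<le> n" | "n < vr s x" "n * n + n + 1 \<le> vr s x" | "n < vr s x" "vr s x < n * n + n + 1"
    by linarith
  then show ?case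
  proof cases
    case 1
    then show ?thesis using RawGet(1-5) x m c6 sim_setv[OF s(1), of v 0]
      by (intro compile_correctI[where t = "Suc (Suc (Suc 0))" and m' = "?m1(v := 0)"])
        (auto simp: code_at_Cons run_Suc step_instr raw_zone_def add.commute)
  next
    case 2
    then show ?thesis using RawGet(1-5) x m c6 sim_setv[OF s(2), of v 0]
      by (intro compile_correctI[where t = "Suc (Suc (Suc (Suc (Suc 0))))" and m' = "?m2(v := 0)"])
        (auto simp: code_at_Cons run_Suc step_instr raw_zone_def add.commute)
  next
    case 3
    \<comment> \<open>The scratch cell N+2 has been overwritten by the range check; the address lies
      above n and so differs from it.\<close>
    then have "vr s x \<noteq> N + 2" using RawGet(2) by auto
    then show ?thesis using RawGet(1-5) x m c6 sim_setv[OF s(2), of v "rw s (vr s x)"] 3 z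
      by (intro compile_correctI[where t = "Suc (Suc (Suc (Suc (Suc (Suc 0)))))" and m' = "?m2(v := rw s (vr s x))"])
        (auto simp: code_at_Cons run_Suc step_instr raw_zone_def add.commute)
  qed
next
  case (RawPut x y)
  let ?m1 = "m(N+2 := vr s x - n)" and ?m2 = "m(N+2 := n * n + n + 1 - vr s x)"
  note x = sim_var[OF RawPut(4), of x] sim_var[OF RawPut(4), of y]
  have m: "m 0 = n" "m (N + 4) = n * n + n + 1" using RawPut(4) by (auto simp: sim_def)
  have s: "sim N n ?m1 s" "sim N n ?m2 s" using RawPut(1-4) by (auto intro!: sim_reg)
  consider "vr s x \<le> n" | "n < vr s x" "n * n + n + 1 \<le> vr s x" | "n < vr s x" "vr s x < n * n + n + 1"
    by linarith
  then show ?case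
  proof cases
    case 1
    then show ?thesis using RawPut(1-5) x m s
      by (intro compile_correctI[where t = "Suc (Suc 0)" and m' = "?m1"])
        (auto simp: code_at_Cons run_Suc step_instr raw_zone_def add.commute)
  next
    case 2
    then show ?thesis using RawPut(1-5) x m s
      by (intro compile_correctI[where t = "Suc (Suc (Suc (Suc 0)))" and m' = "?m2"])
        (auto simp: code_at_Cons run_Suc step_instr raw_zone_def add.commute)
  next
    case 3
    have "sim N n (?m2(vr s x := vr s y)) (sem n (RawPut x y) s)"
      using sim_raw[OF s(2), of "vr s x" "vr s y"] 3 RawPut(2) by (auto simp: raw_zone_def)
    moreover have "N + 5 + i \<noteq> vr s x" if "i < 2 * d" for i
      using RawPut(2,3) that 3 by simp
    ultimately show ?thesis using RawPut(1-5) x m 3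
      by (intro compile_correctI[where t = "Suc (Suc (Suc (Suc (Suc 0))))" and m' = "?m2(vr s x := vr s y)"])
        (auto simp: code_at_Cons run_Suc step_instr add.commute)
  qed
next
  case (Seq c1 c2)
  have "code_at P q (compile N c1 d q)" "code_at P (q + clen c1) (compile N c2 d (q + clen c1))"
    using Seq.prems(5) by (auto simp: code_at_append length_compile)
  note code = this
  obtain t1 m1 where 1: "run P t1 (q, m) = (q + clen c1, m1)" "sim N n m1 (sem n c1 s)"
    "t1 \<le> tb X c1" "\<forall>i<2*d. m1 (N + 5 + i) = m (N + 5 + i)"
    using Seq.IH(1)[OF _ Seq.prems(2-4) code(1)] Seq.prems(1,6,7) by auto
  have "vr (sem n c1 s) x \<le> X" if "x \<in> bounds c2" for x
    using that Seq.prems(6,7) by (subst vr_sem) auto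
  then obtain t2 m2 where 2: "run P t2 (q + clen c1, m1) = (q + clen c1 + clen c2, m2)"
    "sim N n m2 (sem n c2 (sem n c1 s))"
    "t2 \<le> tb X c2" "\<forall>i<2*d. m2 (N + 5 + i) = m1 (N + 5 + i)"
    using Seq.IH(2)[OF _ Seq.prems(2,3) 1(2) code(2)] Seq.prems(1,6,7) by auto
  show ?case using 1 2
    by (intro compile_correctI[where t = "t1 + t2" and m' = m2]) (auto simp: run_add)
next
  case (IfZ x c1 c2)
  have code: "q < length P" "P ! q = Jz x (q + 2 + clen c2)" "code_at P (q + 1) (compile N c2 d (q + 1))"
    "q + 1 + clen c2 < length P" "P ! (q + 1 + clen c2) = Jmp (q + 2 + clen c2 + clen c1)"
    "code_at P (q + 2 + clen c2) (compile N c1 d (q + 2 + clen c2))"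
    using IfZ.prems(5) by (auto simp: code_at_append code_at_Cons length_compile)
  have x: "m x = vr s x" using IfZ.prems(1,4) by (auto simp: sim_var)
  show ?case
  proof (cases "vr s x = 0")
    case True
    obtain t m' where "run P t (q + 2 + clen c2, m) = (q + 2 + clen c2 + clen c1, m')" "sim N n m' (sem n c1 s)"
      "t \<le> tb X c1" "\<forall>i<2*d. m' (N + 5 + i) = m (N + 5 + i)"
      using IfZ.IH(1)[OF _ IfZ.prems(2-4) code(6)] IfZ.prems(1,6,7) by auto
    then show ?thesis using True x code
      by (intro compile_correctI[where t = "Suc t" and m' = m']) (auto simp: run_Suc step_instr add_ac)
  next
    case False
    obtain t m' where t: "run P t (q + 1, m) = (q + 1 + clen c2, m')" "sim N n m' (sem n c2 s)"
      "t \<le> tb X c2" "\<forall>i<2*d. m' (N + 5 + i) = m (N + 5 + i)"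
      using IfZ.IH(2)[OF _ IfZ.prems(2-4) code(3)] IfZ.prems(1,6,7) by auto
    have "run P (1 + (t + 1)) (q, m) = (q + 2 + clen c2 + clen c1, m')"
      unfolding run_add using False x code(1,2,4,5) t(1) by (simp add: run_Suc step_instr)
    then show ?thesis using False t
      by (intro compile_correctI[where t = "1 + (t + 1)" and m' = m']) (auto simp: add_ac)
  qed
next
  case (For v x c)
  let ?cnt = "N + 5 + 2 * d" and ?bnd = "N + 6 + 2 * d"
  have code: "q < length P" "P ! q = Add ?cnt N N" "q + 1 < length P" "P ! (q + 1) = Add ?bnd x N"
    "q + 2 < length P" "P ! (q + 2) = Sub (N+2) ?bnd ?cnt" "q + 3 < length P" "P ! (q + 3) = Jz (N+2) (q + 7 + clen c)"
    "q + 4 < length P" "P ! (q + 4) = Add v ?cnt N" "code_at P (q + 5) (compile N c (Suc d) (q + 5))"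
    "q + 5 + clen c < length P" "P ! (q + 5 + clen c) = Add ?cnt ?cnt (N+1)"
    "q + 6 + clen c < length P" "P ! (q + 6 + clen c) = Jmp (q + 2)"
    using For.prems(5) by (auto simp: code_at_append code_at_Cons length_compile eval_nat_numeral)
  define B where "B = vr s x"
  have BX: "B \<le> X" using For.prems(7) by (simp add: B_def)
  have dD: "d < D" "0 < v" "v < N" "x < N" using For.prems(1) by auto
  define S where "S = (\<lambda>j. fold (\<lambda>i s. sem n c (setv v i s)) [0..<j] s)"
  have Sb: "vr (S j) y = vr s y" if "y \<in> bounds c" for j y
  proof -
    have "y \<notin> modv c" "y \<noteq> v" using that For.prems(6) by auto
    then show ?thesis unfolding S_def
      by (intro fold_keep[where f = "\<lambda>s. vr s y"]) (simp add: vr_sem)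
  qed
  \<comment> \<open>After j rounds control is back at the loop test, address q+2; the two
    initialising instructions account for the additive 2.\<close>
  have loop: "\<exists>t m'. run P t (q, m) = (q + 2, m') \<and> sim N n m' (S j) \<and> m' ?cnt = j \<and> m' ?bnd = B
           \<and> t \<le> j * (tb X c + 5) + 2 \<and> (\<forall>i<2*d. m' (N + 5 + i) = m (N + 5 + i))" if "j \<le> B" for j
    using that
  proof (induction j)
    case 0
    have m: "m N = 0" "m x = B" using For.prems(4) dD by (auto simp: sim_def B_def)
    have "run P (Suc (Suc 0)) (q, m) = (q + 2, m(?cnt := 0, ?bnd := B))"
      using code(1-4) m dD by (simp add: run_Suc step_instr)
    moreover have "sim N n (m(?cnt := 0, ?bnd := B)) (S 0)"
      using For.prems dD by (auto simp: S_def intro!: sim_reg)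
    moreover have "(m(?cnt := 0, ?bnd := B)) ?cnt = 0" "(m(?cnt := 0, ?bnd := B)) ?bnd = B"
      "\<forall>i<2*d. (m(?cnt := 0, ?bnd := B)) (N + 5 + i) = m (N + 5 + i)" "Suc (Suc 0) \<le> 0 * (tb X c + 5) + 2"
      by auto
    ultimately show ?case by blast
  next
    case (Suc j)
    then obtain t m1 where 1: "run P t (q, m) = (q + 2, m1)" "sim N n m1 (S j)" "m1 ?cnt = j" "m1 ?bnd = B"
      "t \<le> j * (tb X c + 5) + 2" "\<forall>i<2*d. m1 (N + 5 + i) = m (N + 5 + i)" by auto
    let ?m2 = "m1(N+2 := B - j, v := j)"
    have z: "m1 N = 0" using 1(2) by (auto simp: sim_def)
    have r2: "run P (Suc (Suc (Suc 0))) (q + 2, m1) = (q + 5, ?m2)"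
      using code(5-10) z 1(3,4) Suc.prems dD by (simp add: run_Suc step_instr eval_nat_numeral)
    have s2: "sim N n ?m2 (setv v j (S j))"
      using 1(2) For.prems(2) dD by (intro sim_setv sim_reg) auto
    have b2: "vr (setv v j (S j)) y \<le> X" if "y \<in> bounds c" for y
      using Sb[OF that] For.prems(6,7) that by auto
    have wc: "wfc N D c (Suc d)" and sd: "Suc d \<le> D" and bc: "bounds c \<inter> modv c = {}"
      using For.prems(1,6) by auto
    obtain t3 m3 where 3: "run P t3 (q + 5, ?m2) = (q + 5 + clen c, m3)" "sim N n m3 (sem n c (setv v j (S j)))"
      "t3 \<le> tb X c" "\<forall>i<2*Suc d. m3 (N + 5 + i) = ?m2 (N + 5 + i)"
      using For.IH[OF wc For.prems(2) sd s2 code(11) bc b2] by blast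
    have m3: "m3 (N+1) = 1" "m3 ?cnt = j" "m3 ?bnd = B" "\<forall>i<2*d. m3 (N + 5 + i) = m (N + 5 + i)"
      using 3(2) 3(4)[rule_format, of "2*d"] 3(4)[rule_format, of "2*d+1"] 3(4) 1(3,4,6) dD
      by (auto simp: sim_def add_ac)
    let ?m4 = "m3(?cnt := Suc j)"
    have r4: "run P (Suc (Suc 0)) (q + 5 + clen c, m3) = (q + 2, ?m4)"
      using code(12-15) m3(1-3) by (simp add: run_Suc step_instr eval_nat_numeral)
    have "sim N n ?m4 (S (Suc j))"
      using 3(2) For.prems(2) dD by (auto simp: S_def intro!: sim_reg)
    moreover have "run P (t + (Suc (Suc (Suc 0)) + (t3 + Suc (Suc 0)))) (q, m) = (q + 2, ?m4)"
      unfolding run_add 1(1) r2 3(1) r4 ..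
    moreover have "?m4 ?cnt = Suc j" "?m4 ?bnd = B" "\<forall>i<2*d. ?m4 (N + 5 + i) = m (N + 5 + i)"
      "t + (Suc (Suc (Suc 0)) + (t3 + Suc (Suc 0))) \<le> Suc j * (tb X c + 5) + 2"
      using m3 3(3) 1(5) by auto
    ultimately show ?case by blast
  qed
  obtain t m1 where 1: "run P t (q, m) = (q + 2, m1)" "sim N n m1 (S B)" "m1 ?cnt = B" "m1 ?bnd = B"
      "t \<le> B * (tb X c + 5) + 2" "\<forall>i<2*d. m1 (N + 5 + i) = m (N + 5 + i)" using loop[of B] by auto
  have "run P (Suc (Suc 0)) (q + 2, m1) = (q + 7 + clen c, m1(N+2 := 0))"
    using code(5-8) 1(3,4) by (simp add: run_Suc step_instr eval_nat_numeral)
  then have "run P (t + Suc (Suc 0)) (q, m) = (q + 7 + clen c, m1(N+2 := 0))"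
    unfolding run_add 1(1) .
  moreover have "sim N n (m1(N+2 := 0)) (sem n (For v x c) s)"
    using 1(2) For.prems(2) dD by (auto simp: S_def B_def intro!: sim_reg)
  moreover have "t + Suc (Suc 0) \<le> tb X (For v x c)"
    using 1(5) mult_le_mono1[OF BX, of "tb X c + 5"] by (simp only: tb.simps)
  ultimately show ?case using 1(6)
    by (intro compile_correctI[where t = "t + Suc (Suc 0)" and m' = "m1(N+2 := 0)"]) (auto simp: add_ac)
qed

section \<open>Initialisation and the complete machine program\<close>

definition boot :: "nat \<Rightarrow> nat \<Rightarrow> instr list" where
  "boot N D = [LoadC 1 (N + 5 + 2 * D), Sub 1 1 0, Jz 1 4, Halt, LoadC N 0, LoadC (N+1) 1,
     Add (N+2) 0 N, Add (N+4) 0 (N+1), Jz (N+2) 12, Add (N+4) (N+4) 0, Sub (N+2) (N+2) (N+1), Jmp 8]"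

definition ram_prog :: "nat \<Rightarrow> nat \<Rightarrow> com \<Rightarrow> instr list" where
  "ram_prog N D c = boot N D @ compile N c 0 12"

lemma length_boot: "length (boot N D) = 12"
  by (simp add: boot_def)

lemma code_at_ram_prog:
  "code_at (ram_prog N D c) 0 (boot N D)" "code_at (ram_prog N D c) 12 (compile N c 0 12)"
proof -
  have "code_at (ram_prog N D c) 0 (boot N D @ compile N c 0 12)"
    by (simp add: code_at_def ram_prog_def)
  then show "code_at (ram_prog N D c) 0 (boot N D)" "code_at (ram_prog N D c) 12 (compile N c 0 12)"
    by (simp_all add: code_at_append length_boot)
qed

lemma run_halted:
  assumes "halted P (run P t c)" "t \<le> t'"
  shows "run P t' c = run P t c"
proof -
  have "run P i d = d" if "halted P d" for i d
    by (induction i) (use that in \<open>auto simp: run_Suc step_def\<close>)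
  from this[OF assms(1), of "t' - t"] show ?thesis
    using assms(2) by (simp flip: run_add)
qed

text \<open>Cell 1 receives the truncated difference of N+5+2D and n. If it is nonzero, the
  registers would not fit below the raw zone and the machine stops at once; only boundedly many n
  are affected.\<close>

lemma boot_small:
  assumes "n < N + 5 + 2 * D"
  shows "halted (ram_prog N D c) (run (ram_prog N D c) 3 (0, input_mem n E))"
proof -
  have n: "input_mem n E 0 = n" by (simp add: input_mem_def)
  show ?thesis using code_at_ram_prog(1)[of N D c] assms
    by (simp add: boot_def code_at_Cons eval_nat_numeral run_Suc step_instr halted_def n)
qed

text \<open>Without a multiplication instruction, the base \<open>n * n + n + 1\<close> of the array
  zone is reached from n+1 by n additions of n. The arrays start as zero because all cells beyond
  the input matrix are zero.\<close>

lemma boot_large: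
  assumes "N + 5 + 2 * D \<le> n" "2 \<le> N"
  shows "\<exists>t m. run (ram_prog N D c) t (0, input_mem n E) = (12, m) \<and> t \<le> 4 * n + 10
           \<and> sim N n m \<lparr>vr = m, ar = (\<lambda>_ _. 0), rw = input_mem n E\<rparr>"
proof -
  define P where "P = ram_prog N D c"
  let ?m = "input_mem n E"
  have n: "?m 0 = n" by (simp add: input_mem_def)
  have code: "P ! 8 = Jz (N+2) 12" "P ! 9 = Add (N+4) (N+4) 0" "P ! 10 = Sub (N+2) (N+2) (N+1)" "P ! 11 = Jmp 8"
    "12 \<le> length P"
    using code_at_ram_prog(1)[of N D c] by (simp_all add: boot_def code_at_Cons P_def eval_nat_numeral)
  let ?mi = "?m(1 := 0, N := 0, N+1 := 1)"
  have r0: "run P 7 (0, ?m) = (8, ?mi(N+2 := n, N+4 := n + 1))"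
    using code_at_ram_prog(1)[of N D c] assms unfolding P_def[symmetric]
    by (simp add: boot_def code_at_Cons eval_nat_numeral run_Suc step_instr n fun_upd_twist)
  have loop: "run P (4 * j) (8, ?mi(N+2 := n, N+4 := n + 1)) = (8, ?mi(N+2 := n - j, N+4 := j * n + n + 1))"
    if "j \<le> n" for j
    using that
  proof (induction j)
    case (Suc j)
    have "run P (4 * Suc j) (8, ?mi(N+2 := n, N+4 := n + 1))
        = run P (Suc (Suc (Suc (Suc 0)))) (run P (4 * j) (8, ?mi(N+2 := n, N+4 := n + 1)))"
      unfolding run_add[symmetric] by (rule arg_cong[where f = "\<lambda>t. run P t _"]) simp
    also have "\<dots> = run P (Suc (Suc (Suc (Suc 0)))) (8, ?mi(N+2 := n - j, N+4 := j * n + n + 1))"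
      by (rule arg_cong[OF Suc.IH[OF Suc_leD[OF Suc.prems]]])
    also have "\<dots> = (8, ?mi(N+2 := n - Suc j, N+4 := Suc j * n + n + 1))"
      using code Suc.prems assms by (simp add: run_Suc step_instr n fun_upd_twist algebra_simps)
    finally show ?case .
  qed simp
  let ?mf = "?mi(N+2 := 0, N+4 := n * n + n + 1)"
  have "run P (7 + (4 * n + 1)) (0, ?m) = (12, ?mf)"
    unfolding run_add r0 loop[OF order.refl] using code by (simp add: run_Suc step_instr)
  moreover have "sim N n ?mf \<lparr>vr = ?mf, ar = (\<lambda>_ _. 0), rw = ?m\<rparr>"
    using assms n by (auto simp: sim_def raw_zone_def) (auto simp: input_mem_def)
  moreover have "7 + (4 * n + 1) \<le> 4 * n + 10" by simp
  ultimately show ?thesis unfolding P_def by blast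
qed

text \<open>\<open>pre\<close> may compute loop bounds that \<open>main\<close> uses. Treating the
  halves separately keeps the rule that no program modifies its own loop bounds, which may fail for
  the sequence as a whole, and lets the bound X for \<open>main\<close> be read off the state after
  \<open>pre\<close>.\<close>

theorem ram_prog_correct:
  assumes "N + 5 + 2 * D \<le> n" "2 \<le> N" "wfc N D pre 0" "wfc N D main 0"
    and "bounds pre \<subseteq> {0}" "bounds main \<inter> modv main = {}"
    and "\<And>s x. vr s 0 = n \<Longrightarrow> rw s = input_mem n E \<Longrightarrow> x \<in> bounds main \<Longrightarrow> vr (sem n pre s) x \<le> X"
    and "4 * n + 10 + tb n pre + tb X main \<le> T"
  shows "ram_halts_within (ram_prog N D (pre ;; main)) T n E"
    and "\<exists>s. vr s 0 = n \<and> ar s = (\<lambda>_ _. 0) \<and> rw s = input_mem n E \<and>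
      ram_output (ram_prog N D (pre ;; main)) T n E = {i. i < n \<and> rw (sem n main (sem n pre s)) (1 + n * n + i) \<noteq> 0}"
proof -
  define P where "P = ram_prog N D (pre ;; main)"
  obtain t0 m0 where 0: "run P t0 (0, input_mem n E) = (12, m0)" "t0 \<le> 4 * n + 10"
    "sim N n m0 \<lparr>vr = m0, ar = (\<lambda>_ _. 0), rw = input_mem n E\<rparr>"
    using boot_large[OF assms(1,2), of "pre ;; main" E] unfolding P_def by blast
  define s where "s = \<lparr>vr = m0, ar = (\<lambda>_ _. 0), rw = input_mem n E\<rparr>"
  have s: "vr s 0 = n" "ar s = (\<lambda>_ _. 0)" "rw s = input_mem n E"
    using 0(3) by (auto simp: s_def sim_def)
  have code: "code_at P 12 (compile N pre 0 12)" "code_at P (12 + clen pre) (compile N main 0 (12 + clen pre))"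
    using code_at_ram_prog(2)[of N D "pre ;; main"] by (auto simp: P_def code_at_append length_compile)
  have "0 \<notin> modv c" if "wfc N D c d" for c d using that
    by (induction c arbitrary: d) auto
  then have "bounds pre \<inter> modv pre = {}" using assms(3,5) by blast
  moreover have "vr s x \<le> n" if "x \<in> bounds pre" for x using that assms(5) s by auto
  ultimately obtain t1 m1 where 1: "run P t1 (12, m0) = (12 + clen pre, m1)" "sim N n m1 (sem n pre s)" "t1 \<le> tb n pre"
    using compile_correct[OF assms(3,1) _ 0(3)[folded s_def] code(1)] by blast
  obtain t2 m2 where 2: "run P t2 (12 + clen pre, m1) = (12 + clen pre + clen main, m2)"
    "sim N n m2 (sem n main (sem n pre s))" "t2 \<le> tb X main"
    using compile_correct[OF assms(4,1) _ 1(2) code(2) assms(6)] assms(7)[OF s(1,3)] by blast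
  have r: "run P (t0 + (t1 + t2)) (0, input_mem n E) = (12 + clen pre + clen main, m2)"
    unfolding run_add 0 1 2 ..
  have "length P = 12 + clen pre + clen main"
    by (simp add: P_def ram_prog_def boot_def length_compile)
  then have h: "halted P (run P (t0 + (t1 + t2)) (0, input_mem n E))"
    unfolding r by (simp add: halted_def)
  have T: "t0 + (t1 + t2) \<le> T" using 0(2) 1(3) 2(3) assms(8) by linarith
  note rT = run_halted[OF h T]
  show "ram_halts_within (ram_prog N D (pre ;; main)) T n E"
    using h rT by (simp add: ram_halts_within_def P_def[symmetric])
  have "m2 (1 + n * n + i) = rw (sem n main (sem n pre s)) (1 + n * n + i)" if "i < n" for i
  proof -
    have "raw_zone n (1 + n * n + i)"
      using that le_square[of n] unfolding raw_zone_def by linarith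
    then show ?thesis using 2(2) by (auto simp: sim_def)
  qed
  then have "ram_output P T n E = {i. i < n \<and> rw (sem n main (sem n pre s)) (1 + n * n + i) \<noteq> 0}"
    unfolding ram_output_def rT r by auto
  with s show "\<exists>s. vr s 0 = n \<and> ar s = (\<lambda>_ _. 0) \<and> rw s = input_mem n E \<and>
      ram_output (ram_prog N D (pre ;; main)) T n E = {i. i < n \<and> rw (sem n main (sem n pre s)) (1 + n * n + i) \<noteq> 0}"
    unfolding P_def by blast
qed

section \<open>The clique program\<close>

text \<open>Next to the invariant, the step may use that everything outside the frame sets of the
  body still has its value from before the loop. Invariants then speak only about what the loop
  changes.\<close>

lemma For_rule:
  assumes "I 0 s0"
    and step: "\<And>i s. i < vr s0 x \<Longrightarrow> (\<And>u. u \<notin> insert v (modv c) \<Longrightarrow> vr s u = vr s0 u) \<Longrightarrow>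
      (\<And>a. a \<notin> moda c \<Longrightarrow> ar s a = ar s0 a) \<Longrightarrow> (\<not> modr c \<Longrightarrow> rw s = rw s0) \<Longrightarrow> I i s \<Longrightarrow>
      I (Suc i) (sem n c (setv v i s))"
  shows "I (vr s0 x) (sem n (For v x c) s0)"
proof -
  let ?S = "\<lambda>j. fold (\<lambda>i s. sem n c (setv v i s)) [0..<j] s0"
  have fr: "vr (?S j) u = vr s0 u" if "u \<notin> insert v (modv c)" for u j
    using that by (intro fold_keep[where f = "\<lambda>s. vr s u"]) (simp add: vr_sem)
  have fa: "ar (?S j) a = ar s0 a" if "a \<notin> moda c" for a j
    using that by (intro fold_keep[where f = "\<lambda>s. ar s a"]) (simp add: ar_sem)
  have fw: "rw (?S j) = rw s0" if "\<not> modr c" for j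
    using that by (intro fold_keep[where f = "\<lambda>s. rw s"]) (simp add: rw_sem)
  have "I j (?S j)" if "j \<le> vr s0 x" for j
    using that
  proof (induction j)
    case 0 then show ?case using assms(1) by simp
  next
    case (Suc j)
    then show ?case using step[of j "?S j"] fr fa fw by simp
  qed
  then show ?thesis by simp
qed

text \<open>Edge sets are arbitrary here, so a singleton might be a member; the guard agrees with
  the off-diagonal test of \<open>input_mem\<close>.\<close>

definition adj :: "nat set set \<Rightarrow> nat \<Rightarrow> nat \<Rightarrow> bool" where
  "adj E u v \<longleftrightarrow> {u, v} \<in> E \<and> u \<noteq> v"

lemma adj_commute: "adj E u v \<longleftrightarrow> adj E v u"
  by (auto simp: adj_def insert_commute)

text \<open>Variable 0 is n; 2, 3, 4, 5, 6, 7 are constant after the preamble, with values 1, 0, t, h, the number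
  of branching codes, and the output address; 8 is the size of the best clique found so far. Array 0
  is the table of row offsets, 2 holds the guesses, 3 the neighbourhood V, 4 and 5 the positive and
  negative parts of the iterated vector (6 and 7 their successors), 8 the set T, 9 the set of vertices
  near T, and 10 its branch. Row 0 of the input is overwritten by the registers, so that an edge is
  always read from a row with nonzero index.\<close>

definition env :: "nat \<Rightarrow> nat set set \<Rightarrow> nat \<Rightarrow> nat \<Rightarrow> nat \<Rightarrow> st \<Rightarrow> bool" where
  "env n E t h Y s \<longleftrightarrow> vr s 0 = n \<and> vr s 2 = Suc 0 \<and> vr s 3 = 0 \<and> vr s 4 = t \<and> vr s 5 = h \<and> vr s 6 = Y
     \<and> vr s 7 = Suc (n * n) \<and> (\<forall>u<n. ar s 0 u = u * n)
     \<and> (\<forall>x. n < x \<longrightarrow> x \<le> n * n \<longrightarrow> rw s x = input_mem n E x)"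

lemma env_cong:
  assumes "\<And>u. u \<in> {0,2,3,4,5,6,7} \<Longrightarrow> vr s u = vr s' u" "ar s 0 = ar s' 0" "rw s = rw s'"
  shows "env n E t h Y s \<longleftrightarrow> env n E t h Y s'"
  using assms by (simp add: env_def)

lemma env_sem:
  assumes "modv c \<inter> {0,2,3,4,5,6,7} = {}" "0 \<notin> moda c" "\<not> modr c"
  shows "env n E t h Y (sem n c s) \<longleftrightarrow> env n E t h Y s"
  using assms by (intro env_cong vr_sem ar_sem rw_sem) auto

lemma env_setv [simp]:
  "v \<notin> {0,2,3,4,5,6,7} \<Longrightarrow> env n E t h Y (setv v x s) \<longleftrightarrow> env n E t h Y s"
  by (intro env_cong) auto

definition edge_c :: "nat \<Rightarrow> nat \<Rightarrow> com" where
  "edge_c x y = IfZ x (Plus 14 y 3;; Plus 15 x 3) (Plus 14 x 3;; Plus 15 y 3);;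
     Get 16 0 14;; Plus 16 16 15;; Plus 16 16 2;; RawGet 13 16"

lemma mod_edge_c [simp]:
  "modv (edge_c x y) = {13, 14, 15, 16}" "moda (edge_c x y) = {}" "\<not> modr (edge_c x y)"
  "bounds (edge_c x y) = {}"
  by (auto simp: edge_c_def)

lemma input_mem_edge:
  assumes "a < n" "b < n"
  shows "input_mem n E (Suc (a * n + b)) = of_bool (adj E a b)"
proof -
  have "a * n + b < n * n"
  proof -
    have "a * n + b < a * n + n" using assms by simp
    also have "\<dots> = Suc a * n" by simp
    also have "\<dots> \<le> n * n" using assms by (intro mult_le_mono1) simp
    finally show ?thesis .
  qed
  moreover have "(a * n + b) div n = a" "(a * n + b) mod n = b" using assms by auto
  ultimately show ?thesis by (auto simp: input_mem_def adj_def)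
qed

text \<open>An endpoint equal to 0 is put into the column position. If both are 0, the address 1
  lies outside the raw zone and the guarded read returns 0, as it should.\<close>

lemma edge_c:
  assumes "env n E t h Y s" "vr s x < n" "vr s y < n" "x \<notin> {14,15}" "y \<notin> {14,15}"
  shows "vr (sem n (edge_c x y) s) 13 = of_bool (adj E (vr s x) (vr s y))"
proof -
  define a b where "a = (if vr s x = 0 then vr s y else vr s x)" and "b = (if vr s x = 0 then 0 else vr s y)"
  have ab: "a < n" "b < n" "{a, b} = {vr s x, vr s y}" "a = 0 \<Longrightarrow> b = 0"
    using assms(2,3) by (auto simp: a_def b_def)
  have *: "vr (sem n (edge_c x y) s) 13 = (if raw_zone n (Suc (a * n + b)) then rw s (Suc (a * n + b)) else 0)"
    using assms ab(1,2) by (auto simp: edge_c_def env_def a_def b_def)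
  have adj: "adj E (vr s x) (vr s y) = adj E a b"
    using ab(3) by (auto simp: a_def b_def adj_commute)
  show ?thesis
  proof (cases "a = 0")
    case True
    then show ?thesis using * ab(4) adj ab(1) by (simp add: raw_zone_def adj_def)
  next
    case False
    have "a * n + b < a * n + n" using ab by simp
    also have "\<dots> = Suc a * n" by simp
    also have "\<dots> \<le> n * n" using ab by (intro mult_le_mono1) simp
    finally have 1: "a * n + b < n * n" .
    have 2: "n \<le> a * n" using False by simp
    have 3: "n < Suc (a * n + b)" "Suc (a * n + b) \<le> n * n" using 1 2 by linarith+
    then have "raw_zone n (Suc (a * n + b))" "rw s (Suc (a * n + b)) = input_mem n E (Suc (a * n + b))"
      using assms(1) unfolding raw_zone_def env_def by (linarith, blast)
    then show ?thesis using * adj input_mem_edge[OF ab(1,2)] by simp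
  qed
qed

section \<open>Common neighbourhood and powers of the centred matrix\<close>

definition nbh_c :: com where
  "nbh_c = For 10 0 (Put 3 10 2;; For 11 4 (Get 22 2 11;; edge_c 10 22;; IfZ 13 (Put 3 10 3) Skip))"

definition nbh :: "nat \<Rightarrow> nat set set \<Rightarrow> nat \<Rightarrow> (nat \<Rightarrow> nat) \<Rightarrow> nat set" where
  "nbh n E t g = {v. v < n \<and> (\<forall>i<t. adj E v (g i))}"

lemma nbh_c:
  assumes "env n E t h Y s" "\<And>i. i < t \<Longrightarrow> ar s 2 i < n"
  shows "\<forall>v<n. ar (sem n nbh_c s) 3 v = of_bool (v \<in> nbh n E t (ar s 2))"
proof -
  let ?in = "Get 22 2 11;; edge_c 10 22;; IfZ 13 (Put 3 10 3) Skip"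
  have inner: "ar (sem n (For 11 4 ?in) s1) 3 v = (if v = w then of_bool (\<forall>i<t. adj E w (ar s 2 i)) else ar s1 3 v)"
    if s1: "env n E t h Y s1" "ar s1 2 = ar s 2" "vr s1 10 = w" "w < n" "ar s1 3 w = Suc 0" for s1 w v
  proof -
    define I where "I i s' \<longleftrightarrow> (\<forall>v. ar s' 3 v = (if v = w then of_bool (\<forall>i'<i. adj E w (ar s 2 i')) else ar s1 3 v))" for i :: nat and s' :: st
    have "I (vr s1 4) (sem n (For 11 4 ?in) s1)"
    proof (rule For_rule)
      show "I 0 s1" using s1(5) by (simp add: I_def)
    next
      fix i s2
      assume i: "i < vr s1 4" and fr: "\<And>u. u \<notin> insert 11 (modv ?in) \<Longrightarrow> vr s2 u = vr s1 u"
        "\<And>a. a \<notin> moda ?in \<Longrightarrow> ar s2 a = ar s1 a" "\<not> modr ?in \<Longrightarrow> rw s2 = rw s1" and I: "I i s2"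
      have e2: "env n E t h Y s2" using s1(1) fr by (subst env_cong[of _ s1]) auto
      have it: "i < t" using i s1(1) by (simp add: env_def)
      let ?s3 = "setv 22 (ar s 2 i) (setv 11 i s2)"
      have s3: "sem n (Get 22 2 11) (setv 11 i s2) = ?s3" using fr(2)[of 2] s1(2) by simp
      have "vr (sem n (edge_c 10 22) ?s3) 13 = of_bool (adj E w (ar s 2 i))"
        using edge_c[of n E t h Y ?s3 10 22] e2 assms(2)[OF it] s1(3,4) fr(1)[of 10] by simp
      moreover have "vr s2 3 = 0" using e2 by (simp add: env_def)
      ultimately show "I (Suc i) (sem n ?in (setv 11 i s2))"
        using I s3 fr(1)[of 10] s1(3) by (auto simp: I_def vr_sem ar_sem less_Suc_eq)
    qed
    then show ?thesis using s1(1) by (simp add: I_def env_def)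
  qed
  define J where "J i s' \<longleftrightarrow> (\<forall>v<i. ar s' 3 v = of_bool (\<forall>i<t. adj E v (ar s 2 i)))" for i :: nat and s' :: st
  have "J (vr s 0) (sem n nbh_c s)"
    unfolding nbh_c_def
  proof (rule For_rule)
    show "J 0 s" by (simp add: J_def)
  next
    fix i s2
    let ?c = "Put 3 10 2;; For 11 4 ?in"
    assume i: "i < vr s 0" and fr: "\<And>u. u \<notin> insert 10 (modv ?c) \<Longrightarrow> vr s2 u = vr s u"
        "\<And>a. a \<notin> moda ?c \<Longrightarrow> ar s2 a = ar s a" "\<not> modr ?c \<Longrightarrow> rw s2 = rw s" and J: "J i s2"
    let ?s3 = "sem n (Put 3 10 2) (setv 10 i s2)"
    have e2: "env n E t h Y s2" using assms(1) fr by (subst env_cong[of _ s]) auto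
    then have e3: "env n E t h Y ?s3" by (subst env_cong[of _ s2]) auto
    have "ar (sem n (For 11 4 ?in) ?s3) 3 v = (if v = i then of_bool (\<forall>i'<t. adj E i (ar s 2 i')) else ar ?s3 3 v)" for v
      by (rule inner[OF e3]) (use fr(2)[of 2] i assms(1) e2 in \<open>auto simp: env_def\<close>)
    then show "J (Suc i) (sem n ?c (setv 10 i s2))" using J
      by (auto simp: J_def less_Suc_eq)
  qed
  then show ?thesis using assms(1) by (auto simp: J_def env_def nbh_def)
qed

text \<open>Entries t, t+1 and t+2 of the guess array are the numerator j of the guessed density
  j/n, the column i of the matrix power, and the vertex l whose entry is the threshold. The
  iteration starts from the unit vector of i.\<close>

definition start_c :: "nat \<Rightarrow> com" where
  "start_c t = Const 17 t;; Get 25 2 17;; Const 17 (t+1);; Get 12 2 17;; Const 17 (t+2);; Get 26 2 17;;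
     For 10 0 (Put 4 10 3;; Put 5 10 3);; Put 4 12 2"

lemma start_c:
  assumes "env n E t h Y s"
  shows "vr (sem n (start_c t) s) 25 = ar s 2 t" "vr (sem n (start_c t) s) 26 = ar s 2 (t + 2)"
    "\<forall>v<n. ar (sem n (start_c t) s) 4 v = of_bool (v = ar s 2 (t + 1)) \<and> ar (sem n (start_c t) s) 5 v = 0"
proof -
  let ?c = "Put 4 10 3;; Put 5 10 3"
  have *: "\<forall>v<n. ar (sem n (For 10 0 ?c) s1) 4 v = 0 \<and> ar (sem n (For 10 0 ?c) s1) 5 v = 0"
    if s1: "env n E t h Y s1" for s1
  proof -
    define I where "I i s' \<longleftrightarrow> (\<forall>v<i. ar s' 4 v = 0 \<and> ar s' 5 v = 0)" for i :: nat and s' :: st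
    have "I (vr s1 0) (sem n (For 10 0 ?c) s1)"
    proof (rule For_rule)
      show "I 0 s1" by (simp add: I_def)
    next
      fix i s2
      assume fr: "\<And>u. u \<notin> insert 10 (modv ?c) \<Longrightarrow> vr s2 u = vr s1 u" and I: "I i s2"
      then show "I (Suc i) (sem n ?c (setv 10 i s2))"
        using s1 by (auto simp: I_def less_Suc_eq env_def)
    qed
    then show ?thesis using s1 by (simp add: I_def env_def)
  qed
  let ?s1 = "sem n (Const 17 t;; Get 25 2 17;; Const 17 (t+1);; Get 12 2 17;; Const 17 (t+2);; Get 26 2 17) s"
  have e: "env n E t h Y ?s1" using assms by (simp add: env_sem)
  have v: "vr ?s1 25 = ar s 2 t" "vr ?s1 26 = ar s 2 (t + 2)" "vr ?s1 12 = ar s 2 (t + 1)" "vr ?s1 2 = Suc 0"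
    using assms by (simp_all add: env_def)
  have eq: "sem n (start_c t) s = sem n (Put 4 12 2) (sem n (For 10 0 ?c) ?s1)"
    by (simp add: start_c_def)
  show "vr (sem n (start_c t) s) 25 = ar s 2 t" "vr (sem n (start_c t) s) 26 = ar s 2 (t + 2)"
    unfolding eq v[symmetric] by (rule vr_sem[where c = "For 10 0 ?c;; Put 4 12 2", unfolded sem.simps(9)]; simp)+
  have "vr (sem n (For 10 0 ?c) ?s1) 12 = ar s 2 (t + 1)" "vr (sem n (For 10 0 ?c) ?s1) 2 = Suc 0"
    using v by (subst vr_sem; simp)+
  then show "\<forall>v<n. ar (sem n (start_c t) s) 4 v = of_bool (v = ar s 2 (t + 1)) \<and> ar (sem n (start_c t) s) 5 v = 0"
    unfolding eq using *[OF e] by (simp del: sem.simps(11,9) add: sem.simps(6))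
qed

text \<open>Multiplication by one entry of the scaled matrix, n - j for an edge and -j otherwise.
  Over n rounds, an edge adds both parts of the vector in every round, while the first j rounds also
  add them with the parts exchanged, which amounts to a subtraction.\<close>

definition acc_c :: com where
  "acc_c = edge_c 12 10;; Get 21 4 10;; Get 22 5 10;;
     For 23 0 ((IfZ 13 Skip (Plus 19 19 21;; Plus 20 20 22));; Minus 24 25 23;;
       IfZ 24 Skip (Plus 19 19 22;; Plus 20 20 21))"

lemma mod_acc_c [simp]:
  "modv acc_c = {13,14,15,16,19,20,21,22,23,24}" "moda acc_c = {}" "\<not> modr acc_c" "bounds acc_c = {0}"
  by (auto simp: acc_c_def)

lemma acc_c:
  assumes "env n E t h Y s" "vr s 12 < n" "vr s 10 < n" "vr s 25 \<le> n"
  shows "vr (sem n acc_c s) 19 = vr s 19 + (n * of_bool (adj E (vr s 12) (vr s 10)) * ar s 4 (vr s 10) + vr s 25 * ar s 5 (vr s 10))"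
    "vr (sem n acc_c s) 20 = vr s 20 + (n * of_bool (adj E (vr s 12) (vr s 10)) * ar s 5 (vr s 10) + vr s 25 * ar s 4 (vr s 10))"
proof -
  let ?c = "(IfZ 13 Skip (Plus 19 19 21;; Plus 20 20 22));; Minus 24 25 23;;
       IfZ 24 Skip (Plus 19 19 22;; Plus 20 20 21)"
  let ?s0 = "sem n (edge_c 12 10) s"
  let ?e = "of_bool (adj E (vr s 12) (vr s 10)) :: nat" and ?p = "ar s 4 (vr s 10)" and ?q = "ar s 5 (vr s 10)"
  let ?s1 = "setv 22 ?q (setv 21 ?p ?s0)"
  have eq: "sem n acc_c s = sem n (For 23 0 ?c) ?s1"
    by (simp add: acc_c_def ar_sem vr_sem)
  have e13: "vr ?s0 13 = ?e" using assms by (intro edge_c) auto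
  define I where "I i s' \<longleftrightarrow> vr s' 19 = vr s 19 + (i * ?e * ?p + min i (vr s 25) * ?q) \<and>
      vr s' 20 = vr s 20 + (i * ?e * ?q + min i (vr s 25) * ?p)" for i :: nat and s' :: st
  have "I (vr ?s1 0) (sem n (For 23 0 ?c) ?s1)"
  proof (rule For_rule)
    show "I 0 ?s1" by (simp add: I_def vr_sem)
  next
    fix i s2
    assume fr: "\<And>u. u \<notin> insert 23 (modv ?c) \<Longrightarrow> vr s2 u = vr ?s1 u" and I: "I i s2"
    have v: "vr s2 13 = ?e" "vr s2 21 = ?p" "vr s2 22 = ?q" "vr s2 25 = vr s 25"
      using fr[of 13] fr[of 21] fr[of 22] fr[of 25] e13 by (simp_all add: vr_sem)
    show "I (Suc i) (sem n ?c (setv 23 i s2))"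
      using I by (cases "vr s 25 \<le> i") (auto simp: I_def v min_def algebra_simps not_le split: if_splits)
  qed
  moreover have "vr ?s1 0 = n" using assms(1) by (simp add: vr_sem env_def)
  ultimately have "I n (sem n acc_c s)" by (simp only: eq)
  then show "vr (sem n acc_c s) 19 = vr s 19 + (n * ?e * ?p + vr s 25 * ?q)"
    "vr (sem n acc_c s) 20 = vr s 20 + (n * ?e * ?q + vr s 25 * ?p)"
    using assms(4) by (simp_all add: I_def min_def)
qed

definition row_c :: com where
  "row_c = Const 19 0;; Const 20 0;; Get 24 3 12;; IfZ 24 Skip (For 10 0 acc_c);; Put 6 12 19;; Put 7 12 20"

lemma mod_row_c [simp]:
  "modv row_c = {10,13,14,15,16,19,20,21,22,23,24}" "moda row_c = {6,7}" "\<not> modr row_c" "bounds row_c = {0}"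
  by (auto simp: row_c_def)

text \<open>The positive part of a row product: -j times the vector contributes j times its negative
  part. Exchanging p and q gives the negative part of the same product.\<close>

definition row_sum :: "nat \<Rightarrow> nat set set \<Rightarrow> nat \<Rightarrow> (nat \<Rightarrow> nat) \<Rightarrow> (nat \<Rightarrow> nat) \<Rightarrow> nat \<Rightarrow> nat" where
  "row_sum n E j p q u = (\<Sum>v<n. n * of_bool (adj E u v) * p v + j * q v)"

lemma row_c:
  assumes "env n E t h Y s" "vr s 12 < n" "vr s 25 \<le> n"
  shows "ar (sem n row_c s) 6 = (ar s 6)(vr s 12 := (if ar s 3 (vr s 12) = 0 then 0 else row_sum n E (vr s 25) (ar s 4) (ar s 5) (vr s 12)))"
    "ar (sem n row_c s) 7 = (ar s 7)(vr s 12 := (if ar s 3 (vr s 12) = 0 then 0 else row_sum n E (vr s 25) (ar s 5) (ar s 4) (vr s 12)))"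
proof -
  let ?s1 = "setv 24 (ar s 3 (vr s 12)) (setv 20 0 (setv 19 0 s))"
  define I where "I i s' \<longleftrightarrow> vr s' 19 = (\<Sum>v<i. n * of_bool (adj E (vr s 12) v) * ar s 4 v + vr s 25 * ar s 5 v) \<and>
      vr s' 20 = (\<Sum>v<i. n * of_bool (adj E (vr s 12) v) * ar s 5 v + vr s 25 * ar s 4 v)" for i :: nat and s' :: st
  have "I (vr ?s1 0) (sem n (For 10 0 acc_c) ?s1)"
  proof (rule For_rule)
    show "I 0 ?s1" by (simp add: I_def)
  next
    fix i s2
    assume i: "i < vr ?s1 0" and fr: "\<And>u. u \<notin> insert 10 (modv acc_c) \<Longrightarrow> vr s2 u = vr ?s1 u"
      "\<And>a. a \<notin> moda acc_c \<Longrightarrow> ar s2 a = ar ?s1 a" "\<not> modr acc_c \<Longrightarrow> rw s2 = rw ?s1" and I: "I i s2"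
    have "env n E t h Y s2" using assms(1) fr by (subst env_cong[of _ s]) auto
    then have e2: "env n E t h Y (setv 10 i s2)" by simp
    show "I (Suc i) (sem n acc_c (setv 10 i s2))"
      using acc_c[OF e2] I i assms fr(1)[of 12] fr(1)[of 25] fr(2) by (simp add: I_def env_def)
  qed
  then have I: "I n (sem n (For 10 0 acc_c) ?s1)" using assms(1) by (simp add: env_def)
  have fr: "vr (sem n (For 10 0 acc_c) ?s1) 12 = vr s 12" "ar (sem n (For 10 0 acc_c) ?s1) = ar s"
    by (subst vr_sem; simp) (auto simp: ar_sem fun_eq_iff simp del: sem.simps)
  show "ar (sem n row_c s) 6 = (ar s 6)(vr s 12 := (if ar s 3 (vr s 12) = 0 then 0 else row_sum n E (vr s 25) (ar s 4) (ar s 5) (vr s 12)))"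
    "ar (sem n row_c s) 7 = (ar s 7)(vr s 12 := (if ar s 3 (vr s 12) = 0 then 0 else row_sum n E (vr s 25) (ar s 5) (ar s 4) (vr s 12)))"
    using I fr by (simp_all add: row_c_def I_def row_sum_def del: sem.simps(11))
qed

definition iter_c :: com where
  "iter_c = For 12 0 row_c;; For 10 0 (Get 24 6 10;; Put 4 10 24;; Get 24 7 10;; Put 5 10 24)"

lemma mod_iter_c [simp]:
  "modv iter_c = {10,12,13,14,15,16,19,20,21,22,23,24}" "moda iter_c = {4,5,6,7}" "\<not> modr iter_c" "bounds iter_c = {0}"
  by (auto simp: iter_c_def)

lemma iter_c:
  assumes "env n E t h Y s" "vr s 25 \<le> n"
  shows "\<forall>u<n. ar (sem n iter_c s) 4 u = (if ar s 3 u = 0 then 0 else row_sum n E (vr s 25) (ar s 4) (ar s 5) u)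
     \<and> ar (sem n iter_c s) 5 u = (if ar s 3 u = 0 then 0 else row_sum n E (vr s 25) (ar s 5) (ar s 4) u)"
proof -
  define I where "I i s' \<longleftrightarrow> (\<forall>u<i. ar s' 6 u = (if ar s 3 u = 0 then 0 else row_sum n E (vr s 25) (ar s 4) (ar s 5) u)
     \<and> ar s' 7 u = (if ar s 3 u = 0 then 0 else row_sum n E (vr s 25) (ar s 5) (ar s 4) u))" for i :: nat and s' :: st
  have "I (vr s 0) (sem n (For 12 0 row_c) s)"
  proof (rule For_rule)
    show "I 0 s" by (simp add: I_def)
  next
    fix i s2
    assume i: "i < vr s 0" and fr: "\<And>u. u \<notin> insert 12 (modv row_c) \<Longrightarrow> vr s2 u = vr s u"
      "\<And>a. a \<notin> moda row_c \<Longrightarrow> ar s2 a = ar s a" "\<not> modr row_c \<Longrightarrow> rw s2 = rw s" and I: "I i s2"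
    have "env n E t h Y s2" using assms(1) fr by (subst env_cong[of _ s]) auto
    then have e2: "env n E t h Y (setv 12 i s2)" by simp
    show "I (Suc i) (sem n row_c (setv 12 i s2))"
      using row_c[OF e2] I i assms fr(1)[of 25] fr(2) by (auto simp: I_def env_def less_Suc_eq)
  qed
  moreover define s1 where "s1 = sem n (For 12 0 row_c) s"
  ultimately have I: "I n s1" using assms(1) by (simp add: env_def)
  have s10: "vr s1 0 = n" unfolding s1_def using assms(1) by (subst vr_sem) (simp_all add: env_def)
  let ?c = "Get 24 6 10;; Put 4 10 24;; Get 24 7 10;; Put 5 10 24"
  define J where "J i s' \<longleftrightarrow> (\<forall>u<i. ar s' 4 u = ar s1 6 u \<and> ar s' 5 u = ar s1 7 u)" for i :: nat and s' :: st
  have "J (vr s1 0) (sem n (For 10 0 ?c) s1)"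
  proof (rule For_rule)
    show "J 0 s1" by (simp add: J_def)
  next
    fix i s2
    assume fr: "\<And>a. a \<notin> moda ?c \<Longrightarrow> ar s2 a = ar s1 a" and J: "J i s2"
    then show "J (Suc i) (sem n ?c (setv 10 i s2))"
      by (auto simp: J_def less_Suc_eq)
  qed
  then show ?thesis using I s10 by (simp add: iter_c_def I_def J_def s1_def[symmetric] del: sem.simps(11))
qed

text \<open>For i in V this is column i of the r-th power of n times the matrix A - j/n restricted
  to V, where A is the adjacency matrix. The diagonal is -j rather than 0; this difference is later
  counted as noise.\<close>

primrec pw :: "nat \<Rightarrow> nat set set \<Rightarrow> nat set \<Rightarrow> nat \<Rightarrow> nat \<Rightarrow> nat \<Rightarrow> nat \<Rightarrow> int" where
  "pw n E V j i 0 = (\<lambda>u. of_bool (u = i))"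
| "pw n E V j i (Suc r) = (\<lambda>u. if u \<in> V then \<Sum>v<n. (int n * of_bool (adj E u v) - int j) * pw n E V j i r v else 0)"

definition power_c :: com where
  "power_c = For 18 0 iter_c"

lemma power_c:
  assumes "env n E t h Y s" "vr s 25 \<le> n" "\<forall>v<n. ar s 3 v = of_bool (v \<in> V)"
    "\<forall>v<n. ar s 4 v = of_bool (v = i) \<and> ar s 5 v = 0"
  shows "\<forall>u<n. int (ar (sem n power_c s) 4 u) - int (ar (sem n power_c s) 5 u) = pw n E V (vr s 25) i n u"
proof -
  define I where "I r s' \<longleftrightarrow> (\<forall>u<n. int (ar s' 4 u) - int (ar s' 5 u) = pw n E V (vr s 25) i r u)" for r :: nat and s' :: st
  have "I (vr s 0) (sem n power_c s)"
    unfolding power_c_def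
  proof (rule For_rule)
    show "I 0 s" using assms(4) by (simp add: I_def)
  next
    fix r s2
    assume fr: "\<And>u. u \<notin> insert 18 (modv iter_c) \<Longrightarrow> vr s2 u = vr s u"
      "\<And>a. a \<notin> moda iter_c \<Longrightarrow> ar s2 a = ar s a" "\<not> modr iter_c \<Longrightarrow> rw s2 = rw s" and I: "I r s2"
    have "env n E t h Y s2" using assms(1) fr by (subst env_cong[of _ s]) auto
    then have e2: "env n E t h Y (setv 18 r s2)" by simp
    have rs: "int (row_sum n E j (ar s2 4) (ar s2 5) u) - int (row_sum n E j (ar s2 5) (ar s2 4) u)
        = (\<Sum>v<n. (int n * of_bool (adj E u v) - int j) * pw n E V (vr s 25) i r v)" for j u
      using I by (auto simp: row_sum_def I_def sum_subtractf[symmetric] algebra_simps intro!: sum.cong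
          simp del: sum_subtractf split: if_splits)
    show "I (Suc r) (sem n iter_c (setv 18 r s2))"
      using iter_c[OF e2] assms(2,3) fr(1)[of 25] fr(2)[of 3] rs by (auto simp: I_def)
  qed
  then show ?thesis using assms(1) by (simp add: I_def env_def)
qed

section \<open>Threshold set and the vertices adjacent to most of it\<close>

definition thr_c :: com where
  "thr_c = Get 34 4 26;; Get 35 5 26;; For 10 0 (Get 24 3 10;; IfZ 24 (Put 8 10 3)
     (Get 21 4 10;; Get 22 5 10;; Plus 21 21 35;; Plus 22 22 34;; Minus 24 22 21;; IfZ 24 (Put 8 10 2) (Put 8 10 3)))"

lemma mod_thr_c [simp]:
  "modv thr_c = {10,21,22,24,34,35}" "moda thr_c = {8}" "\<not> modr thr_c" "bounds thr_c = {0}"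
  by (auto simp: thr_c_def)

text \<open>Differences of natural numbers are compared by moving the negative parts across, so that
  one truncated subtraction decides the inequality.\<close>

lemma thr_c:
  assumes "env n E t h Y s" "\<forall>v<n. ar s 3 v = of_bool (v \<in> V)" "vr s 26 < n"
    "\<forall>v<n. int (ar s 4 v) - int (ar s 5 v) = f v"
  shows "\<forall>v<n. ar (sem n thr_c s) 8 v = of_bool (v \<in> V \<and> f (vr s 26) \<le> f v)"
proof -
  let ?l = "vr s 26"
  let ?s1 = "setv 35 (ar s 5 ?l) (setv 34 (ar s 4 ?l) s)"
  let ?c = "Get 24 3 10;; IfZ 24 (Put 8 10 3)
     (Get 21 4 10;; Get 22 5 10;; Plus 21 21 35;; Plus 22 22 34;; Minus 24 22 21;; IfZ 24 (Put 8 10 2) (Put 8 10 3))"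
  define I where "I i s' \<longleftrightarrow> (\<forall>v<i. ar s' 8 v = of_bool (v \<in> V \<and> f ?l \<le> f v))" for i :: nat and s' :: st
  have "I (vr ?s1 0) (sem n (For 10 0 ?c) ?s1)"
  proof (rule For_rule)
    show "I 0 ?s1" by (simp add: I_def)
  next
    fix i s2
    assume i: "i < vr ?s1 0" and fr: "\<And>u. u \<notin> insert 10 (modv ?c) \<Longrightarrow> vr s2 u = vr ?s1 u"
      "\<And>a. a \<notin> moda ?c \<Longrightarrow> ar s2 a = ar ?s1 a" and I: "I i s2"
    have v: "vr s2 34 = ar s 4 ?l" "vr s2 35 = ar s 5 ?l" "vr s2 2 = Suc 0" "vr s2 3 = 0" "i < n"
      "ar s2 3 = ar s 3" "ar s2 4 = ar s 4" "ar s2 5 = ar s 5"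
      using fr i assms(1) by (auto simp: env_def)
    have "(ar s 5 i + ar s 4 ?l) - (ar s 4 i + ar s 5 ?l) = 0 \<longleftrightarrow> f ?l \<le> f i"
      using assms(4)[rule_format, of i] assms(4)[rule_format, of ?l] v(5) assms(3) by linarith
    then show "I (Suc i) (sem n ?c (setv 10 i s2))"
      using I assms(2) v by (auto simp: I_def less_Suc_eq)
  qed
  then show ?thesis using assms(1) by (simp add: thr_c_def I_def env_def)
qed

definition sz_c :: "nat \<Rightarrow> com" where
  "sz_c a = Const 27 0;; For 10 0 (Get 24 a 10;; Plus 27 27 24)"

lemma mod_sz_c [simp]:
  "modv (sz_c a) = {10,24,27}" "moda (sz_c a) = {}" "\<not> modr (sz_c a)" "bounds (sz_c a) = {0}"
  by (auto simp: sz_c_def)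

lemma sz_c:
  assumes "env n E t h Y s" "\<forall>v<n. ar s a v = of_bool (v \<in> T)"
  shows "vr (sem n (sz_c a) s) 27 = card {v. v < n \<and> v \<in> T}"
proof -
  let ?c = "Get 24 a 10;; Plus 27 27 24"
  define I where "I i s' \<longleftrightarrow> vr s' 27 = card {v. v < i \<and> v \<in> T}" for i :: nat and s' :: st
  have "I (vr (setv 27 0 s) 0) (sem n (For 10 0 ?c) (setv 27 0 s))"
  proof (rule For_rule)
    show "I 0 (setv 27 0 s)" by (simp add: I_def)
  next
    fix i s2
    assume i: "i < vr (setv 27 0 s) 0" and fr: "\<And>a. a \<notin> moda ?c \<Longrightarrow> ar s2 a = ar (setv 27 0 s) a" and I: "I i s2"
    have "{v. v < Suc i \<and> v \<in> T} = (if i \<in> T then insert i {v. v < i \<and> v \<in> T} else {v. v < i \<and> v \<in> T})"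
      by (auto simp: less_Suc_eq)
    then have "card {v. v < Suc i \<and> v \<in> T} = card {v. v < i \<and> v \<in> T} + of_bool (i \<in> T)"
      by simp
    then show "I (Suc i) (sem n ?c (setv 10 i s2))"
      using I assms fr[of a] i by (simp add: I_def env_def)
  qed
  then show ?thesis using assms(1) by (simp add: sz_c_def I_def env_def)
qed

text \<open>Since \<open>Minus\<close> truncates, the sum of both differences is zero exactly for
  equal vertices. A vertex is thus never counted as its own non-neighbour.\<close>

definition nonadj_c :: "com \<Rightarrow> com" where
  "nonadj_c c = edge_c 12 10;; IfZ 13 (Minus 24 12 10;; Minus 33 10 12;; Plus 24 24 33;; IfZ 24 Skip c) Skip"

lemma mod_nonadj_c [simp]:
  "modv (nonadj_c c) = {13,14,15,16,24,33} \<union> modv c" "moda (nonadj_c c) = moda c" "modr (nonadj_c c) = modr c"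
  "bounds (nonadj_c c) = bounds c"
  by (auto simp: nonadj_c_def)

definition nonadj_s :: "nat \<Rightarrow> st \<Rightarrow> st" where
  "nonadj_s n s = sem n (edge_c 12 10;; Minus 24 12 10;; Minus 33 10 12;; Plus 24 24 33) s"

lemma nonadj_s:
  "u \<notin> {13,14,15,16,24,33} \<Longrightarrow> vr (nonadj_s n s) u = vr s u" "ar (nonadj_s n s) = ar s" "rw (nonadj_s n s) = rw s"
  "env n E t h Y (nonadj_s n s) = env n E t h Y s"
proof -
  show 1: "u \<notin> {13,14,15,16,24,33} \<Longrightarrow> vr (nonadj_s n s) u = vr s u" for u
    unfolding nonadj_s_def by (rule vr_sem) auto
  show 2: "ar (nonadj_s n s) = ar s" "rw (nonadj_s n s) = rw s"
    unfolding nonadj_s_def by (auto simp: ar_sem fun_eq_iff rw_sem simp del: sem.simps)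
  show "env n E t h Y (nonadj_s n s) = env n E t h Y s"
    using 1 2 by (intro env_cong) auto
qed

lemma nonadj_c:
  assumes "env n E t h Y s" "vr s 12 < n" "vr s 10 < n"
  shows "vr s 12 \<noteq> vr s 10 \<Longrightarrow> \<not> adj E (vr s 12) (vr s 10) \<Longrightarrow> sem n (nonadj_c c) s = sem n c (nonadj_s n s)"
    and "vr s 12 = vr s 10 \<or> adj E (vr s 12) (vr s 10) \<Longrightarrow>
      (\<forall>u. u \<notin> {13,14,15,16,24,33} \<longrightarrow> vr (sem n (nonadj_c c) s) u = vr s u)
      \<and> ar (sem n (nonadj_c c) s) = ar s \<and> rw (sem n (nonadj_c c) s) = rw s"
proof -
  have e: "vr (sem n (edge_c 12 10) s) 13 = of_bool (adj E (vr s 12) (vr s 10))"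
    using assms by (intro edge_c) auto
  have v: "vr (sem n (edge_c 12 10) s) 12 = vr s 12" "vr (sem n (edge_c 12 10) s) 10 = vr s 10"
    by (auto simp: vr_sem)
  show "vr s 12 \<noteq> vr s 10 \<Longrightarrow> \<not> adj E (vr s 12) (vr s 10) \<Longrightarrow> sem n (nonadj_c c) s = sem n c (nonadj_s n s)"
    using e v by (auto simp: nonadj_c_def nonadj_s_def)
  assume "vr s 12 = vr s 10 \<or> adj E (vr s 12) (vr s 10)"
  then have "sem n (nonadj_c c) s = sem n (edge_c 12 10) s \<or> sem n (nonadj_c c) s = nonadj_s n s"
    using e v by (auto simp: nonadj_c_def nonadj_s_def adj_def)
  then show "(\<forall>u. u \<notin> {13,14,15,16,24,33} \<longrightarrow> vr (sem n (nonadj_c c) s) u = vr s u)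
      \<and> ar (sem n (nonadj_c c) s) = ar s \<and> rw (sem n (nonadj_c c) s) = rw s"
    by (auto simp: nonadj_s vr_sem ar_sem rw_sem fun_eq_iff)
qed

definition fin_c :: com where
  "fin_c = For 12 0 (Const 28 0;; For 10 0 (Get 24 8 10;; IfZ 24 Skip (nonadj_c (Plus 28 28 5)));;
     Minus 24 28 27;; IfZ 24 (Put 9 12 2) (Put 9 12 3))"

lemma mod_fin_c [simp]:
  "modv fin_c = {10,12,13,14,15,16,24,28,33}" "moda fin_c = {9}" "\<not> modr fin_c" "bounds fin_c = {0}"
  by (auto simp: fin_c_def)

text \<open>Adding h for each non-neighbour compares h times their number with the size in variable
  27 without forming a product.\<close>

lemma fin_c:
  assumes "env n E t h Y s" "\<forall>v<n. ar s 8 v = of_bool (v \<in> T)"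
  shows "\<forall>v<n. ar (sem n fin_c s) 9 v
     = of_bool (h * card {x. x < n \<and> x \<in> T \<and> v \<noteq> x \<and> \<not> adj E v x} \<le> vr s 27)"
proof -
  let ?in = "Get 24 8 10;; IfZ 24 Skip (nonadj_c (Plus 28 28 5))"
  have inner: "vr (sem n (For 10 0 ?in) s1) 28 = h * card {x. x < n \<and> x \<in> T \<and> w \<noteq> x \<and> \<not> adj E w x}"
    if s1: "env n E t h Y s1" "ar s1 8 = ar s 8" "vr s1 12 = w" "w < n" "vr s1 28 = 0" for s1 w
  proof -
    define I where "I i s' \<longleftrightarrow> vr s' 28 = h * card {x. x < i \<and> x \<in> T \<and> w \<noteq> x \<and> \<not> adj E w x}" for i :: nat and s' :: st
    have "I (vr s1 0) (sem n (For 10 0 ?in) s1)"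
    proof (rule For_rule)
      show "I 0 s1" using s1(5) by (simp add: I_def)
    next
      fix i s2
      assume i: "i < vr s1 0" and fr: "\<And>u. u \<notin> insert 10 (modv ?in) \<Longrightarrow> vr s2 u = vr s1 u"
        "\<And>a. a \<notin> moda ?in \<Longrightarrow> ar s2 a = ar s1 a" "\<not> modr ?in \<Longrightarrow> rw s2 = rw s1" and I: "I i s2"
      have "env n E t h Y s2" using s1(1) fr by (subst env_cong[of _ s1]) auto
      then have e2: "env n E t h Y (setv 24 x (setv 10 i s2))" for x by simp
      have i': "i < n" using i s1(1) by (simp add: env_def)
      have w: "vr s2 12 = w" "vr s2 5 = h" "ar s2 8 i = of_bool (i \<in> T)"
        using fr(1)[of 12] fr(1)[of 5] fr(2)[of 8] s1 assms(2) i' by (auto simp: env_def)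
      let ?b = "i \<in> T \<and> w \<noteq> i \<and> \<not> adj E w i"
      have "{x. x < Suc i \<and> x \<in> T \<and> w \<noteq> x \<and> \<not> adj E w x} =
         (if ?b then insert i {x. x < i \<and> x \<in> T \<and> w \<noteq> x \<and> \<not> adj E w x} else {x. x < i \<and> x \<in> T \<and> w \<noteq> x \<and> \<not> adj E w x})"
        by (auto simp: less_Suc_eq)
      then have c: "card {x. x < Suc i \<and> x \<in> T \<and> w \<noteq> x \<and> \<not> adj E w x}
         = card {x. x < i \<and> x \<in> T \<and> w \<noteq> x \<and> \<not> adj E w x} + of_bool ?b"
        by simp
      have "vr (sem n ?in (setv 10 i s2)) 28 = vr s2 28 + h * of_bool ?b"
        using nonadj_c[OF e2, of "Suc 0" "Plus 28 28 5"] w s1(4) i' by (auto simp: nonadj_s)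
      then show "I (Suc i) (sem n ?in (setv 10 i s2))"
        using I c unfolding I_def by (simp only: distrib_left)
    qed
    then show ?thesis using s1(1) by (simp add: I_def env_def)
  qed
  let ?c = "Const 28 0;; For 10 0 ?in;; Minus 24 28 27;; IfZ 24 (Put 9 12 2) (Put 9 12 3)"
  define J where "J i s' \<longleftrightarrow> (\<forall>v<i. ar s' 9 v
     = of_bool (h * card {x. x < n \<and> x \<in> T \<and> v \<noteq> x \<and> \<not> adj E v x} \<le> vr s 27))" for i :: nat and s' :: st
  have "J (vr s 0) (sem n fin_c s)"
    unfolding fin_c_def
  proof (rule For_rule)
    show "J 0 s" by (simp add: J_def)
  next
    fix i s2
    assume i: "i < vr s 0" and fr: "\<And>u. u \<notin> insert 12 (modv ?c) \<Longrightarrow> vr s2 u = vr s u"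
        "\<And>a. a \<notin> moda ?c \<Longrightarrow> ar s2 a = ar s a" "\<not> modr ?c \<Longrightarrow> rw s2 = rw s" and J: "J i s2"
    let ?s3 = "setv 28 0 (setv 12 i s2)"
    let ?s4 = "sem n (For 10 0 ?in) ?s3"
    have "env n E t h Y s2" using assms(1) fr by (subst env_cong[of _ s]) auto
    then have e3: "env n E t h Y ?s3" by simp
    have 28: "vr ?s4 28 = h * card {x. x < n \<and> x \<in> T \<and> i \<noteq> x \<and> \<not> adj E i x}"
      by (rule inner[OF e3]) (use fr(2)[of 8] i assms(1) in \<open>auto simp: env_def\<close>)
    have v: "vr ?s4 12 = i" "vr ?s4 27 = vr s 27" "vr ?s4 2 = Suc 0" "vr ?s4 3 = 0" "ar ?s4 9 = ar s2 9"
      using fr(1)[of 27] fr(1)[of 2] fr(1)[of 3] assms(1)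
      by (subst vr_sem ar_sem; simp add: env_def)+
    have "sem n ?c (setv 12 i s2) = sem n (Minus 24 28 27;; IfZ 24 (Put 9 12 2) (Put 9 12 3)) ?s4"
      by simp
    then show "J (Suc i) (sem n ?c (setv 12 i s2))" using J 28 v
      by (auto simp: J_def less_Suc_eq simp del: sem.simps(11))
  qed
  then show ?thesis using assms(1) by (simp add: J_def env_def)
qed

section \<open>Branching on the remaining non-edges\<close>

definition half_c :: com where
  "half_c = Const 31 0;; Const 32 0;; For 23 6 (Minus 24 30 23;; IfZ 24 Skip (IfZ 31 (Plus 31 2 3) (Const 31 0;; Plus 32 32 2)));;
     Plus 30 32 3"

lemma mod_half_c [simp]:
  "modv half_c = {23,24,30,31,32}" "moda half_c = {}" "\<not> modr half_c" "bounds half_c = {6}"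
  by (auto simp: half_c_def)

text \<open>Parity and half are found by counting: a flag alternates, and each return to 0 raises
  the quotient. The loop runs for Y rounds, of which only the first \<open>vr s 30\<close>
  act.\<close>

lemma half_c:
  assumes "env n E t h Y s" "vr s 30 \<le> Y"
  shows "vr (sem n half_c s) 31 = vr s 30 mod 2" "vr (sem n half_c s) 30 = vr s 30 div 2"
proof -
  let ?c = "Minus 24 30 23;; IfZ 24 Skip (IfZ 31 (Plus 31 2 3) (Const 31 0;; Plus 32 32 2))"
  let ?s1 = "setv 32 0 (setv 31 0 s)"
  define I where "I i s' \<longleftrightarrow> vr s' 31 = min i (vr s 30) mod 2 \<and> vr s' 32 = min i (vr s 30) div 2" for i :: nat and s' :: st
  have "I (vr ?s1 6) (sem n (For 23 6 ?c) ?s1)"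
  proof (rule For_rule)
    show "I 0 ?s1" by (simp add: I_def)
  next
    fix i s2
    assume fr: "\<And>u. u \<notin> insert 23 (modv ?c) \<Longrightarrow> vr s2 u = vr ?s1 u" and I: "I i s2"
    have v: "vr s2 30 = vr s 30" "vr s2 2 = Suc 0" "vr s2 3 = 0" using fr assms(1) by (auto simp: env_def)
    have "Suc (i mod 2) div 2 = (if i mod 2 = 0 then 0 else 1)" by (auto simp: mod_2_eq_odd)
    then show "I (Suc i) (sem n ?c (setv 23 i s2))"
      using I v by (cases "i < vr s 30") (auto simp: I_def min_def mod_Suc div_Suc)
  qed
  then have I: "I Y (sem n (For 23 6 ?c) ?s1)" using assms(1) by (simp add: env_def)
  have "vr (sem n (For 23 6 ?c) ?s1) 3 = 0" using assms(1) by (subst vr_sem) (auto simp: env_def)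
  then show "vr (sem n half_c s) 31 = vr s 30 mod 2" "vr (sem n half_c s) 30 = vr s 30 div 2"
    using I assms(2) by (simp_all add: half_c_def I_def min_def del: sem.simps(11))
qed

text \<open>The bits of y, least significant first, are the choices made at successive non-edges
  inside F; a bit is consumed only when a vertex is deleted.\<close>

definition brstep :: "nat set set \<Rightarrow> nat \<times> nat \<Rightarrow> nat \<times> nat set \<Rightarrow> nat \<times> nat set" where
  "brstep E = (\<lambda>(u, v) (y, F). if u \<in> F \<and> v \<in> F \<and> u \<noteq> v \<and> \<not> adj E u v
     then (y div 2, if even y then F - {u} else F - {v}) else (y, F))"

definition res :: "nat \<Rightarrow> nat set set \<Rightarrow> nat \<Rightarrow> nat set \<Rightarrow> nat set" where
  "res n E y F = snd (fold (brstep E) (List.product [0..<n] [0..<n]) (y, F))"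

definition pair_c :: com where
  "pair_c = Get 24 10 12;; IfZ 24 Skip (Get 24 10 10;; IfZ 24 Skip
     (nonadj_c (half_c;; IfZ 31 (Put 10 12 3) (Put 10 10 3))))"

lemma mod_pair_c [simp]:
  "modv pair_c = {13,14,15,16,23,24,30,31,32,33}" "moda pair_c = {10}" "\<not> modr pair_c" "bounds pair_c = {6}"
  by (auto simp: pair_c_def)

definition br_rel :: "nat \<Rightarrow> nat \<Rightarrow> st \<Rightarrow> nat \<times> nat set \<Rightarrow> bool" where
  "br_rel n Y s = (\<lambda>(y, F). vr s 30 = y \<and> y \<le> Y \<and> (\<forall>v<n. ar s 10 v = of_bool (v \<in> F)))"

lemma pair_c:
  assumes e: "env n E t h Y s" and uv: "vr s 12 < n" "vr s 10 < n" and R: "br_rel n Y s yF"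
  shows "br_rel n Y (sem n pair_c s) (brstep E (vr s 12, vr s 10) yF)"
proof -
  obtain y F where yF: "yF = (y, F)" by (cases yF)
  have R': "vr s 30 = y" "y \<le> Y" "\<And>v. v < n \<Longrightarrow> ar s 10 v = of_bool (v \<in> F)"
    using R by (auto simp: br_rel_def yF)
  let ?c = "half_c;; IfZ 31 (Put 10 12 3) (Put 10 10 3)"
  let ?s1 = "setv 24 1 (setv 24 1 s)"
  have e1: "env n E t h Y ?s1" using e by simp
  show ?thesis
  proof (cases "vr s 12 \<in> F \<and> vr s 10 \<in> F")
    case False
    then have "sem n pair_c s = setv 24 0 s \<or> sem n pair_c s = setv 24 0 (setv 24 1 s)"
      using R' uv by (auto simp: pair_c_def)
    then show ?thesis using R False by (auto simp: br_rel_def yF brstep_def)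
  next
    case True
    then have eq: "sem n pair_c s = sem n (nonadj_c ?c) ?s1"
      using R' uv by (simp add: pair_c_def)
    show ?thesis
    proof (cases "vr s 12 \<noteq> vr s 10 \<and> \<not> adj E (vr s 12) (vr s 10)")
      case False
      then show ?thesis unfolding eq
        using nonadj_c(2)[OF e1, of ?c] uv True R by (auto simp: br_rel_def yF brstep_def)
    next
      case nadj: True
      let ?s2 = "nonadj_s n ?s1"
      have e2: "env n E t h Y ?s2" using e by (simp add: nonadj_s)
      have eq2: "sem n pair_c s = sem n (IfZ 31 (Put 10 12 3) (Put 10 10 3)) (sem n half_c ?s2)"
        unfolding eq using nonadj_c(1)[OF e1, of ?c] uv nadj by simp
      have h: "vr (sem n half_c ?s2) 31 = y mod 2" "vr (sem n half_c ?s2) 30 = y div 2"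
        using half_c[OF e2] R' by (auto simp: nonadj_s)
      have v: "vr (sem n half_c ?s2) 12 = vr s 12" "vr (sem n half_c ?s2) 10 = vr s 10"
        "vr (sem n half_c ?s2) 3 = 0" "ar (sem n half_c ?s2) 10 = ar s 10"
        using e by (auto simp: vr_sem ar_sem nonadj_s env_def)
      have le: "y div 2 \<le> Y" using R'(2) by linarith
      show ?thesis
      proof (cases "even y")
        case ev: True
        then have "vr (sem n half_c ?s2) 31 = 0" using h by simp
        then have "sem n pair_c s = sem n (Put 10 12 3) (sem n half_c ?s2)" unfolding eq2 by simp
        then show ?thesis using True nadj R'(3) ev h(2) v le by (simp add: br_rel_def yF brstep_def)
      next
        case od: False
        then have "vr (sem n half_c ?s2) 31 \<noteq> 0" using h by (simp add: odd_iff_mod_2_eq_one)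
        then have "sem n pair_c s = sem n (Put 10 10 3) (sem n half_c ?s2)" unfolding eq2 by simp
        then show ?thesis using True nadj R'(3) od h(2) v le by (simp add: br_rel_def yF brstep_def)
      qed
    qed
  qed
qed

definition pass_c :: com where
  "pass_c = For 12 0 (For 10 0 pair_c)"

lemma mod_pass_c [simp]:
  "modv pass_c = {10,12,13,14,15,16,23,24,30,31,32,33}" "moda pass_c = {10}" "\<not> modr pass_c" "bounds pass_c = {0,6}"
  by (auto simp: pass_c_def)

lemma product_upt_Suc:
  "List.product [0..<Suc i] ys = List.product [0..<i] ys @ map (Pair i) ys"
  by (simp add: product_concat_map)

lemma pass_c:
  assumes e: "env n E t h Y s" and R: "br_rel n Y s yF"
  shows "br_rel n Y (sem n pass_c s) (fold (brstep E) (List.product [0..<n] [0..<n]) yF)"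
proof -
  have inner: "br_rel n Y (sem n (For 10 0 pair_c) s1) (fold (brstep E) (map (Pair w) [0..<n]) zF)"
    if s1: "env n E t h Y s1" "vr s1 12 = w" "w < n" "br_rel n Y s1 zF" for s1 w zF
  proof -
    define I where "I i s' \<longleftrightarrow> br_rel n Y s' (fold (brstep E) (map (Pair w) [0..<i]) zF)" for i :: nat and s' :: st
    have "I (vr s1 0) (sem n (For 10 0 pair_c) s1)"
    proof (rule For_rule)
      show "I 0 s1" using s1(4) by (simp add: I_def)
    next
      fix i s2
      assume i: "i < vr s1 0" and fr: "\<And>u. u \<notin> insert 10 (modv pair_c) \<Longrightarrow> vr s2 u = vr s1 u"
        "\<And>a. a \<notin> moda pair_c \<Longrightarrow> ar s2 a = ar s1 a" "\<not> modr pair_c \<Longrightarrow> rw s2 = rw s1" and I: "I i s2"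
      have "env n E t h Y s2" using s1(1) fr by (subst env_cong[of _ s1]) auto
      then have e2: "env n E t h Y (setv 10 i s2)" by simp
      have "vr s2 12 = w" using fr(1)[of 12] s1(2) by simp
      then show "I (Suc i) (sem n pair_c (setv 10 i s2))"
        using pair_c[OF e2, of "fold (brstep E) (map (Pair w) [0..<i]) zF"] i s1(1,3) I
        by (simp add: I_def br_rel_def env_def)
    qed
    then show ?thesis using s1(1) by (simp add: I_def env_def)
  qed
  define J where "J i s' \<longleftrightarrow> br_rel n Y s' (fold (brstep E) (List.product [0..<i] [0..<n]) yF)" for i :: nat and s' :: st
  have "J (vr s 0) (sem n pass_c s)"
    unfolding pass_c_def
  proof (rule For_rule)
    show "J 0 s" using R by (simp add: J_def)
  next
    fix i s2
    let ?c = "For 10 0 pair_c"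
    assume i: "i < vr s 0" and fr: "\<And>u. u \<notin> insert 12 (modv ?c) \<Longrightarrow> vr s2 u = vr s u"
      "\<And>a. a \<notin> moda ?c \<Longrightarrow> ar s2 a = ar s a" "\<not> modr ?c \<Longrightarrow> rw s2 = rw s" and J: "J i s2"
    have "env n E t h Y s2" using e fr by (subst env_cong[of _ s]) auto
    then have e2: "env n E t h Y (setv 12 i s2)" by simp
    have "br_rel n Y (setv 12 i s2) (fold (brstep E) (List.product [0..<i] [0..<n]) yF)"
      using J by (simp add: J_def br_rel_def)
    from inner[OF e2 _ _ this, of i] show "J (Suc i) (sem n ?c (setv 12 i s2))"
      using i e by (simp add: J_def product_upt_Suc env_def del: sem.simps upt_Suc)
  qed
  then show ?thesis using e by (simp add: J_def env_def)
qed

lemma brstep_subset: "snd (brstep E p (y, F)) \<subseteq> F"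
  by (auto simp: brstep_def split: prod.splits)

lemma fold_brstep_subset: "snd (fold (brstep E) ps yF) \<subseteq> snd yF"
proof (induction ps arbitrary: yF)
  case (Cons p ps)
  show ?case using Cons.IH[of "brstep E p yF"] brstep_subset[of E p "fst yF" "snd yF"] by auto
qed simp

text \<open>Processing (u, v) removes one of two non-adjacent vertices and nothing is ever put back,
  so both can survive only if they are adjacent.\<close>

lemma fold_brstep_adj:
  assumes "(u, v) \<in> set ps" "u \<in> snd (fold (brstep E) ps yF)" "v \<in> snd (fold (brstep E) ps yF)" "u \<noteq> v"
  shows "adj E u v"
  using assms
proof (induction ps arbitrary: yF)
  case (Cons p ps)
  show ?case
  proof (cases "(u, v) \<in> set ps")
    case True
    then show ?thesis using Cons by auto
  next
    case False
    then have "p = (u, v)" using Cons by auto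
    then show ?thesis
      using Cons.prems fold_brstep_subset[of E ps "brstep E p yF"] by (cases yF) (auto simp: brstep_def split: if_splits)
  qed
qed simp

lemma res_subset: "res n E y F \<subseteq> F"
  using fold_brstep_subset[of E _ "(y, F)"] by (simp add: res_def)

lemma res_clique:
  assumes "F \<subseteq> {..<n}"
  shows "is_clique n E (res n E y F)"
  unfolding is_clique_def
proof (intro conjI ballI impI)
  show "res n E y F \<subseteq> {..<n}" using res_subset assms by blast
  fix i j assume ij: "i \<in> res n E y F" "j \<in> res n E y F" "i \<noteq> j"
  then have "i < n" "j < n" using res_subset assms by blast+
  then have "adj E i j" using ij unfolding res_def by (intro fold_brstep_adj) auto
  then show "{i, j} \<in> E" by (simp add: adj_def)
qed

text \<open>At each non-edge inside F at least one endpoint lies outside the clique C, and the bit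
  that deletes it lowers \<open>card (F - C)\<close>. Along these choices at most r bits are
  read.\<close>

lemma res_branch:
  assumes "is_clique n E C" "C \<subseteq> F" "finite F" "card (F - C) \<le> r"
  shows "\<exists>y<2^r. C \<subseteq> res n E y F"
proof -
  have "\<exists>y<2^r. C \<subseteq> snd (fold (brstep E) ps (y, F))" if "C \<subseteq> F" "finite F" "card (F - C) \<le> r" for ps
    using that
  proof (induction ps arbitrary: F r)
    case Nil then show ?case by (auto intro: exI[of _ 0])
  next
    case (Cons p ps)
    obtain u v where p: "p = (u, v)" by (cases p)
    show ?case
    proof (cases "u \<in> F \<and> v \<in> F \<and> u \<noteq> v \<and> \<not> adj E u v")
      case False
      then have "brstep E p (y, F) = (y, F)" for y by (auto simp: brstep_def p)
      then show ?thesis using Cons.IH[OF Cons.prems] by simp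
    next
      case True
      then have "\<not> (u \<in> C \<and> v \<in> C)" using assms(1) by (auto simp: is_clique_def adj_def)
      \<comment> \<open>z is an endpoint outside C and b the bit that deletes it: 0 for u, 1 for
        v.\<close>
      then obtain z b where z: "z \<in> F" "z \<notin> C" and b: "b < (2::nat)" "(if even b then F - {u} else F - {v}) = F - {z}"
        using True by (metis even_zero one_less_numeral_iff odd_one semiring_norm(76) zero_less_numeral)
      have "card (F - {z} - C) < card (F - C)"
        using z Cons.prems(2) by (intro psubset_card_mono) auto
      then obtain r' where r': "r = Suc r'" "card (F - {z} - C) \<le> r'"
        using Cons.prems(3) by (cases r) auto
      obtain y where y: "y < 2 ^ r'" "C \<subseteq> snd (fold (brstep E) ps (y, F - {z}))"
        using Cons.IH[of "F - {z}" r'] r' z Cons.prems(1,2) by auto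
      have "brstep E p (2 * y + b, F) = (y, F - {z})"
        using True b by (auto simp: brstep_def p)
      then show ?thesis using y b r' by (intro exI[of _ "2 * y + b"]) auto
    qed
  qed
  then show ?thesis using assms(2-4) by (simp add: res_def)
qed

section \<open>Recording the best clique and enumerating the guesses\<close>

definition out :: "nat \<Rightarrow> st \<Rightarrow> nat set" where
  "out n s = {i. i < n \<and> rw s (Suc (n * n) + i) \<noteq> 0}"

definition rec_c :: com where
  "rec_c = Minus 24 27 8;; IfZ 24 Skip (Plus 8 27 3;; For 10 0 (Plus 17 7 10;; Get 24 10 10;; RawPut 17 24))"

lemma mod_rec_c [simp]:
  "modv rec_c = {8,10,17,24}" "moda rec_c = {}" "bounds rec_c = {0}"
  by (auto simp: rec_c_def)

lemma rec_c:
  assumes e: "env n E t h Y s" and F: "\<forall>v<n. ar s 10 v = of_bool (v \<in> F)"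
  shows "env n E t h Y (sem n rec_c s)"
    and "vr s 27 \<le> vr s 8 \<Longrightarrow> vr (sem n rec_c s) 8 = vr s 8 \<and> out n (sem n rec_c s) = out n s"
    and "vr s 8 < vr s 27 \<Longrightarrow> vr (sem n rec_c s) 8 = vr s 27 \<and> out n (sem n rec_c s) = {v. v < n \<and> v \<in> F}"
proof -
  let ?c = "Plus 17 7 10;; Get 24 10 10;; RawPut 17 24"
  let ?s1 = "setv 8 (vr s 27) (setv 24 (vr s 27 - vr s 8) s)"
  let ?s2 = "sem n (For 10 0 ?c) ?s1"
  define I where "I i s' \<longleftrightarrow> (\<forall>x. rw s' x = (if x \<in> {Suc (n * n)..<Suc (n * n) + i} then of_bool (x - Suc (n * n) \<in> F) else rw s x))" for i :: nat and s' :: st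
  have "I (vr ?s1 0) ?s2"
  proof (rule For_rule)
    show "I 0 ?s1" by (simp add: I_def)
  next
    fix i s2
    assume i: "i < vr ?s1 0" and fr: "\<And>u. u \<notin> insert 10 (modv ?c) \<Longrightarrow> vr s2 u = vr ?s1 u"
      "\<And>a. a \<notin> moda ?c \<Longrightarrow> ar s2 a = ar ?s1 a" and I: "I i s2"
    have i': "i < n" using i e by (simp add: env_def)
    have v: "vr s2 7 = Suc (n * n)" "ar s2 10 i = of_bool (i \<in> F)" using fr e F i' by (auto simp: env_def)
    have "raw_zone n (Suc (n * n) + i)"
      using i' le_square[of n] unfolding raw_zone_def by linarith
    then show "I (Suc i) (sem n ?c (setv 10 i s2))"
      using I v by (auto simp: I_def)
  qed
  then have I: "I n ?s2" using e by (simp add: env_def)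
  have v2: "vr ?s2 u = vr ?s1 u" if "u \<notin> {10,17,24}" for u using that by (subst vr_sem) auto
  have a2: "ar ?s2 0 = ar s 0" by (subst ar_sem) auto
  have e2: "env n E t h Y ?s2"
    using e I v2 a2 by (simp add: env_def I_def del: sem.simps)
  have eq: "sem n rec_c s = (if vr s 27 \<le> vr s 8 then setv 24 (vr s 27 - vr s 8) s else ?s2)"
    using e by (simp add: rec_c_def env_def)
  show "env n E t h Y (sem n rec_c s)" using e e2 by (simp add: eq del: sem.simps)
  show "vr s 27 \<le> vr s 8 \<Longrightarrow> vr (sem n rec_c s) 8 = vr s 8 \<and> out n (sem n rec_c s) = out n s"
    by (simp add: eq out_def del: sem.simps)
  show "vr s 8 < vr s 27 \<Longrightarrow> vr (sem n rec_c s) 8 = vr s 27 \<and> out n (sem n rec_c s) = {v. v < n \<and> v \<in> F}"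
    using v2[of 8] I by (auto simp: eq out_def I_def simp del: sem.simps)
qed

definition br_c :: com where
  "br_c = Plus 30 29 3;; For 10 0 (Get 24 9 10;; Put 10 10 24);; pass_c;; sz_c 10;; rec_c"

lemma mod_br_c [simp]:
  "modv br_c = {8,10,12,13,14,15,16,17,23,24,27,30,31,32,33}" "moda br_c = {10}" "bounds br_c = {0,6}"
  by (auto simp: br_c_def)

text \<open>Nothing here refers to the guesses, so wrong ones cannot break it. Together with the
  monotonicity of variable 8 it makes the final output at least as large as every candidate.\<close>

definition clique_inv :: "nat \<Rightarrow> nat set set \<Rightarrow> nat \<Rightarrow> nat \<Rightarrow> nat \<Rightarrow> st \<Rightarrow> bool" where
  "clique_inv n E t h Y s \<longleftrightarrow> env n E t h Y s \<and> is_clique n E (out n s) \<and> vr s 8 = card (out n s)"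

lemma clique_inv_cong:
  assumes "\<And>u. u \<in> {0,2,3,4,5,6,7,8} \<Longrightarrow> vr s u = vr s' u" "ar s 0 = ar s' 0" "rw s = rw s'"
  shows "clique_inv n E t h Y s \<longleftrightarrow> clique_inv n E t h Y s'"
proof -
  have "env n E t h Y s \<longleftrightarrow> env n E t h Y s'" by (rule env_cong) (use assms in auto)
  moreover have "out n s = out n s'" "vr s 8 = vr s' 8" using assms by (simp_all add: out_def)
  ultimately show ?thesis by (simp add: clique_inv_def)
qed

lemma clique_inv_sem:
  assumes "modv c \<inter> {0,2,3,4,5,6,7,8} = {}" "0 \<notin> moda c" "\<not> modr c"
  shows "clique_inv n E t h Y (sem n c s) \<longleftrightarrow> clique_inv n E t h Y s"
  using assms by (intro clique_inv_cong vr_sem ar_sem rw_sem) auto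

lemma br_c:
  assumes i: "clique_inv n E t h Y s" and F: "\<forall>v<n. ar s 9 v = of_bool (v \<in> F)" "F \<subseteq> {..<n}" and y: "vr s 29 < Y"
  shows "clique_inv n E t h Y (sem n br_c s)" "vr s 8 \<le> vr (sem n br_c s) 8"
    "card (res n E (vr s 29) F) \<le> vr (sem n br_c s) 8"
proof -
  let ?c = "Get 24 9 10;; Put 10 10 24"
  have e: "env n E t h Y s" using i by (simp add: clique_inv_def)
  define s1 where "s1 = setv 30 (vr s 29) s"
  define s2 where "s2 = sem n (For 10 0 ?c) s1"
  define s3 where "s3 = sem n pass_c s2"
  define s4 where "s4 = sem n (sz_c 10) s3"
  have eq: "sem n br_c s = sem n rec_c s4"
    using e by (simp add: br_c_def s4_def s3_def s2_def s1_def env_def)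
  have i1: "clique_inv n E t h Y s1" using i by (subst clique_inv_cong[of _ s]) (auto simp: s1_def)
  then have i2: "clique_inv n E t h Y s2" unfolding s2_def by (subst clique_inv_sem) auto
  then have i3: "clique_inv n E t h Y s3" unfolding s3_def by (subst clique_inv_sem) auto
  then have i4: "clique_inv n E t h Y s4" unfolding s4_def by (subst clique_inv_sem) auto
  define I where "I i s' \<longleftrightarrow> (\<forall>v<i. ar s' 10 v = ar s 9 v)" for i :: nat and s' :: st
  have "I (vr s1 0) s2"
    unfolding s2_def
  proof (rule For_rule)
    show "I 0 s1" by (simp add: I_def)
  next
    fix i s2
    assume fr: "\<And>a. a \<notin> moda ?c \<Longrightarrow> ar s2 a = ar s1 a" and I: "I i s2"
    have "ar s2 9 = ar s 9" using fr[of 9] by (simp add: s1_def)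
    then show "I (Suc i) (sem n ?c (setv 10 i s2))"
      using I by (auto simp: I_def less_Suc_eq)
  qed
  then have 10: "\<forall>v<n. ar s2 10 v = of_bool (v \<in> F)" using i1 F by (simp add: I_def clique_inv_def env_def)
  have "vr s2 30 = vr s 29" unfolding s2_def by (subst vr_sem) (auto simp: s1_def)
  then have "br_rel n Y s2 (vr s 29, F)" using 10 y by (simp add: br_rel_def)
  then have "br_rel n Y s3 (fold (brstep E) (List.product [0..<n] [0..<n]) (vr s 29, F))"
    unfolding s3_def using i2 by (intro pass_c) (auto simp: clique_inv_def)
  then have a3: "\<forall>v<n. ar s3 10 v = of_bool (v \<in> res n E (vr s 29) F)"
    by (auto simp: br_rel_def res_def split: prod.splits)
  have set: "{v. v < n \<and> v \<in> res n E (vr s 29) F} = res n E (vr s 29) F"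
    using res_subset F(2) by blast
  have a4: "\<forall>v<n. ar s4 10 v = of_bool (v \<in> res n E (vr s 29) F)"
    using a3 by (simp add: s4_def ar_sem)
  have 27: "vr s4 27 = card (res n E (vr s 29) F)"
    unfolding s4_def using sz_c[OF _ a3, of E t h Y] i3 set by (simp add: clique_inv_def)
  have 8: "vr s4 8 = vr s 8"
    by (simp add: s4_def s3_def s2_def s1_def vr_sem del: sem.simps)
  note r = rec_c[OF _ a4, of E t h Y]
  show "clique_inv n E t h Y (sem n br_c s)" "vr s 8 \<le> vr (sem n br_c s) 8"
    "card (res n E (vr s 29) F) \<le> vr (sem n br_c s) 8"
    using r i4 27 8 set res_clique[OF F(2), of E "vr s 29"]
    by (cases "vr s4 27 \<le> vr s4 8"; simp add: eq clique_inv_def)+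
qed

definition candT :: "nat \<Rightarrow> nat set set \<Rightarrow> nat \<Rightarrow> (nat \<Rightarrow> nat) \<Rightarrow> nat set" where
  "candT n E t g = {v \<in> nbh n E t g. pw n E (nbh n E t g) (g t) (g (t+1)) n (g (t+2))
      \<le> pw n E (nbh n E t g) (g t) (g (t+1)) n v}"

text \<open>All vertices are tested, not only those of the common neighbourhood: Q itself, and
  clique vertices that miss some of Q, have to be recovered here.\<close>

definition near :: "nat \<Rightarrow> nat set set \<Rightarrow> nat \<Rightarrow> nat set \<Rightarrow> nat set" where
  "near n E h T = {v. v < n \<and> h * card {x \<in> T. v \<noteq> x \<and> \<not> adj E v x} \<le> card T}"

definition body_c :: "nat \<Rightarrow> com" where
  "body_c t = (nbh_c;; start_c t;; power_c;; thr_c;; sz_c 8;; fin_c);; For 29 6 br_c"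

lemma mod_nbh_c [simp]:
  "modv nbh_c = {10,11,13,14,15,16,22}" "moda nbh_c = {3}" "\<not> modr nbh_c" "bounds nbh_c = {0,4}"
  by (auto simp: nbh_c_def)

lemma mod_start_c [simp]:
  "modv (start_c t) = {10,12,17,25,26}" "moda (start_c t) = {4,5}" "\<not> modr (start_c t)" "bounds (start_c t) = {0}"
  by (auto simp: start_c_def)

lemma mod_power_c [simp]:
  "modv power_c = {10,12,13,14,15,16,18,19,20,21,22,23,24}" "moda power_c = {4,5,6,7}" "\<not> modr power_c" "bounds power_c = {0}"
  by (auto simp: power_c_def)

lemma mod_body_c [simp]:
  "modv (body_c t) \<inter> {0,2,3,4,5,6,7,9} = {}" "moda (body_c t) = {3,4,5,6,7,8,9,10}" "bounds (body_c t) = {0,4,6}"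
  by (auto simp: body_c_def)

lemma body_c:
  assumes i: "clique_inv n E t h Y s" and g: "\<And>i. i < t + 3 \<Longrightarrow> ar s 2 i < n"
  shows "clique_inv n E t h Y (sem n (body_c t) s)" "vr s 8 \<le> vr (sem n (body_c t) s) 8"
    "\<And>y. y < Y \<Longrightarrow> card (res n E y (near n E h (candT n E t (ar s 2)))) \<le> vr (sem n (body_c t) s) 8"
proof -
  define g where "g = ar s 2"
  define V where "V = nbh n E t g"
  define T where "T = candT n E t g"
  define F where "F = near n E h T"
  have T: "{v. v < n \<and> v \<in> T} = T" by (auto simp: T_def candT_def nbh_def)
  have e: "env n E t h Y s" using i by (simp add: clique_inv_def)
  define s1 where "s1 = sem n nbh_c s"
  define s2 where "s2 = sem n (start_c t) s1"
  define s3 where "s3 = sem n power_c s2"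
  define s4 where "s4 = sem n thr_c s3"
  define s5 where "s5 = sem n (sz_c 8) s4"
  define s6 where "s6 = sem n fin_c s5"
  have eq: "sem n (body_c t) s = sem n (For 29 6 br_c) s6"
    by (simp only: body_c_def sem.simps(9) s6_def s5_def s4_def s3_def s2_def s1_def)
  note defs = s1_def s2_def s3_def s4_def s5_def s6_def
  have e1: "env n E t h Y s1" using e by (simp add: defs env_sem)
  then have e2: "env n E t h Y s2" by (simp add: s2_def env_sem)
  then have e3: "env n E t h Y s3" by (simp add: s3_def env_sem)
  then have e4: "env n E t h Y s4" by (simp add: s4_def env_sem)
  then have e5: "env n E t h Y s5" by (simp add: s5_def env_sem)
  have i6: "clique_inv n E t h Y s6" using i by (simp add: defs clique_inv_sem)
  have 8: "vr s6 8 = vr s 8" by (simp add: defs vr_sem)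
  have V1: "\<forall>v<n. ar s1 3 v = of_bool (v \<in> V)"
    unfolding s1_def V_def g_def using assms(2) by (intro nbh_c[OF e]) auto
  have V2: "\<forall>v<n. ar s2 3 v = of_bool (v \<in> V)" "\<forall>v<n. ar s3 3 v = of_bool (v \<in> V)"
    using V1 by (simp_all add: s3_def s2_def ar_sem)
  have g1: "ar s1 2 = g" by (simp add: s1_def ar_sem g_def)
  have j: "vr s2 25 = g t" "vr s2 26 = g (t + 2)"
    "\<forall>v<n. ar s2 4 v = of_bool (v = g (t + 1)) \<and> ar s2 5 v = 0"
    using start_c[OF e1] unfolding g1 s2_def by auto
  have gn: "g t < n" "g (t + 2) < n" using assms(2)[of t] assms(2)[of "t+2"] by (auto simp: g_def)
  have p3: "\<forall>u<n. int (ar s3 4 u) - int (ar s3 5 u) = pw n E V (g t) (g (t+1)) n u"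
    unfolding s3_def j(1)[symmetric] using gn j by (intro power_c[OF e2 _ V2(1)]) auto
  have l3: "vr s3 26 = g (t + 2)" using j by (simp add: s3_def vr_sem)
  have T4: "\<forall>v<n. ar s4 8 v = of_bool (v \<in> T)"
    using thr_c[OF e3 V2(2) _ p3] gn l3 by (simp add: s4_def T_def candT_def V_def)
  have 27: "vr s5 27 = card T" using sz_c[OF e4 T4] T by (simp add: s5_def)
  have T5: "\<forall>v<n. ar s5 8 v = of_bool (v \<in> T)" using T4 by (simp add: s5_def ar_sem)
  have "{x. x < n \<and> x \<in> T \<and> v \<noteq> x \<and> \<not> adj E v x} = {x \<in> T. v \<noteq> x \<and> \<not> adj E v x}" for v
    using T by blast
  then have F6: "\<forall>v<n. ar s6 9 v = of_bool (v \<in> F)"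
    using fin_c[OF e5 T5] 27 by (simp add: s6_def F_def near_def)
  have F: "F \<subseteq> {..<n}" by (auto simp: F_def near_def)
  define I where "I y s' \<longleftrightarrow> clique_inv n E t h Y s' \<and> vr s 8 \<le> vr s' 8 \<and> (\<forall>y'<y. card (res n E y' F) \<le> vr s' 8)" for y :: nat and s' :: st
  have "I (vr s6 6) (sem n (For 29 6 br_c) s6)"
  proof (rule For_rule)
    show "I 0 s6" using i6 8 by (simp add: I_def)
  next
    fix y s2
    assume y: "y < vr s6 6" and fr: "\<And>a. a \<notin> moda br_c \<Longrightarrow> ar s2 a = ar s6 a" and I: "I y s2"
    have yY: "y < Y" using y i6 by (simp add: clique_inv_def env_def)
    have i2: "clique_inv n E t h Y (setv 29 y s2)" using I by (subst clique_inv_cong[of _ s2]) (auto simp: I_def)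
    have "\<forall>v<n. ar (setv 29 y s2) 9 v = of_bool (v \<in> F)" using F6 fr[of 9] by simp
    from br_c[OF i2 this F] yY I show "I (Suc y) (sem n br_c (setv 29 y s2))"
      by (force simp: I_def less_Suc_eq)
  qed
  then have "I Y (sem n (body_c t) s)" using i6 by (simp add: clique_inv_def env_def eq)
  then show "clique_inv n E t h Y (sem n (body_c t) s)" "vr s 8 \<le> vr (sem n (body_c t) s) 8"
    "\<And>y. y < Y \<Longrightarrow> card (res n E y (near n E h (candT n E t (ar s 2)))) \<le> vr (sem n (body_c t) s) 8"
    by (simp_all add: I_def F_def T_def g_def)
qed

text \<open>The outermost loop fixes the entry with the highest index. One loop variable serves all
  depths, because its value is stored before an inner loop overwrites it and a compiled loop keeps
  its own counter.\<close>

primrec nest :: "nat \<Rightarrow> com \<Rightarrow> com" where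
  "nest 0 c = c"
| "nest (Suc m) c = For 9 0 (Const 17 m;; Put 2 17 9;; nest m c)"

lemma mod_nest:
  "modv (nest m c) \<subseteq> {9,17} \<union> modv c" "moda (nest m c) \<subseteq> {2} \<union> moda c" "bounds (nest m c) \<subseteq> {0} \<union> bounds c"
  by (induction m) auto

lemma near_candT_cong:
  assumes "\<And>i. i < t + 3 \<Longrightarrow> g i = g' i"
  shows "near n E h (candT n E t g) = near n E h (candT n E t g')"
proof -
  have "nbh n E t g = nbh n E t g'" using assms by (auto simp: nbh_def)
  then show ?thesis using assms[of t] assms[of "t+1"] assms[of "t+2"] by (simp add: candT_def)
qed

text \<open>Entries from m upward are already fixed by outer loops; the bound covers every
  completion g of them, which is what the induction on m needs.\<close>

lemma nest_body:
  assumes "clique_inv n E t h Y s" "m \<le> t + 3" "\<And>i. m \<le> i \<Longrightarrow> i < t + 3 \<Longrightarrow> ar s 2 i < n"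
  shows "clique_inv n E t h Y (sem n (nest m (body_c t)) s) \<and> vr s 8 \<le> vr (sem n (nest m (body_c t)) s) 8
    \<and> (\<forall>i\<ge>m. ar (sem n (nest m (body_c t)) s) 2 i = ar s 2 i)
    \<and> (\<forall>g y. (\<forall>i<m. g i < n) \<longrightarrow> (\<forall>i. m \<le> i \<longrightarrow> i < t + 3 \<longrightarrow> g i = ar s 2 i) \<longrightarrow> y < Y \<longrightarrow>
         card (res n E y (near n E h (candT n E t g))) \<le> vr (sem n (nest m (body_c t)) s) 8)"
  using assms
proof (induction m arbitrary: s)
  case 0
  have eq: "near n E h (candT n E t g) = near n E h (candT n E t (ar s 2))" if "\<forall>i. i < t + 3 \<longrightarrow> g i = ar s 2 i" for g
    by (rule near_candT_cong) (use that in auto)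
  have 2: "ar (sem n (body_c t) s) 2 = ar s 2" by (rule ar_sem) simp
  have "ar s 2 i < n" if "i < t + 3" for i using 0(3) that by simp
  note b = body_c[OF 0(1) this]
  show ?case
    unfolding nest.simps(1)
  proof (intro conjI allI impI b(1,2))
    show "ar (sem n (body_c t) s) 2 i = ar s 2 i" for i using 2 by simp
    fix g y assume g: "\<forall>i. 0 \<le> i \<longrightarrow> i < t + 3 \<longrightarrow> g i = ar s 2 i" and y: "y < Y"
    have "\<forall>i. i < t + 3 \<longrightarrow> g i = ar s 2 i" using g by simp
    from eq[OF this] show "card (res n E y (near n E h (candT n E t g))) \<le> vr (sem n (body_c t) s) 8"
      using b(3)[OF _ y] by (simp only:)
  qed
next
  case (Suc m)
  let ?c = "Const 17 m;; Put 2 17 9;; nest m (body_c t)"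
  let ?val = "\<lambda>g y. card (res n E y (near n E h (candT n E t g)))"
  define I where "I j s' \<longleftrightarrow> clique_inv n E t h Y s' \<and> vr s 8 \<le> vr s' 8 \<and> (\<forall>i\<ge>Suc m. ar s' 2 i = ar s 2 i)
    \<and> (\<forall>g y. (\<forall>i<m. g i < n) \<longrightarrow> g m < j \<longrightarrow> (\<forall>i. Suc m \<le> i \<longrightarrow> i < t + 3 \<longrightarrow> g i = ar s 2 i) \<longrightarrow> y < Y \<longrightarrow>
         ?val g y \<le> vr s' 8)" for j :: nat and s' :: st
  have "I (vr s 0) (sem n (For 9 0 ?c) s)"
  proof (rule For_rule)
    show "I 0 s" using Suc.prems by (simp add: I_def)
  next
    fix j s2
    assume j: "j < vr s 0" and I: "I j s2"
    define s3 where "s3 = sem n (Const 17 m;; Put 2 17 9) (setv 9 j s2)"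
    have s3: "vr s3 8 = vr s2 8" "ar s3 2 = (ar s2 2)(m := j)" by (simp_all add: s3_def)
    have jn: "j < n" using j Suc.prems(1) by (simp add: clique_inv_def env_def)
    have i3: "clique_inv n E t h Y s3" using I by (subst clique_inv_cong[of _ s2]) (auto simp: I_def s3_def)
    have "ar s3 2 i < n" if "m \<le> i" "i < t + 3" for i
      using that Suc.prems(3)[of i] I jn by (cases "i = m") (auto simp: s3 I_def)
    note IH = Suc.IH[OF i3 _ this]
    have eq: "sem n ?c (setv 9 j s2) = sem n (nest m (body_c t)) s3" by (simp add: s3_def)
    show "I (Suc j) (sem n ?c (setv 9 j s2))"
      unfolding I_def eq
    proof (intro conjI allI impI)
      show "clique_inv n E t h Y (sem n (nest m (body_c t)) s3)" using IH Suc.prems(2) by simp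
      show mono: "vr s 8 \<le> vr (sem n (nest m (body_c t)) s3) 8"
        using IH Suc.prems(2) s3 I by (auto simp: I_def)
      show "ar (sem n (nest m (body_c t)) s3) 2 i = ar s 2 i" if "Suc m \<le> i" for i
        using IH Suc.prems(2) s3 I that by (auto simp: I_def)
      fix g y assume g: "\<forall>i<m. g i < n" "g m < Suc j" "\<forall>i. Suc m \<le> i \<longrightarrow> i < t + 3 \<longrightarrow> g i = ar s 2 i" "y < Y"
      show "?val g y \<le> vr (sem n (nest m (body_c t)) s3) 8"
      proof (cases "g m = j")
        case True
        then have "\<forall>i. m \<le> i \<longrightarrow> i < t + 3 \<longrightarrow> g i = ar s3 2 i"
          using g(3) I by (auto simp: s3 I_def)
        then show ?thesis using IH Suc.prems(2) g by simp
      next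
        case False
        then have "?val g y \<le> vr s2 8" using I g by (auto simp: I_def)
        also have "\<dots> \<le> vr (sem n (nest m (body_c t)) s3) 8" using IH Suc.prems(2) s3 by simp
        finally show ?thesis .
      qed
    qed
  qed
  then have "I n (sem n (nest (Suc m) (body_c t)) s)" using Suc.prems(1) by (simp add: clique_inv_def env_def)
  then show ?case unfolding I_def by (auto simp: less_Suc_eq)
qed

section \<open>Preamble and running time of the whole program\<close>

primrec pow_c :: "nat \<Rightarrow> com" where
  "pow_c 0 = Skip"
| "pow_c (Suc a) = Const 24 0;; For 10 0 (Plus 24 24 6);; Plus 6 24 3;; pow_c a"

lemma mod_pow_c: "modv (pow_c a) \<subseteq> {6,10,24}" "moda (pow_c a) = {}" "\<not> modr (pow_c a)" "bounds (pow_c a) \<subseteq> {0}"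
  by (induction a) auto

lemma pow_c: "vr s 0 = n \<Longrightarrow> vr s 3 = 0 \<Longrightarrow> vr (sem n (pow_c a) s) 6 = vr s 6 * n ^ a"
proof (induction a arbitrary: s)
  case (Suc a)
  define I where "I i s' \<longleftrightarrow> vr s' 24 = i * vr s 6" for i :: nat and s' :: st
  let ?s1 = "setv 24 0 s"
  define s2 where "s2 = sem n (For 10 0 (Plus 24 24 6)) ?s1"
  have "I (vr ?s1 0) s2"
    unfolding s2_def
  proof (rule For_rule)
    show "I 0 ?s1" by (simp add: I_def)
  next
    fix i s2
    assume fr: "\<And>u. u \<notin> insert 10 (modv (Plus 24 24 6)) \<Longrightarrow> vr s2 u = vr ?s1 u" and I: "I i s2"
    have "vr s2 6 = vr s 6" using fr[of 6] by simp
    then show "I (Suc i) (sem n (Plus 24 24 6) (setv 10 i s2))" using I by (simp add: I_def)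
  qed
  then have 24: "vr s2 24 = n * vr s 6" using Suc.prems by (simp add: I_def)
  have v: "vr s2 0 = n" "vr s2 3 = 0" unfolding s2_def by (subst vr_sem; use Suc.prems in simp)+
  have "vr (sem n (pow_c (Suc a)) s) 6 = vr (sem n (pow_c a) (setv 6 (n * vr s 6) s2)) 6"
    using 24 v by (simp add: s2_def)
  also have "\<dots> = vr s 6 * n ^ Suc a" using v by (subst Suc.IH) auto
  finally show ?case .
qed simp

definition pre_c :: "nat \<Rightarrow> nat \<Rightarrow> nat \<Rightarrow> com" where
  "pre_c t h a = (Const 2 1;; Const 3 0;; Const 4 t;; Const 5 h;; Const 6 1;; Const 8 0;; Const 24 0);;
     For 10 0 (Put 0 10 24;; Plus 24 24 0);; Plus 7 24 2;; pow_c a"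

lemma pre_c:
  assumes s: "vr s 0 = n" "rw s = input_mem n E"
  shows "clique_inv n E t h (n ^ a) (sem n (pre_c t h a) s)"
proof -
  let ?c = "Put 0 10 24;; Plus 24 24 0"
  define s1 where "s1 = sem n (Const 2 1;; Const 3 0;; Const 4 t;; Const 5 h;; Const 6 1;; Const 8 0;; Const 24 0) s"
  define s2 where "s2 = sem n (For 10 0 ?c) s1"
  define s3 where "s3 = sem n (Plus 7 24 2) s2"
  have s1: "vr s1 0 = n" "vr s1 2 = Suc 0" "vr s1 3 = 0" "vr s1 4 = t" "vr s1 5 = h" "vr s1 6 = Suc 0" "vr s1 8 = 0" "vr s1 24 = 0"
    "rw s1 = rw s" using s by (simp_all add: s1_def)
  define I where "I i s' \<longleftrightarrow> vr s' 24 = i * n \<and> (\<forall>u<i. ar s' 0 u = u * n)" for i :: nat and s' :: st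
  have "I (vr s1 0) s2"
    unfolding s2_def
  proof (rule For_rule)
    show "I 0 s1" by (simp add: I_def s1)
  next
    fix i s2
    assume fr: "\<And>u. u \<notin> insert 10 (modv ?c) \<Longrightarrow> vr s2 u = vr s1 u" and I: "I i s2"
    have "vr s2 0 = n" using fr[of 0] s1 by simp
    then show "I (Suc i) (sem n ?c (setv 10 i s2))" using I by (auto simp: I_def less_Suc_eq)
  qed
  then have I: "vr s2 24 = n * n" "\<forall>u<n. ar s2 0 u = u * n" by (simp_all add: I_def s1)
  have v2: "vr s2 u = vr s1 u" if "u \<notin> {10,24}" for u unfolding s2_def by (subst vr_sem) (use that in auto)
  have r2: "rw s2 = rw s" unfolding s2_def by (subst rw_sem) (auto simp: s1)
  have v37: "vr s3 7 = Suc (n * n)" using I v2[of 2] s1 by (simp add: s3_def)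
  have v3: "vr s3 u = vr s2 u" if "u \<noteq> 7" for u using that by (simp add: s3_def)
  have eq: "sem n (pre_c t h a) s = sem n (pow_c a) s3"
    by (simp add: pre_c_def s3_def s2_def s1_def)
  have v4: "vr (sem n (pow_c a) s3) u = vr s3 u" if "u \<notin> {6,10,24}" for u
    using mod_pow_c(1)[of a] that by (intro vr_sem) blast
  have a4: "ar (sem n (pow_c a) s3) = ar s2" "rw (sem n (pow_c a) s3) = rw s"
    by (auto simp: ar_sem rw_sem mod_pow_c s3_def r2 fun_eq_iff)
  have "vr (sem n (pow_c a) s3) 6 = n ^ a"
    using pow_c[of s3 n a] v2 v3 s1 by simp
  then have "env n E t h (n ^ a) (sem n (pow_c a) s3)"
    unfolding env_def using v2 v3 v37 v4 a4 s1 I(2) s(2) by simp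
  \<comment> \<open>The output cells of the input memory are zero, so the initial record is the
    empty clique.\<close>
  moreover have "out n (sem n (pow_c a) s3) = {}"
    by (auto simp: out_def a4 s input_mem_def)
  moreover have "vr (sem n (pow_c a) s3) 8 = 0" using v2[of 8] v3[of 8] v4[of 8] s1 by simp
  ultimately show ?thesis unfolding eq clique_inv_def by (simp add: is_clique_def)
qed

definition main_c :: "nat \<Rightarrow> com" where
  "main_c t = nest (t + 3) (body_c t)"

text \<open>36 is the number of variables and t+7 the loop depth, from t+3 guesses and at most four
  nested loops in the body. The threshold 55+2t on n used below is 36+5+2(t+7).\<close>

definition clique_prog :: "nat \<Rightarrow> nat \<Rightarrow> nat \<Rightarrow> instr list" where
  "clique_prog t h a = ram_prog 36 (t + 7) (pre_c t h a ;; main_c t)"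

lemma wfc_mono: "wfc N D c d \<Longrightarrow> D + d' \<le> D' + d \<Longrightarrow> wfc N D' c d'"
  by (induction c arbitrary: d d') auto

lemma wfc_nest: "wfc N D c (d + m) \<Longrightarrow> d + m \<le> D \<Longrightarrow> 18 \<le> N \<Longrightarrow> wfc N D (nest m c) d"
  by (induction m arbitrary: d) auto

lemma wfc_body: "wfc 36 (t + 7) (body_c t) (t + 3)"
proof -
  have "wfc 36 4 (body_c t) 0"
    by (simp add: body_c_def nbh_c_def start_c_def power_c_def iter_c_def row_c_def acc_c_def thr_c_def
        sz_c_def fin_c_def nonadj_c_def edge_c_def br_c_def pass_c_def pair_c_def half_c_def rec_c_def)
  then show ?thesis by (rule wfc_mono) simp
qed

lemma wfc_pre: "wfc 36 (t + 7) (pre_c t h a) 0"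
proof -
  have "wfc 36 (t + 7) (pow_c a) 0" by (induction a) auto
  then show ?thesis by (simp add: pre_c_def)
qed

theorem clique_prog:
  assumes "1 \<le> a"
  shows "\<exists>C d. (\<forall>n E. ram_halts_within (clique_prog t h a) (C * (n + 1) ^ d) n E) \<and>
    (\<forall>n E. 55 + 2 * t \<le> n \<longrightarrow> is_clique n E (ram_output (clique_prog t h a) (C * (n + 1) ^ d) n E) \<and>
       (\<forall>g y. (\<forall>i<t+3. g i < n) \<longrightarrow> y < n ^ a \<longrightarrow>
         card (res n E y (near n E h (candT n E t g))) \<le> card (ram_output (clique_prog t h a) (C * (n + 1) ^ d) n E)))"
proof -
  obtain C1 d1 where 1: "\<And>X. tb X (pre_c t h a) \<le> C1 * (X + 1) ^ d1" using tb_poly by blast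
  obtain C2 d2 where 2: "\<And>X. tb X (main_c t) \<le> C2 * (X + 1) ^ d2" using tb_poly by blast
  define C where "C = 10 + C1 + C2 * (t + 2) ^ d2"
  define d where "d = 1 + d1 + a * d2"
  have wm: "wfc 36 (t + 7) (main_c t) 0"
    unfolding main_c_def using wfc_body[of t] by (intro wfc_nest) auto
  have b: "bounds (main_c t) \<subseteq> {0,4,6}"
    using mod_nest(3)[of "t+3" "body_c t"] by (simp add: main_c_def insert_commute)
  have "modv (main_c t) \<subseteq> {9,17} \<union> modv (body_c t)"
    unfolding main_c_def by (rule mod_nest)
  then have "modv (main_c t) \<inter> {0,4,6} = {}"
    using mod_body_c(1)[of t] by (auto simp del: mod_body_c)
  with b have bm: "bounds (main_c t) \<inter> modv (main_c t) = {}" "bounds (main_c t) \<subseteq> {0,4,6}"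
    by blast+
  have T: "4 * n + 10 + tb n (pre_c t h a) + tb (n ^ a + n + t) (main_c t) \<le> C * (n + 1) ^ d" for n
  proof -
    let ?m = "n + 1"
    have p: "?m \<le> ?m ^ d" "?m ^ d1 \<le> ?m ^ d" "?m ^ (a * d2) \<le> ?m ^ d"
      using power_increasing[of 1 d ?m] power_increasing[of d1 d ?m] power_increasing[of "a * d2" d ?m]
      by (auto simp: d_def)
    have "n ^ a \<le> ?m ^ a" by (intro power_mono) auto
    moreover have ma: "?m \<le> ?m ^ a" using power_increasing[of 1 a ?m] assms by simp
    moreover have "t \<le> t * ?m ^ a" by simp
    ultimately have "n ^ a + n + t + 1 \<le> (t + 2) * ?m ^ a" by (unfold add_mult_distrib, linarith)
    then have "(n ^ a + n + t + 1) ^ d2 \<le> ((t + 2) * ?m ^ a) ^ d2" by (intro power_mono) auto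
    also have "\<dots> = (t + 2) ^ d2 * ?m ^ (a * d2)" by (simp only: power_mult_distrib power_mult)
    also have "\<dots> \<le> (t + 2) ^ d2 * ?m ^ d" by (intro mult_left_mono p(3)) simp
    finally have "C2 * (n ^ a + n + t + 1) ^ d2 \<le> C2 * ((t + 2) ^ d2 * ?m ^ d)" by (intro mult_left_mono) auto
    then have "tb (n ^ a + n + t) (main_c t) \<le> C2 * (t + 2) ^ d2 * ?m ^ d"
      using 2[of "n ^ a + n + t"] by (unfold mult.assoc, linarith)
    moreover have "tb n (pre_c t h a) \<le> C1 * ?m ^ d"
      using 1[of n] mult_left_mono[OF p(2), of C1] by linarith
    moreover have "4 * n + 10 \<le> 10 * ?m ^ d" using p(1) by linarith
    ultimately show ?thesis unfolding C_def by (unfold add_mult_distrib, linarith)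
  qed
  have bp: "bounds (pre_c t h a) \<subseteq> {0}" using mod_pow_c(4)[of a] by (auto simp: pre_c_def)
  have X: "vr (sem n (pre_c t h a) s) x \<le> n ^ a + n + t"
    if "vr s 0 = n" "rw s = input_mem n E" "x \<in> bounds (main_c t)" for n s x E
    using pre_c[OF that(1,2), of t h a] bm(2) that(3) by (auto simp: clique_inv_def env_def)
  have main: "ram_halts_within (clique_prog t h a) (C * (n + 1) ^ d) n E"
    "\<exists>s. vr s 0 = n \<and> ar s = (\<lambda>_ _. 0) \<and> rw s = input_mem n E \<and>
      ram_output (clique_prog t h a) (C * (n + 1) ^ d) n E = out n (sem n (main_c t) (sem n (pre_c t h a) s))"
    if "55 + 2 * t \<le> n" for n E
    using ram_prog_correct[OF _ _ wfc_pre wm bp bm(1) X T, of n E] that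
    unfolding clique_prog_def out_def by simp_all
  have A: "ram_halts_within (clique_prog t h a) (C * (n + 1) ^ d) n E" for n E
  proof (cases "55 + 2 * t \<le> n")
    case True
    then show ?thesis by (rule main)
  next
    case False
    have "1 \<le> (n + 1) ^ d" by simp
    \<comment> \<open>Small inputs stop after three steps, and C is at least 10.\<close>
    then have "3 \<le> C * (n + 1) ^ d" unfolding C_def by (unfold add_mult_distrib, linarith)
    with False boot_small[of n 36 "t+7" "pre_c t h a ;; main_c t" E] show ?thesis
      using run_halted[of "clique_prog t h a" 3 "(0, input_mem n E)" "C * (n + 1) ^ d"]
      by (simp add: ram_halts_within_def clique_prog_def)
  qed
  have B: "is_clique n E (ram_output (clique_prog t h a) (C * (n + 1) ^ d) n E) \<and>
       (\<forall>g y. (\<forall>i<t+3. g i < n) \<longrightarrow> y < n ^ a \<longrightarrow>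
         card (res n E y (near n E h (candT n E t g))) \<le> card (ram_output (clique_prog t h a) (C * (n + 1) ^ d) n E))"
    if n: "55 + 2 * t \<le> n" for n E
  proof -
    obtain s where s: "vr s 0 = n" "rw s = input_mem n E"
      "ram_output (clique_prog t h a) (C * (n + 1) ^ d) n E = out n (sem n (main_c t) (sem n (pre_c t h a) s))"
      using main(2)[OF n] by blast
    have "clique_inv n E t h (n ^ a) (sem n (pre_c t h a) s)" by (rule pre_c[OF s(1,2)])
    note nb = nest_body[OF this order.refl, folded main_c_def]
    define s' where "s' = sem n (main_c t) (sem n (pre_c t h a) s)"
    have i: "clique_inv n E t h (n ^ a) s'" using nb unfolding s'_def by simp
    have "card (res n E y (near n E h (candT n E t g))) \<le> vr s' 8" if "\<forall>i<t+3. g i < n" "y < n ^ a" for g y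
      using nb that unfolding s'_def by simp
    then show ?thesis using i unfolding s(3) s'_def[symmetric] by (simp add: clique_inv_def)
  qed
  show ?thesis using A B by blast
qed

section \<open>Rank-one matrices with noise\<close>

definition mv :: "nat set \<Rightarrow> (nat \<Rightarrow> nat \<Rightarrow> real) \<Rightarrow> (nat \<Rightarrow> real) \<Rightarrow> nat \<Rightarrow> real" where
  "mv V M x = (\<lambda>u. \<Sum>v\<in>V. M u v * x v)"

definition ip :: "nat set \<Rightarrow> (nat \<Rightarrow> real) \<Rightarrow> (nat \<Rightarrow> real) \<Rightarrow> real" where
  "ip V x y = (\<Sum>v\<in>V. x v * y v)"

definition sq :: "nat set \<Rightarrow> (nat \<Rightarrow> real) \<Rightarrow> real" where
  "sq V x = (\<Sum>v\<in>V. (x v)\<^sup>2)"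

lemma sq_nonneg: "0 \<le> sq V x"
  by (simp add: sq_def sum_nonneg)

lemma ip_square_le: "(ip V x y)\<^sup>2 \<le> sq V x * sq V y"
  unfolding ip_def sq_def by (rule Cauchy_Schwarz_ineq_sum)

lemma ip_mv_symmetric:
  assumes "\<And>u v. u \<in> V \<Longrightarrow> v \<in> V \<Longrightarrow> M u v = M v u"
  shows "ip V x (mv V M y) = ip V (mv V M x) y"
proof -
  have "ip V x (mv V M y) = (\<Sum>u\<in>V. \<Sum>v\<in>V. x u * (M u v * y v))"
    by (simp add: ip_def mv_def sum_distrib_left)
  also have "\<dots> = (\<Sum>v\<in>V. \<Sum>u\<in>V. x u * (M u v * y v))" by (rule sum.swap)
  also have "\<dots> = ip V (mv V M x) y"
    unfolding ip_def mv_def sum_distrib_right using assms by (intro sum.cong refl) simp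
  finally show ?thesis .
qed

lemma ip_mv_iter:
  assumes "\<And>u v. u \<in> V \<Longrightarrow> v \<in> V \<Longrightarrow> M u v = M v u"
  shows "ip V x ((mv V M ^^ s) y) = ip V ((mv V M ^^ s) x) y"
proof (induction s arbitrary: x)
  case (Suc s)
  have "ip V x ((mv V M ^^ Suc s) y) = ip V (mv V M x) ((mv V M ^^ s) y)"
    by (simp add: ip_mv_symmetric[OF assms])
  also have "\<dots> = ip V ((mv V M ^^ s) (mv V M x)) y" by (rule Suc)
  finally show ?case by (simp add: funpow_swap1)
qed simp

lemma sq_decompose:
  assumes "sq V u = 1"
  shows "sq V y = (ip V u y)\<^sup>2 + sq V (\<lambda>v. y v - ip V u y * u v)"
proof -
  have "sq V (\<lambda>v. y v - ip V u y * u v)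
      = (\<Sum>v\<in>V. (y v)\<^sup>2 - 2 * ip V u y * (u v * y v) + (ip V u y)\<^sup>2 * (u v)\<^sup>2)"
    unfolding sq_def by (intro sum.cong refl) (simp add: power2_eq_square algebra_simps)
  also have "\<dots> = sq V y - 2 * ip V u y * ip V u y + (ip V u y)\<^sup>2 * sq V u"
    by (simp add: sum.distrib sum_subtractf sq_def ip_def sum_distrib_left)
  finally show ?thesis using assms by (simp add: power2_eq_square)
qed

text \<open>The planted direction is written u, so that M is a rank-one matrix plus noise R. The columns of
  a high power of M are compared in Frobenius norm: their components orthogonal to u are damped by R
  in every step, while those along u add up to the squared norm of M^s u.\<close>

locale rank_one_noise =
  fixes V :: "nat set" and M R :: "nat \<Rightarrow> nat \<Rightarrow> real" and u :: "nat \<Rightarrow> real" and \<kappa> \<rho> \<epsilon> :: real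
  assumes fin: "finite V"
    and sym: "\<And>x y. x \<in> V \<Longrightarrow> y \<in> V \<Longrightarrow> M x y = M y x"
    and decomp: "\<And>x y. x \<in> V \<Longrightarrow> y \<in> V \<Longrightarrow> M x y = \<kappa> * u x * u y + R x y"
    and noise: "\<And>y. sq V (mv V R y) \<le> \<rho>\<^sup>2 * sq V y"
    and unit: "sq V u = 1" and u_nonneg: "\<And>v. 0 \<le> u v"
    and \<rho>: "0 \<le> \<rho>" "\<rho> \<le> \<epsilon> * \<kappa>" and \<kappa>: "0 < \<kappa>" and \<epsilon>: "0 < \<epsilon>" "\<epsilon> \<le> 1 / 10"
begin

abbreviation Z :: "nat \<Rightarrow> nat \<Rightarrow> real" where "Z s \<equiv> (mv V M ^^ s) u"
abbreviation pr :: "(nat \<Rightarrow> real) \<Rightarrow> nat \<Rightarrow> real" where "pr y \<equiv> (\<lambda>v. y v - ip V u y * u v)"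
abbreviation col :: "nat \<Rightarrow> nat \<Rightarrow> nat \<Rightarrow> real" where "col s i \<equiv> (mv V M ^^ s) (\<lambda>v. of_bool (v = i))"

lemma mv_decomp: "v \<in> V \<Longrightarrow> mv V M y v = \<kappa> * ip V u y * u v + mv V R y v"
  by (simp add: mv_def ip_def decomp distrib_right sum.distrib sum_distrib_left sum_distrib_right algebra_simps)

lemma ip_uu: "ip V u u = 1"
  using unit by (simp add: ip_def sq_def power2_eq_square)

lemma ip_mv: "ip V u (mv V M y) = \<kappa> * ip V u y + ip V u (mv V R y)"
proof -
  have "ip V u (mv V M y) = (\<Sum>v\<in>V. \<kappa> * ip V u y * (u v * u v) + u v * mv V R y v)"
    unfolding ip_def[of V u "mv V M y"] by (intro sum.cong refl) (simp add: mv_decomp algebra_simps)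
  also have "\<dots> = \<kappa> * ip V u y * ip V u u + ip V u (mv V R y)"
    by (simp add: sum.distrib ip_def sum_distrib_left)
  finally show ?thesis by (simp add: ip_uu)
qed

text \<open>The rank-one part maps everything to multiples of u, so after one application of M only
  R contributes orthogonally to u.\<close>

lemma sq_pr_mv: "sq V (pr (mv V M y)) \<le> \<rho>\<^sup>2 * sq V y"
proof -
  have "sq V (pr (mv V M y)) = sq V (pr (mv V R y))"
    unfolding sq_def by (intro sum.cong refl) (simp add: mv_decomp ip_mv algebra_simps)
  also have "\<dots> \<le> sq V (mv V R y)" using sq_decompose[OF unit, of "mv V R y"] by simp
  also have "\<dots> \<le> \<rho>\<^sup>2 * sq V y" by (rule noise)
  finally show ?thesis .
qed

lemma ip_noise: "\<bar>ip V u (mv V R y)\<bar> \<le> \<rho> * sqrt (sq V y)"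
proof -
  have "(ip V u (mv V R y))\<^sup>2 \<le> sq V (mv V R y)" using ip_square_le[of V u "mv V R y"] unit by simp
  also have "\<dots> \<le> \<rho>\<^sup>2 * sq V y" by (rule noise)
  finally have "sqrt ((ip V u (mv V R y))\<^sup>2) \<le> sqrt (\<rho>\<^sup>2 * sq V y)" by (rule real_sqrt_le_mono)
  then show ?thesis using \<rho>(1) by (simp add: real_sqrt_mult)
qed

lemma cone_norm:
  assumes "0 < a"
  shows "a\<^sup>2 + (2 * \<epsilon> * a)\<^sup>2 \<le> (11/10 * a)\<^sup>2"
proof -
  have "(2 * \<epsilon> * a)\<^sup>2 \<le> (1/5 * a)\<^sup>2" using assms \<epsilon> by (intro power_mono mult_right_mono) auto
  moreover have "a\<^sup>2 + (1/5 * a)\<^sup>2 \<le> (11/10 * a)\<^sup>2" by (simp add: power2_eq_square)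
  ultimately show ?thesis by linarith
qed

text \<open>The iterates of u stay in a cone around u. In the cone the norm is at most 11/10 times
  the component a along u; so the next component is at least 11/20 \<kappa> a while the next
  orthogonal part is at most 11/10 \<epsilon> \<kappa> a, and the ratio is again at most 2
  \<epsilon>.\<close>

lemma Z_cone: "0 < ip V u (Z s) \<and> sq V (pr (Z s)) \<le> (2 * \<epsilon> * ip V u (Z s))\<^sup>2"
proof (induction s)
  case 0
  then show ?case by (simp add: ip_uu sq_def)
next
  case (Suc s)
  define a where "a = ip V u (Z s)"
  define r where "r = sqrt (sq V (Z s))"
  have a: "0 < a" using Suc by (simp add: a_def)
  have "sq V (Z s) \<le> a\<^sup>2 + (2 * \<epsilon> * a)\<^sup>2" using Suc sq_decompose[OF unit, of "Z s"] by (simp add: a_def)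
  also have "\<dots> \<le> (11/10 * a)\<^sup>2" using a by (rule cone_norm)
  finally have r: "r \<le> 11/10 * a" unfolding r_def using a by (intro real_le_lsqrt) auto
  have r0: "0 \<le> r" by (simp add: r_def sq_nonneg)
  have \<rho>r: "\<rho> * r \<le> \<epsilon> * \<kappa> * (11/10 * a)" using \<rho> r r0 by (intro mult_mono) auto
  have \<epsilon>\<kappa>: "\<epsilon> * \<kappa> * (11/10 * a) \<le> 1/10 * \<kappa> * (11/10 * a)"
    using \<epsilon> \<kappa> a by (intro mult_right_mono) auto
  have ka: "0 < \<kappa> * a" using \<kappa> a by simp
  have up: "ip V u (Z (Suc s)) \<ge> \<kappa> * a - \<rho> * r"
    using ip_noise[of "Z s"] by (simp add: ip_mv a_def r_def abs_le_iff)
  have b: "11/20 * (\<kappa> * a) \<le> ip V u (Z (Suc s))" using up \<rho>r \<epsilon>\<kappa> ka by (simp add: algebra_simps)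
  have "sq V (pr (Z (Suc s))) \<le> \<rho>\<^sup>2 * sq V (Z s)" using sq_pr_mv[of "Z s"] by simp
  also have "\<dots> = (\<rho> * r)\<^sup>2" by (simp add: power_mult_distrib r_def sq_nonneg)
  also have "\<dots> \<le> (2 * \<epsilon> * (11/20 * (\<kappa> * a)))\<^sup>2"
    using \<rho>r \<rho> r0 by (intro power_mono) (auto simp: algebra_simps)
  also have "\<dots> \<le> (2 * \<epsilon> * ip V u (Z (Suc s)))\<^sup>2"
    using b \<epsilon> ka by (intro power_mono mult_left_mono) auto
  finally show ?case using b ka by simp
qed

lemma sq_Z_Suc: "(\<kappa> / 2)\<^sup>2 * sq V (Z s) \<le> sq V (Z (Suc s))"
proof -
  define a where "a = ip V u (Z s)"
  have a: "0 < a" using Z_cone by (simp add: a_def)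
  have "sq V (Z s) \<le> a\<^sup>2 + (2 * \<epsilon> * a)\<^sup>2" using Z_cone[of s] sq_decompose[OF unit, of "Z s"] by (simp add: a_def)
  also have "\<dots> \<le> (11/10 * a)\<^sup>2" using a by (rule cone_norm)
  finally have s: "sq V (Z s) \<le> (11/10 * a)\<^sup>2" .
  then have r: "sqrt (sq V (Z s)) \<le> 11/10 * a" using a by (intro real_le_lsqrt) auto
  have "\<rho> * sqrt (sq V (Z s)) \<le> \<epsilon> * \<kappa> * (11/10 * a)"
    using \<rho> r by (intro mult_mono) (auto simp: sq_nonneg)
  also have "\<dots> \<le> 1/10 * \<kappa> * (11/10 * a)" using \<epsilon> \<kappa> a by (intro mult_right_mono) auto
  finally have "\<rho> * sqrt (sq V (Z s)) \<le> 11/100 * (\<kappa> * a)" by simp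
  then have b: "89/100 * (\<kappa> * a) \<le> ip V u (Z (Suc s))"
    using ip_noise[of "Z s"] by (simp add: ip_mv a_def[symmetric] abs_le_iff)
  have ka: "0 < \<kappa> * a" using \<kappa> a by simp
  have "(\<kappa> / 2)\<^sup>2 * sq V (Z s) \<le> (\<kappa> / 2)\<^sup>2 * (11/10 * a)\<^sup>2" using s by (intro mult_left_mono) auto
  also have "\<dots> = (11/20 * (\<kappa> * a))\<^sup>2" by (simp add: power2_eq_square)
  also have "\<dots> \<le> (ip V u (Z (Suc s)))\<^sup>2" using b ka by (intro power_mono) auto
  also have "\<dots> \<le> sq V (Z (Suc s))" using sq_decompose[OF unit, of "Z (Suc s)"] sq_nonneg[of V "pr (Z (Suc s))"] by linarith
  finally show ?thesis .
qed

lemma sq_Z_lower: "(\<kappa> / 2) ^ (2 * s) \<le> sq V (Z s)"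
proof (induction s)
  case (Suc s)
  have "(\<kappa> / 2) ^ (2 * Suc s) = (\<kappa> / 2)\<^sup>2 * (\<kappa> / 2) ^ (2 * s)" by (simp add: power2_eq_square)
  also have "\<dots> \<le> (\<kappa> / 2)\<^sup>2 * sq V (Z s)" using Suc by (intro mult_left_mono) auto
  also have "\<dots> \<le> sq V (Z (Suc s))" by (rule sq_Z_Suc)
  finally show ?case .
qed (simp add: unit)

text \<open>By symmetry the power of M moves to the other factor, so the component of column i along
  u is an entry of the iterate of u.\<close>

lemma ip_col: "i \<in> V \<Longrightarrow> ip V u (col s i) = Z s i"
  by (subst ip_mv_iter[OF sym]) (simp_all add: ip_def fin sum.delta if_distrib of_bool_def cong: if_cong)

text \<open>The squared Frobenius norm of the part of the s-th power orthogonal to u.\<close>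

definition dev :: "nat \<Rightarrow> real" where
  "dev s = (\<Sum>i\<in>V. sq V (pr (col s i)))"

lemma dev_Suc: "dev (Suc s) \<le> \<rho>\<^sup>2 * (sq V (Z s) + dev s)"
proof -
  have "dev (Suc s) \<le> (\<Sum>i\<in>V. \<rho>\<^sup>2 * sq V (col s i))"
    unfolding dev_def using sq_pr_mv by (intro sum_mono) simp
  also have "\<dots> = \<rho>\<^sup>2 * (\<Sum>i\<in>V. (Z s i)\<^sup>2 + sq V (pr (col s i)))"
    unfolding sum_distrib_left
  proof (intro sum.cong refl)
    fix i assume "i \<in> V"
    then have "sq V (col s i) = (Z s i)\<^sup>2 + sq V (pr (col s i))"
      using sq_decompose[OF unit, of "col s i"] by (simp only: ip_col)
    then show "\<rho>\<^sup>2 * sq V (col s i) = \<rho>\<^sup>2 * ((Z s i)\<^sup>2 + sq V (pr (col s i)))" by (simp only:)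
  qed
  also have "\<dots> = \<rho>\<^sup>2 * (sq V (Z s) + dev s)" by (simp add: sum.distrib dev_def sq_def)
  finally show ?thesis .
qed

text \<open>One step damps by \<rho>^2, at most \<epsilon>^2 \<kappa>^2, whereas the squared norm of
  \<open>Z s\<close> grows at least by the factor \<kappa>^2 / 4. The contribution of
  \<open>Z s\<close> therefore becomes 4 \<epsilon>^2 and that of the old deviation at most another
  4 \<epsilon>^2. The term with \<open>card V\<close> is what remains of the identity matrix at s =
  0.\<close>

lemma dev_bound: "dev s \<le> 8 * \<epsilon>\<^sup>2 * sq V (Z s) + card V * \<rho> ^ (2 * s)"
proof (induction s)
  case 0
  have "dev 0 \<le> (\<Sum>i\<in>V. 1)"
    unfolding dev_def
  proof (rule sum_mono)
    fix i assume i: "i \<in> V"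
    have "sq V (pr (col 0 i)) \<le> sq V (col 0 i)" using sq_decompose[OF unit, of "col 0 i"] by simp
    also have "\<dots> = 1" using i fin by (simp add: sq_def of_bool_def if_distrib[of "\<lambda>x. x\<^sup>2"] sum.delta cong: if_cong)
    finally show "sq V (pr (col 0 i)) \<le> 1" .
  qed
  then have "dev 0 \<le> real (card V)" by simp
  moreover have "0 \<le> 8 * \<epsilon>\<^sup>2" by simp
  ultimately have "dev 0 \<le> 8 * \<epsilon>\<^sup>2 + real (card V)" by linarith
  then show ?case using unit by simp
next
  case (Suc s)
  have \<rho>\<kappa>: "\<rho>\<^sup>2 \<le> (\<epsilon> * \<kappa>)\<^sup>2" using \<rho> by (intro power_mono) auto
  have "\<rho>\<^sup>2 * sq V (Z s) \<le> (\<epsilon> * \<kappa>)\<^sup>2 * sq V (Z s)" using \<rho>\<kappa> sq_nonneg by (intro mult_right_mono)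
  also have "\<dots> = 4 * \<epsilon>\<^sup>2 * ((\<kappa> / 2)\<^sup>2 * sq V (Z s))" by (simp add: power2_eq_square)
  also have "\<dots> \<le> 4 * \<epsilon>\<^sup>2 * sq V (Z (Suc s))" by (intro mult_left_mono sq_Z_Suc) simp
  finally have 1: "\<rho>\<^sup>2 * sq V (Z s) \<le> 4 * \<epsilon>\<^sup>2 * sq V (Z (Suc s))" .
  have e2: "\<epsilon>\<^sup>2 \<le> (1/10)\<^sup>2" using \<epsilon> by (intro power_mono) auto
  have "\<rho>\<^sup>2 * (8 * \<epsilon>\<^sup>2 * sq V (Z s)) = 8 * \<epsilon>\<^sup>2 * (\<rho>\<^sup>2 * sq V (Z s))" by simp
  also have "\<dots> \<le> 8 * (1/10)\<^sup>2 * (4 * \<epsilon>\<^sup>2 * sq V (Z (Suc s)))"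
    using e2 by (intro mult_mono[OF _ 1]) (auto simp: sq_nonneg)
  also have "\<dots> \<le> 1 * (4 * \<epsilon>\<^sup>2 * sq V (Z (Suc s)))"
    by (intro mult_right_mono mult_nonneg_nonneg sq_nonneg) (auto simp: power2_eq_square)
  finally have 2: "\<rho>\<^sup>2 * (8 * \<epsilon>\<^sup>2 * sq V (Z s)) \<le> 4 * \<epsilon>\<^sup>2 * sq V (Z (Suc s))"
    by (simp only: mult_1_left)
  have "dev (Suc s) \<le> \<rho>\<^sup>2 * (sq V (Z s) + (8 * \<epsilon>\<^sup>2 * sq V (Z s) + card V * \<rho> ^ (2 * s)))"
    using Suc by (intro order.trans[OF dev_Suc] mult_left_mono add_left_mono) auto
  also have "\<dots> = \<rho>\<^sup>2 * sq V (Z s) + \<rho>\<^sup>2 * (8 * \<epsilon>\<^sup>2 * sq V (Z s)) + card V * \<rho> ^ (2 * Suc s)"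
    by (simp add: algebra_simps power2_eq_square)
  finally show ?case using 1 2 by linarith
qed

lemma good_column:
  assumes s: "card V * (2 * \<epsilon>) ^ (2 * s) \<le> \<epsilon>\<^sup>2"
  obtains i where "i \<in> V" "0 < Z s i" "sq V (\<lambda>v. col s i v - Z s i * u v) \<le> 20 * \<epsilon>\<^sup>2 * (Z s i)\<^sup>2"
proof -
  define g where "g = sq V (Z s)"
  have "0 < (\<kappa> / 2) ^ (2 * s)" using \<kappa> by simp
  then have g: "0 < g" using sq_Z_lower[of s] unfolding g_def by linarith
  have "\<rho> ^ (2 * s) \<le> (\<epsilon> * \<kappa>) ^ (2 * s)" using \<rho> by (intro power_mono) auto
  also have "\<dots> = (2 * \<epsilon>) ^ (2 * s) * (\<kappa> / 2) ^ (2 * s)"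
    unfolding power_mult_distrib[symmetric] by simp
  also have "\<dots> \<le> (2 * \<epsilon>) ^ (2 * s) * g" using sq_Z_lower \<epsilon> by (intro mult_left_mono) (auto simp: g_def)
  finally have "card V * \<rho> ^ (2 * s) \<le> card V * ((2 * \<epsilon>) ^ (2 * s) * g)" by (intro mult_left_mono) auto
  also have "\<dots> \<le> \<epsilon>\<^sup>2 * g" using mult_right_mono[OF s, of g] g by (simp add: mult.assoc)
  finally have dev: "dev s \<le> 9 * \<epsilon>\<^sup>2 * g" using dev_bound[of s] by (simp add: g_def)
  define a where "a = ip V u (Z s)"
  define A B where "A = {i \<in> V. 0 < Z s i}" and "B = {i \<in> V. Z s i \<le> 0}"
  have AB: "V = A \<union> B" "A \<inter> B = {}" "finite A" "finite B" using fin by (auto simp: A_def B_def)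
  have "(\<Sum>i\<in>B. (Z s i)\<^sup>2) \<le> (\<Sum>i\<in>B. (pr (Z s) i)\<^sup>2)"
  proof (rule sum_mono)
    fix i assume i: "i \<in> B"
    \<comment> \<open>A non-positive entry lies below the non-negative multiple of u, so its
      absolute value is at most its distance to that multiple.\<close>
    have "0 \<le> a * u i" using Z_cone[of s] u_nonneg[of i] by (simp add: a_def)
    then have "\<bar>Z s i\<bar> \<le> \<bar>pr (Z s) i\<bar>" using i by (auto simp: B_def a_def)
    then show "(Z s i)\<^sup>2 \<le> (pr (Z s) i)\<^sup>2" by (simp only: abs_le_square_iff)
  qed
  also have "\<dots> \<le> sq V (pr (Z s))" unfolding sq_def using AB fin by (intro sum_mono2) auto
  also have "\<dots> \<le> (2 * \<epsilon> * a)\<^sup>2" using Z_cone[of s] by (simp add: a_def)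
  also have "\<dots> \<le> (1/2 * a)\<^sup>2" using Z_cone[of s] \<epsilon> by (intro power_mono mult_right_mono) (auto simp: a_def)
  also have "\<dots> \<le> 1/2 * g" using sq_decompose[OF unit, of "Z s"] sq_nonneg[of V "pr (Z s)"] g
    by (simp add: a_def g_def power2_eq_square)
  finally have Bg: "(\<Sum>i\<in>B. (Z s i)\<^sup>2) \<le> 1/2 * g" .
  have "g = (\<Sum>i\<in>A. (Z s i)\<^sup>2) + (\<Sum>i\<in>B. (Z s i)\<^sup>2)"
    unfolding g_def sq_def AB(1) using AB by (intro sum.union_disjoint) auto
  with Bg have Ag: "1/2 * g \<le> (\<Sum>i\<in>A. (Z s i)\<^sup>2)" by linarith
  have "\<exists>i\<in>A. sq V (pr (col s i)) \<le> 20 * \<epsilon>\<^sup>2 * (Z s i)\<^sup>2"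
  proof (rule ccontr)
    assume "\<not> ?thesis"
    then have "(\<Sum>i\<in>A. 20 * \<epsilon>\<^sup>2 * (Z s i)\<^sup>2) \<le> (\<Sum>i\<in>A. sq V (pr (col s i)))"
      by (intro sum_mono) auto
    also have "\<dots> \<le> dev s" unfolding dev_def using AB fin by (intro sum_mono2) (auto simp: sq_nonneg)
    also have "\<dots> \<le> 9 * \<epsilon>\<^sup>2 * g" by (rule dev)
    finally have "\<epsilon>\<^sup>2 * (20 * (\<Sum>i\<in>A. (Z s i)\<^sup>2)) \<le> \<epsilon>\<^sup>2 * (9 * g)"
      by (simp add: sum_distrib_left mult_ac)
    then have "20 * (\<Sum>i\<in>A. (Z s i)\<^sup>2) \<le> 9 * g" using \<epsilon>(1) by simp
    then show False using g Ag by linarith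
  qed
  then obtain i where "i \<in> A" "sq V (pr (col s i)) \<le> 20 * \<epsilon>\<^sup>2 * (Z s i)\<^sup>2" by blast
  then show thesis using that[of i] by (auto simp: A_def ip_col)
qed

end

text \<open>Cutting at \<theta>, half of the ideal value a / sqrt (card K), each misplaced vertex
  contributes at least \<theta>^2 to the squared error, so there are at most 80 \<delta> card K of
  them. The cut has to be named by a vertex: the smallest entry of x not below \<theta> cuts in the
  same place, and the bound on \<delta> ensures that there is one.\<close>

lemma threshold_recovers:
  fixes x :: "nat \<Rightarrow> real"
  assumes V: "finite V" "K \<subseteq> V" "K \<noteq> {}" and a: "0 < a" and \<eta>: "20 * \<delta> * 4 < 1"
    and b: "sq V (\<lambda>v. x v - a * (if v \<in> K then 1 / sqrt (card K) else 0)) \<le> 20 * \<delta> * a\<^sup>2"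
  shows "\<exists>l\<in>V. real (card ({v \<in> V. x l \<le> x v} - K)) \<le> 80 * \<delta> * card K
     \<and> real (card (K - {v \<in> V. x l \<le> x v})) \<le> 80 * \<delta> * card K"
proof -
  define k where "k = real (card K)"
  have k: "0 < k" using V finite_subset[OF V(2,1)] by (simp add: k_def card_gt_0_iff)
  define \<theta> where "\<theta> = a / (2 * sqrt k)"
  have \<theta>: "0 < \<theta>" "\<theta>\<^sup>2 = a\<^sup>2 / (4 * k)" "a / sqrt k = 2 * \<theta>" using a k by (auto simp: \<theta>_def power_divide power_mult_distrib)
  define e where "e = (\<lambda>v. x v - a * (if v \<in> K then 1 / sqrt (card K) else 0))"
  define T where "T = {v \<in> V. \<theta> \<le> x v}"
  have count: "real (card A) \<le> 80 * \<delta> * k" if A: "A \<subseteq> V" "\<And>v. v \<in> A \<Longrightarrow> \<theta> \<le> \<bar>e v\<bar>" for A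
  proof -
    have "card A * \<theta>\<^sup>2 = (\<Sum>v\<in>A. \<theta>\<^sup>2)" by simp
    also have "\<dots> \<le> (\<Sum>v\<in>A. (e v)\<^sup>2)" 
    proof (rule sum_mono)
      fix v assume "v \<in> A"
      then show "\<theta>\<^sup>2 \<le> (e v)\<^sup>2" using A(2)[of v] \<theta>(1) abs_le_square_iff[of \<theta> "e v"] by simp
    qed
    also have "\<dots> \<le> sq V e" unfolding sq_def using A(1) V(1) by (intro sum_mono2) auto
    also have "\<dots> \<le> 20 * \<delta> * a\<^sup>2" using b by (simp add: e_def)
    finally have "card A * (a\<^sup>2 / (4 * k)) \<le> 20 * \<delta> * a\<^sup>2" by (simp add: \<theta>)
    then have "real (card A) * a\<^sup>2 \<le> (80 * \<delta> * k) * a\<^sup>2" using k by (simp add: field_simps)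
    then show ?thesis using a by simp
  qed
  have 1: "real (card (T - K)) \<le> 80 * \<delta> * k" by (rule count) (auto simp: T_def e_def)
  have 2: "real (card (K - T)) \<le> 80 * \<delta> * k"
  proof (rule count)
    show "K - T \<subseteq> V" using V by auto
    fix v assume v: "v \<in> K - T"
    then have "x v < \<theta>" using V by (auto simp: T_def)
    moreover have "e v = x v - 2 * \<theta>" using v \<theta>(3) by (simp add: e_def k_def)
    ultimately show "\<theta> \<le> \<bar>e v\<bar>" by linarith
  qed
  have "T \<noteq> {}"
  proof
    assume "T = {}"
    then have "k \<le> 80 * \<delta> * k" using 2 by (simp add: k_def)
    then show False using k \<eta> by simp
  qed
  have "finite T" using V by (simp add: T_def)
  with \<open>T \<noteq> {}\<close> have "Min (x ` T) \<in> x ` T" by (intro Min_in) auto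
  then obtain l where "l \<in> T" "x l = Min (x ` T)" by auto
  then have l: "l \<in> T" "\<And>v. v \<in> T \<Longrightarrow> x l \<le> x v" using \<open>finite T\<close> by auto
  then have "{v \<in> V. x l \<le> x v} = T" by (auto simp: T_def)
  then show ?thesis using 1 2 l(1) by (intro bexI[of _ l]) (auto simp: k_def T_def)
qed

section \<open>Random graphs\<close>

lemma finite_all_pairs: "finite (all_pairs n)"
  by (rule finite_subset[of _ "Pow {..<n}"]) (auto simp: all_pairs_def)

text \<open>Hoeffding's lemma for one centred Bernoulli variable; a negative x is reduced to a
  positive one by exchanging p and 1-p.\<close>

lemma bernoulli_mgf:
  fixes p x :: real
  assumes "0 \<le> p" "p \<le> 1"
  shows "exp (x * (1 - p)) * p + exp (x * (0 - p)) * (1 - p) \<le> exp (x\<^sup>2 / 8)"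
proof -
  have *: "exp (h * (1 - q)) * q + exp (h * (0 - q)) * (1 - q) \<le> exp (h\<^sup>2 / 8)"
    if h: "0 \<le> h" and q: "0 \<le> q" "q \<le> 1" for h q :: real
  proof -
    have "0 \<le> q * (exp h - 1)" using h q by (intro mult_nonneg_nonneg) auto
    then have pos: "0 < 1 + q * (exp h - 1)" by linarith
    have "exp (h * (1 - q)) * q + exp (h * (0 - q)) * (1 - q) = exp (- h * q) * (1 + q * (exp h - 1))"
      by (simp add: algebra_simps exp_diff exp_minus field_simps exp_add[symmetric])
    also have "\<dots> = exp (- h * q + ln (1 + q * (exp h - 1)))"
      unfolding exp_add using pos by simp
    also have "\<dots> \<le> exp (h\<^sup>2 / 8)" using Hoeffdings_lemma_aux[OF h q(1)] by simp
    finally show ?thesis .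
  qed
  show ?thesis
  proof (cases "0 \<le> x")
    case True
    then show ?thesis using * assms by blast
  next
    case False
    then show ?thesis using *[of "- x" "1 - p"] assms by (simp add: algebra_simps)
  qed
qed

text \<open>An exponential-moment bound together with a set F of prescribed edges: as F and D are
  disjoint, independence splits off the factor \<open>p ^ card F\<close>. With D empty it bounds the
  presence of a subgraph, with F empty it is a Chernoff bound.\<close>

lemma gnp_prob_le:
  assumes p: "0 \<le> p" "p \<le> 1" and F: "F \<subseteq> all_pairs n" and D: "D \<subseteq> all_pairs n - F" and l: "0 \<le> l"
  shows "measure_pmf.prob (gnp n p) {E. F \<subseteq> E \<and> \<tau> \<le> (\<Sum>e\<in>D. a e * (of_bool (e \<in> E) - p))}
     \<le> p ^ card F * exp (l\<^sup>2 * (\<Sum>e\<in>D. (a e)\<^sup>2) / 8 - l * \<tau>)"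
proof -
  define A where "A = all_pairs n"
  have fA: "finite A" by (simp add: A_def finite_all_pairs)
  have FDA: "F \<subseteq> A" "D \<subseteq> A" "F \<inter> D = {}" using F D unfolding A_def by auto
  note FD = FDA finite_subset[OF FDA(1) fA] finite_subset[OF FDA(2) fA]
  \<comment> \<open>One factor per edge, the indicator of presence on F and an exponential weight on
    D. Multiplied by \<open>exp (- l * \<tau>)\<close>, their product is at least the indicator of
    the event.\<close>
  define f where "f e x = (if e \<in> F then of_bool x else if e \<in> D then exp (l * a e * (of_bool x - p)) else 1)" for e x
  define B where "B = Pi_pmf A False (\<lambda>_. bernoulli_pmf p)"
  have f0: "0 \<le> f e x" for e x by (simp add: f_def)
  have split: "(\<Prod>e\<in>A. g e) = (\<Prod>e\<in>F. g e) * (\<Prod>e\<in>D. g e)" if "\<And>e. e \<notin> F \<Longrightarrow> e \<notin> D \<Longrightarrow> g e = 1" for g :: "nat set \<Rightarrow> real"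
  proof -
    have "(\<Prod>e\<in>A. g e) = (\<Prod>e\<in>F \<union> D. g e)"
      using that FD fA by (intro prod.mono_neutral_right) auto
    also have "\<dots> = (\<Prod>e\<in>F. g e) * (\<Prod>e\<in>D. g e)" using FD by (intro prod.union_disjoint) auto
    finally show ?thesis .
  qed
  have "measure_pmf.prob (gnp n p) {E. F \<subseteq> E \<and> \<tau> \<le> (\<Sum>e\<in>D. a e * (of_bool (e \<in> E) - p))}
      = measure_pmf.prob B {b. (\<forall>e\<in>F. b e) \<and> \<tau> \<le> (\<Sum>e\<in>D. a e * (of_bool (b e) - p))}"
  proof -
    have "(\<Sum>e\<in>D. a e * (of_bool (e \<in> {e \<in> A. b e}) - p)) = (\<Sum>e\<in>D. a e * (of_bool (b e) - p))" for b
      using FD by (intro sum.cong refl) auto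
    moreover have "F \<subseteq> {e \<in> A. b e} \<longleftrightarrow> (\<forall>e\<in>F. b e)" for b using FD by auto
    ultimately show ?thesis
      by (simp add: gnp_def B_def A_def[symmetric] vimage_def)
  qed
  also have "\<dots> = measure_pmf.expectation B (indicator {b. (\<forall>e\<in>F. b e) \<and> \<tau> \<le> (\<Sum>e\<in>D. a e * (of_bool (b e) - p))})"
    by simp
  also have "\<dots> \<le> measure_pmf.expectation B (\<lambda>b. exp (- l * \<tau>) * (\<Prod>e\<in>A. f e (b e)))"
  proof (rule integral_mono)
    have fin: "finite (set_pmf B)" unfolding B_def
      unfolding set_Pi_pmf[OF fA] by (rule finite_PiE_dflt[OF fA]) simp
    then show "integrable (measure_pmf B) (\<lambda>b. exp (- l * \<tau>) * (\<Prod>e\<in>A. f e (b e)))"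
      by (rule integrable_measure_pmf_finite)
    show "integrable (measure_pmf B) (indicat_real {b. (\<forall>e\<in>F. b e) \<and> \<tau> \<le> (\<Sum>e\<in>D. a e * (of_bool (b e) - p))})"
      using fin by (rule integrable_measure_pmf_finite)
    fix b
    show "indicat_real {b. (\<forall>e\<in>F. b e) \<and> \<tau> \<le> (\<Sum>e\<in>D. a e * (of_bool (b e) - p))} b
        \<le> exp (- l * \<tau>) * (\<Prod>e\<in>A. f e (b e))"
    proof (cases "(\<forall>e\<in>F. b e) \<and> \<tau> \<le> (\<Sum>e\<in>D. a e * (of_bool (b e) - p))")
      case True
      have "(\<Prod>e\<in>A. f e (b e)) = (\<Prod>e\<in>F. f e (b e)) * (\<Prod>e\<in>D. f e (b e))" by (rule split) (simp add: f_def)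
      also have "(\<Prod>e\<in>F. f e (b e)) = 1" using True by (intro prod.neutral) (auto simp: f_def)
      also have "(\<Prod>e\<in>D. f e (b e)) = (\<Prod>e\<in>D. exp (l * a e * (of_bool (b e) - p)))"
        using FD by (intro prod.cong refl) (auto simp: f_def)
      also have "\<dots> = exp (l * (\<Sum>e\<in>D. a e * (of_bool (b e) - p)))"
        by (simp add: exp_sum[symmetric] FD sum_distrib_left mult.assoc)
      finally have "exp (- l * \<tau>) * (\<Prod>e\<in>A. f e (b e)) = exp (l * ((\<Sum>e\<in>D. a e * (of_bool (b e) - p)) - \<tau>))"
        by (simp add: exp_add[symmetric] algebra_simps)
      also have "\<dots> \<ge> 1" using True l by simp
      finally show ?thesis using True by simp
    next
      case False
      then show ?thesis by (simp add: prod_nonneg f0)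
    qed
  qed
  also have "\<dots> = exp (- l * \<tau>) * (\<Prod>e\<in>A. measure_pmf.expectation (bernoulli_pmf p) (f e))"
    unfolding B_def using fA f0
    by (subst integral_mult_right_zero, subst expectation_prod_Pi_pmf) (auto intro: integrable_measure_pmf_finite)
  finally have le: "measure_pmf.prob (gnp n p) {E. F \<subseteq> E \<and> \<tau> \<le> (\<Sum>e\<in>D. a e * (of_bool (e \<in> E) - p))}
      \<le> exp (- l * \<tau>) * (\<Prod>e\<in>A. measure_pmf.expectation (bernoulli_pmf p) (f e))" .
  have "(\<Prod>e\<in>A. measure_pmf.expectation (bernoulli_pmf p) (f e)) = (\<Prod>e\<in>F. p) *
      (\<Prod>e\<in>D. exp (l * a e * (1 - p)) * p + exp (l * a e * (0 - p)) * (1 - p))"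
  proof -
    have "(\<Prod>e\<in>A. measure_pmf.expectation (bernoulli_pmf p) (f e))
        = (\<Prod>e\<in>F. measure_pmf.expectation (bernoulli_pmf p) (f e)) * (\<Prod>e\<in>D. measure_pmf.expectation (bernoulli_pmf p) (f e))"
      by (rule split) (use p in \<open>simp add: f_def\<close>)
    also have "(\<Prod>e\<in>F. measure_pmf.expectation (bernoulli_pmf p) (f e)) = (\<Prod>e\<in>F. p)"
      using p by (intro prod.cong refl) (simp add: f_def)
    also have "(\<Prod>e\<in>D. measure_pmf.expectation (bernoulli_pmf p) (f e))
       = (\<Prod>e\<in>D. exp (l * a e * (1 - p)) * p + exp (l * a e * (0 - p)) * (1 - p))"
      using p FD by (intro prod.cong refl) (auto simp: f_def)
    finally show ?thesis .
  qed
  also have "\<dots> \<le> (\<Prod>e\<in>F. p) * (\<Prod>e\<in>D. exp ((l * a e)\<^sup>2 / 8))"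
    using p bernoulli_mgf[OF p]
    by (intro mult_left_mono prod_mono) (auto intro!: add_nonneg_nonneg mult_nonneg_nonneg)
  also have "\<dots> = p ^ card F * exp (l\<^sup>2 * (\<Sum>e\<in>D. (a e)\<^sup>2) / 8)"
    by (simp add: exp_sum[symmetric] FD sum_distrib_left power_mult_distrib sum_divide_distrib)
  finally have "exp (- l * \<tau>) * (\<Prod>e\<in>A. measure_pmf.expectation (bernoulli_pmf p) (f e))
      \<le> exp (- l * \<tau>) * (p ^ card F * exp (l\<^sup>2 * (\<Sum>e\<in>D. (a e)\<^sup>2) / 8))"
    by (intro mult_left_mono) auto
  also have "\<dots> = p ^ card F * (exp (l\<^sup>2 * (\<Sum>e\<in>D. (a e)\<^sup>2) / 8) * exp (- l * \<tau>))" by simp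
  also have "\<dots> = p ^ card F * exp (l\<^sup>2 * (\<Sum>e\<in>D. (a e)\<^sup>2) / 8 - l * \<tau>)"
    unfolding exp_add[symmetric] by simp
  finally show ?thesis using le by linarith
qed

lemma prob_Bex_le:
  assumes "finite I" "\<And>i. i \<in> I \<Longrightarrow> measure_pmf.prob M {x. P i x} \<le> f i"
  shows "measure_pmf.prob M {x. \<exists>i\<in>I. P i x} \<le> (\<Sum>i\<in>I. f i)"
proof -
  have "{x. \<exists>i\<in>I. P i x} = (\<Union>i\<in>I. {x. P i x})" by auto
  then have "measure_pmf.prob M {x. \<exists>i\<in>I. P i x} \<le> (\<Sum>i\<in>I. measure_pmf.prob M {x. P i x})"
    using assms(1) by (simp add: measure_pmf.finite_measure_subadditive_finite)
  also have "\<dots> \<le> (\<Sum>i\<in>I. f i)" by (intro sum_mono assms)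
  finally show ?thesis .
qed

lemma sum_Pow_power_card:
  fixes x :: real
  assumes "finite S"
  shows "(\<Sum>B\<in>Pow S. x ^ card B) = (1 + x) ^ card S"
  using assms
proof (induction S rule: finite_induct)
  case (insert a S)
  have inj: "inj_on (insert a) (Pow S)" using insert(2) by (auto simp: inj_on_def)
  have "(\<Sum>B\<in>Pow (insert a S). x ^ card B) = (\<Sum>B\<in>Pow S. x ^ card B) + (\<Sum>B\<in>insert a ` Pow S. x ^ card B)"
    unfolding Pow_insert using insert by (intro sum.union_disjoint) auto
  also have "(\<Sum>B\<in>insert a ` Pow S. x ^ card B) = (\<Sum>B\<in>Pow S. x * x ^ card B)"
    unfolding sum.reindex[OF inj] o_def
  proof (intro sum.cong refl)
    fix B assume "B \<in> Pow S"
    then have "finite B" "a \<notin> B" using insert finite_subset by auto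
    then show "x ^ card (insert a B) = x * x ^ card B" by simp
  qed
  finally show ?case using insert by (simp add: sum_distrib_left[symmetric] algebra_simps)
qed simp

lemma sum_Pow_exp_le:
  fixes x :: real
  assumes "0 \<le> x" "S \<subseteq> {..<n}"
  shows "(\<Sum>B\<in>Pow S. x ^ card B) \<le> exp (real n * x)"
proof -
  have f: "finite S" using assms(2) finite_subset by blast
  have "card S \<le> n" using card_mono[OF _ assms(2)] by simp
  then have "(1 + x) ^ card S \<le> (1 + x) ^ n" using assms(1) by (intro power_increasing) auto
  also have "\<dots> \<le> exp x ^ n" using assms(1) exp_ge_add_one_self[of x] by (intro power_mono) auto
  also have "\<dots> = exp (real n * x)" by (simp add: exp_of_nat_mult)
  finally show ?thesis by (simp add: sum_Pow_power_card[OF f])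
qed

lemma card_subsets_le: "card {K. K \<subseteq> {..<n} \<and> card K = m} \<le> n ^ m"
proof -
  have "card {K. K \<subseteq> {..<n} \<and> card K = m} = n choose m" using n_subsets[of "{..<n}" m] by simp
  also have "\<dots> \<le> n ^ m" by (cases "m \<le> n") (auto intro: binomial_le_pow simp: binomial_eq_0)
  finally show ?thesis .
qed

section \<open>Common neighbourhoods, cliques and dense pairs in G(n,p)\<close>

definition star_pairs :: "nat set \<Rightarrow> nat set \<Rightarrow> nat set set" where
  "star_pairs Q B = (\<lambda>(q, b). {q, b}) ` (Q \<times> B)"

lemma card_star_pairs:
  assumes "Q \<inter> B = {}"
  shows "card (star_pairs Q B) = card Q * card B"
proof -
  have "inj_on (\<lambda>(q, b). {q, b}) (Q \<times> B)" using assms by (auto simp: inj_on_def doubleton_eq_iff)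
  then show ?thesis by (simp add: star_pairs_def card_image card_cartesian_product)
qed

lemma star_pairs_subset:
  assumes "Q \<subseteq> {..<n}" "B \<subseteq> {..<n}" "Q \<inter> B = {}"
  shows "star_pairs Q B \<subseteq> all_pairs n"
proof
  fix e assume "e \<in> star_pairs Q B"
  then obtain q b where qb: "q \<in> Q" "b \<in> B" "e = {q, b}" by (auto simp: star_pairs_def)
  then have "q < n" "b < n" "q \<noteq> b" using assms by auto
  with qb(3) show "e \<in> all_pairs n" unfolding all_pairs_def by blast
qed

text \<open>Weighting a set B by the probability that it lies in the common neighbourhood of Q lets the
  union bound run over all B at the cost of a factor exp(n p^t) only.\<close>

lemma prob_large_nbh:
  assumes p: "0 \<le> p" "p \<le> 1"
  shows "measure_pmf.prob (gnp n p) {E. \<exists>Q\<in>{Q. Q \<subseteq> {..<n} \<and> card Q = t}. \<exists>B\<in>{B \<in> Pow ({..<n} - Q). m \<le> real (card B)}.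
      star_pairs Q B \<subseteq> E} \<le> real n ^ t * exp (8 * real n * p ^ t - 2 * m)"
proof -
  let ?Qs = "{Q. Q \<subseteq> {..<n} \<and> card Q = t}"
  have fQ: "finite ?Qs" by (rule finite_subset[of _ "Pow {..<n}"]) auto
  have e2: "exp (2::real) \<le> 8"
  proof -
    have "exp (2::real) = exp 1 * exp 1" by (simp flip: exp_add)
    also have "\<dots> \<le> (2.75::real) * 2.75" using e_less_272 by (intro mult_mono) auto
    finally show ?thesis by simp
  qed
  have "measure_pmf.prob (gnp n p) {E. \<exists>Q\<in>?Qs. \<exists>B\<in>{B \<in> Pow ({..<n} - Q). m \<le> real (card B)}. star_pairs Q B \<subseteq> E}
     \<le> (\<Sum>Q\<in>?Qs. exp (8 * real n * p ^ t - 2 * m))"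
  proof (rule prob_Bex_le[OF fQ])
    fix Q assume Q: "Q \<in> ?Qs"
    let ?Bs = "{B \<in> Pow ({..<n} - Q). m \<le> real (card B)}"
    have fB: "finite ?Bs" by simp
    have "measure_pmf.prob (gnp n p) {E. \<exists>B\<in>?Bs. star_pairs Q B \<subseteq> E} \<le> (\<Sum>B\<in>?Bs. (p ^ t) ^ card B)"
    proof (rule prob_Bex_le[OF fB])
      fix B assume B: "B \<in> ?Bs"
      have "star_pairs Q B \<subseteq> all_pairs n" using B Q by (intro star_pairs_subset) auto
      then have "measure_pmf.prob (gnp n p) {E. star_pairs Q B \<subseteq> E} \<le> p ^ card (star_pairs Q B)"
        using gnp_prob_le[OF p, of "star_pairs Q B" n "{}" 0 0] by simp
      also have "card (star_pairs Q B) = t * card B" using B Q by (subst card_star_pairs) auto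
      finally show "measure_pmf.prob (gnp n p) {E. star_pairs Q B \<subseteq> E} \<le> (p ^ t) ^ card B"
        by (simp add: power_mult)
    qed
    \<comment> \<open>Since B has at least m members, a factor exp 2 per member pays for exp (- 2
      m). Bounding exp 2 by 8 is the origin of the term 8 n p^t in all later bounds.\<close>
    also have "\<dots> \<le> (\<Sum>B\<in>?Bs. exp (- 2 * m) * (exp 2 * p ^ t) ^ card B)"
    proof (rule sum_mono)
      fix B assume B: "B \<in> ?Bs"
      have "1 * (p ^ t) ^ card B \<le> exp (- 2 * m + real (card B) * 2) * (p ^ t) ^ card B"
        using B p by (intro mult_right_mono) auto
      then show "(p ^ t) ^ card B \<le> exp (- 2 * m) * (exp 2 * p ^ t) ^ card B"
        unfolding exp_add exp_of_nat_mult by (simp add: power_mult_distrib mult.assoc)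
    qed
    also have "\<dots> \<le> (\<Sum>B\<in>Pow ({..<n} - Q). exp (- 2 * m) * (exp 2 * p ^ t) ^ card B)"
      using p by (intro sum_mono2) auto
    also have "\<dots> = exp (- 2 * m) * (\<Sum>B\<in>Pow ({..<n} - Q). (exp 2 * p ^ t) ^ card B)"
      by (simp add: sum_distrib_left)
    also have "\<dots> \<le> exp (- 2 * m) * exp (real n * (exp 2 * p ^ t))"
      using p by (intro mult_left_mono sum_Pow_exp_le) auto
    also have "\<dots> \<le> exp (- 2 * m) * exp (8 * real n * p ^ t)"
    proof -
      have "exp 2 * p ^ t \<le> 8 * p ^ t" using e2 p by (intro mult_right_mono) auto
      then have "real n * (exp 2 * p ^ t) \<le> real n * (8 * p ^ t)" by (intro mult_left_mono) auto
      then show ?thesis by (simp add: mult_ac)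
    qed
    also have "\<dots> = exp (8 * real n * p ^ t - 2 * m)" by (simp flip: exp_add)
    finally show "measure_pmf.prob (gnp n p) {E. \<exists>B\<in>?Bs. star_pairs Q B \<subseteq> E} \<le> exp (8 * real n * p ^ t - 2 * m)" .
  qed
  also have "\<dots> = real (card ?Qs) * exp (8 * real n * p ^ t - 2 * m)" by simp
  also have "\<dots> \<le> real n ^ t * exp (8 * real n * p ^ t - 2 * m)"
    using card_subsets_le[of n t] by (intro mult_right_mono) (auto simp flip: of_nat_power)
  finally show ?thesis .
qed

lemma prob_clique:
  assumes p: "0 \<le> p" "p \<le> 1"
  shows "measure_pmf.prob (gnp n p) {E. \<exists>C\<in>{C. C \<subseteq> {..<n} \<and> card C = m}. {e. e \<subseteq> C \<and> card e = 2} \<subseteq> E}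
     \<le> real n ^ m * p ^ (m choose 2)"
proof -
  let ?Cs = "{C. C \<subseteq> {..<n} \<and> card C = m}"
  have fC: "finite ?Cs" by (rule finite_subset[of _ "Pow {..<n}"]) auto
  have "measure_pmf.prob (gnp n p) {E. \<exists>C\<in>?Cs. {e. e \<subseteq> C \<and> card e = 2} \<subseteq> E} \<le> (\<Sum>C\<in>?Cs. p ^ (m choose 2))"
  proof (rule prob_Bex_le[OF fC])
    fix C assume C: "C \<in> ?Cs"
    let ?F = "{e. e \<subseteq> C \<and> card e = 2}"
    have fin: "finite C" using C finite_subset by blast
    have "?F \<subseteq> all_pairs n"
    proof
      fix e assume "e \<in> ?F"
      then obtain i j where "e = {i, j}" "i \<noteq> j" "i \<in> C" "j \<in> C" by (auto simp: card_2_iff)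
      moreover from this have "i < n" "j < n" using C by auto
      ultimately show "e \<in> all_pairs n" unfolding all_pairs_def by blast
    qed
    then have "measure_pmf.prob (gnp n p) {E. ?F \<subseteq> E} \<le> p ^ card ?F"
      using gnp_prob_le[OF p, of ?F n "{}" 0 0] by simp
    also have "card ?F = m choose 2" using n_subsets[OF fin] C by simp
    finally show "measure_pmf.prob (gnp n p) {E. ?F \<subseteq> E} \<le> p ^ (m choose 2)" .
  qed
  also have "\<dots> = real (card ?Cs) * p ^ (m choose 2)" by simp
  also have "\<dots> \<le> real n ^ m * p ^ (m choose 2)"
    using card_subsets_le[of n m] p by (intro mult_right_mono) (auto simp flip: of_nat_power)
  finally show ?thesis .
qed

lemma prob_dense_pair:
  assumes p: "0 \<le> p" "p \<le> 1" and \<gamma>: "0 \<le> \<gamma>"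
  shows "measure_pmf.prob (gnp n p) {E. \<exists>D\<in>{D. D \<subseteq> {..<n} \<and> card D = m}. \<exists>K\<in>{K. K \<subseteq> {..<n} \<and> card K = k}.
      D \<inter> K = {} \<and> (p + \<gamma>) * (real m * real k) \<le> card (star_pairs D K \<inter> E)}
     \<le> real n ^ m * (real n ^ k * exp (- 2 * \<gamma>\<^sup>2 * (real m * real k)))"
proof -
  let ?S = "\<lambda>m. {D. D \<subseteq> {..<n} \<and> card D = m}"
  have fS: "finite (?S m)" for m by (rule finite_subset[of _ "Pow {..<n}"]) auto
  let ?e = "exp (- 2 * \<gamma>\<^sup>2 * (real m * real k))"
  have "measure_pmf.prob (gnp n p) {E. \<exists>D\<in>?S m. \<exists>K\<in>?S k. D \<inter> K = {} \<and> (p + \<gamma>) * (real m * real k) \<le> card (star_pairs D K \<inter> E)}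
     \<le> (\<Sum>D\<in>?S m. \<Sum>K\<in>?S k. ?e)"
  proof (rule prob_Bex_le[OF fS], rule prob_Bex_le[OF fS])
    fix D K assume D: "D \<in> ?S m" and K: "K \<in> ?S k"
    show "measure_pmf.prob (gnp n p) {E. D \<inter> K = {} \<and> (p + \<gamma>) * (real m * real k) \<le> card (star_pairs D K \<inter> E)} \<le> ?e"
    proof (cases "D \<inter> K = {}")
      case True
      let ?P = "star_pairs D K"
      have P: "?P \<subseteq> all_pairs n" "card ?P = m * k"
        using True D K star_pairs_subset[of D n K] card_star_pairs[of D K] by auto
      have fP: "finite ?P" using P(1) finite_all_pairs finite_subset by blast
      have eq: "(\<Sum>e\<in>?P. 1 * (of_bool (e \<in> E) - p)) = real (card (?P \<inter> E)) - p * (real m * real k)" for E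
      proof -
        have "(\<Sum>e\<in>?P. of_bool (e \<in> E) :: real) = card (?P \<inter> E)"
          using fP by (simp add: of_bool_def sum.If_cases Int_def)
        then show ?thesis using P(2) by (simp add: sum_subtractf mult.commute)
      qed
      \<comment> \<open>The parameter l = 4 \<gamma> minimises the exponent l^2 N / 8 - l \<gamma> N
        for N = m k pairs.\<close>
      have "measure_pmf.prob (gnp n p) {E. {} \<subseteq> E \<and> \<gamma> * (real m * real k) \<le> (\<Sum>e\<in>?P. 1 * (of_bool (e \<in> E) - p))}
          \<le> p ^ card ({}::nat set set) * exp ((4 * \<gamma>)\<^sup>2 * (\<Sum>e\<in>?P. 1\<^sup>2) / 8 - 4 * \<gamma> * (\<gamma> * (real m * real k)))"
        by (rule gnp_prob_le[OF p]) (use P \<gamma> in auto)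
      moreover have "{E. D \<inter> K = {} \<and> (p + \<gamma>) * (real m * real k) \<le> card (?P \<inter> E)}
          = {E. {} \<subseteq> E \<and> \<gamma> * (real m * real k) \<le> (\<Sum>e\<in>?P. 1 * (of_bool (e \<in> E) - p))}"
        unfolding eq using True by (auto simp: distrib_right)
      moreover have "(4 * \<gamma>)\<^sup>2 * (\<Sum>e\<in>?P. 1\<^sup>2) / 8 - 4 * \<gamma> * (\<gamma> * (real m * real k)) = - 2 * \<gamma>\<^sup>2 * (real m * real k)"
        using P(2) by (simp add: power2_eq_square)
      ultimately show ?thesis by (simp only: card.empty power_0 mult_1_left)
    qed simp
  qed
  also have "\<dots> = real (card (?S m)) * (real (card (?S k)) * ?e)" by simp
  also have "\<dots> \<le> real n ^ m * (real n ^ k * ?e)"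
    using card_subsets_le[of n m] card_subsets_le[of n k]
    by (intro mult_mono) (auto simp flip: of_nat_power)
  finally show ?thesis .
qed

section \<open>Norm of the centred adjacency matrix through integer vectors\<close>

definition intvecs :: "nat set \<Rightarrow> real \<Rightarrow> (nat \<Rightarrow> int) set" where
  "intvecs V X = {z \<in> extensional V. (\<Sum>v\<in>V. (real_of_int (z v))\<^sup>2) \<le> X}"

lemma int_abs_le_square: "\<bar>i\<bar> \<le> (i::int)\<^sup>2"
proof (cases "i = 0")
  case False
  then have "\<bar>i\<bar> * 1 \<le> \<bar>i\<bar> * \<bar>i\<bar>" by (intro mult_left_mono) auto
  then show ?thesis by (simp add: power2_eq_square)
qed simp

lemma gauss_sum_le: "(\<Sum>i\<in>{-int r..int r}. exp (- (real_of_int i)\<^sup>2)) \<le> exp 2"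
proof -
  have e1: "exp (-1) \<le> (1/2 :: real)"
    using exp_ge_add_one_self[of "1::real"] by (simp add: exp_minus divide_simps)
  have bd: "exp (- (real_of_int i)\<^sup>2) \<le> (1/2) ^ nat \<bar>i\<bar>" for i :: int
  proof -
    have "real_of_int \<bar>i\<bar> \<le> (real_of_int i)\<^sup>2"
      using int_abs_le_square[of i] by (metis of_int_le_iff of_int_power)
    then have "exp (- (real_of_int i)\<^sup>2) \<le> exp (real (nat \<bar>i\<bar>) * (-1))" by simp
    also have "\<dots> = exp (-1) ^ nat \<bar>i\<bar>" by (rule exp_of_nat_mult)
    also have "\<dots> \<le> (1/2) ^ nat \<bar>i\<bar>" using e1 by (intro power_mono) auto
    finally show ?thesis .
  qed
  have sum: "(\<Sum>i\<in>{-int r..int r}. (1/2 :: real) ^ nat \<bar>i\<bar>) = 3 - 2 * (1/2) ^ r"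
  proof (induction r)
    case (Suc r)
    have "{-int (Suc r)..int (Suc r)} = insert (int (Suc r)) (insert (- int (Suc r)) {-int r..int r})"
      by auto
    moreover have "nat (1 + int r) = Suc r" "nat (int r + 1) = Suc r" by auto
    ultimately show ?case using Suc by simp
  qed simp
  have "(\<Sum>i\<in>{-int r..int r}. exp (- (real_of_int i)\<^sup>2)) \<le> (\<Sum>i\<in>{-int r..int r}. (1/2 :: real) ^ nat \<bar>i\<bar>)"
    by (intro sum_mono bd)
  also have "\<dots> \<le> 1 + 2" unfolding sum by simp
  also have "\<dots> \<le> exp (2::real)" by (rule exp_ge_add_one_self)
  finally show ?thesis .
qed

text \<open>Every member has weight at least 1 under exp (X - |z|^2). This weight factorises over
  the coordinates, and each coordinate contributes a Gaussian sum of at most exp 2.\<close>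

lemma card_intvecs:
  assumes "finite V"
  shows "finite (intvecs V X)" "real (card (intvecs V X)) \<le> exp (X + 2 * real (card V))"
proof -
  define r where "r = nat \<lfloor>X\<rfloor>"
  let ?P = "PiE V (\<lambda>_. {-int r..int r})"
  have fP: "finite ?P" using assms by (intro finite_PiE) auto
  have sub: "intvecs V X \<subseteq> ?P"
  proof
    fix z assume z: "z \<in> intvecs V X"
    have "z v \<in> {-int r..int r}" if v: "v \<in> V" for v
    proof -
      have "(real_of_int (z v))\<^sup>2 \<le> (\<Sum>v\<in>V. (real_of_int (z v))\<^sup>2)"
        using assms v by (intro member_le_sum) auto
      also have "\<dots> \<le> X" using z by (simp add: intvecs_def)
      finally have "of_int ((z v)\<^sup>2) \<le> X" by simp
      then have "(z v)\<^sup>2 \<le> \<lfloor>X\<rfloor>" by (simp add: le_floor_iff)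
      then have "\<bar>z v\<bar> \<le> int r"
        using int_abs_le_square[of "z v"] unfolding r_def by linarith
      then show ?thesis by auto
    qed
    then show "z \<in> ?P" using z by (auto simp: intvecs_def PiE_def)
  qed
  then show "finite (intvecs V X)" using fP finite_subset by blast
  have "real (card (intvecs V X)) = (\<Sum>z\<in>intvecs V X. 1)" by simp
  also have "\<dots> \<le> (\<Sum>z\<in>intvecs V X. exp (X - (\<Sum>v\<in>V. (real_of_int (z v))\<^sup>2)))"
    by (intro sum_mono) (simp add: intvecs_def)
  also have "\<dots> \<le> (\<Sum>z\<in>?P. exp (X - (\<Sum>v\<in>V. (real_of_int (z v))\<^sup>2)))"
    using fP sub by (intro sum_mono2) auto
  also have "\<dots> = exp X * (\<Sum>z\<in>?P. \<Prod>v\<in>V. exp (- (real_of_int (z v))\<^sup>2))"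
    unfolding sum_distrib_left exp_sum[OF assms, symmetric] exp_add[symmetric] by (simp add: sum_negf)
  also have "(\<Sum>z\<in>?P. \<Prod>v\<in>V. exp (- (real_of_int (z v))\<^sup>2)) = (\<Prod>v\<in>V. \<Sum>i\<in>{-int r..int r}. exp (- (real_of_int i)\<^sup>2))"
    using assms by (subst prod_sum_PiE) auto
  also have "exp X * \<dots> \<le> exp X * (\<Prod>v\<in>V. exp 2)"
    by (intro mult_left_mono prod_mono conjI sum_nonneg gauss_sum_le) auto
  also have "\<dots> = exp (X + 2 * real (card V))"
    unfolding exp_add prod_constant exp_of_nat2_mult by simp
  finally show "real (card (intvecs V X)) \<le> exp (X + 2 * real (card V))" .
qed

definition Wm :: "nat set set \<Rightarrow> real \<Rightarrow> nat \<Rightarrow> nat \<Rightarrow> real" where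
  "Wm E p u v = (if u = v then 0 else of_bool ({u, v} \<in> E) - p)"

text \<open>Each coordinate is rounded up or down according to the sign of its coefficient, so the
  linear form does not decrease. A coordinate moves by at most 1, whence the squared norm is at most
  2 |x|^2 + 2 card V, which is at most 4 L.\<close>

lemma round_linear:
  fixes x c :: "nat \<Rightarrow> real"
  assumes "finite V" "sq V x \<le> L" "real (card V) \<le> L"
  shows "\<exists>z\<in>intvecs V (4 * L). (\<Sum>v\<in>V. x v * c v) \<le> (\<Sum>v\<in>V. real_of_int (z v) * c v)"
proof -
  define z where "z = restrict (\<lambda>v. if 0 \<le> c v then \<lfloor>x v\<rfloor> + 1 else \<lfloor>x v\<rfloor>) V"
  have "(\<Sum>v\<in>V. (real_of_int (z v))\<^sup>2) \<le> (\<Sum>v\<in>V. 2 * (x v)\<^sup>2 + 2)"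
  proof (rule sum_mono)
    fix v assume "v \<in> V"
    then have "\<bar>real_of_int (z v)\<bar> \<le> \<bar>x v\<bar> + 1" by (simp add: z_def) linarith
    then have "(real_of_int (z v))\<^sup>2 \<le> (\<bar>x v\<bar> + 1)\<^sup>2" by (simp add: abs_le_square_iff[symmetric])
    also have "\<dots> \<le> 2 * (x v)\<^sup>2 + 2"
      using zero_le_power2[of "\<bar>x v\<bar> - 1"] by (simp add: power2_eq_square algebra_simps)
    finally show "(real_of_int (z v))\<^sup>2 \<le> 2 * (x v)\<^sup>2 + 2" .
  qed
  also have "\<dots> = 2 * sq V x + 2 * card V" by (simp add: sum.distrib sq_def sum_distrib_left)
  also have "\<dots> \<le> 4 * L" using assms by simp
  finally have "z \<in> intvecs V (4 * L)" by (simp add: intvecs_def z_def)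
  moreover have "(\<Sum>v\<in>V. x v * c v) \<le> (\<Sum>v\<in>V. real_of_int (z v) * c v)"
  proof (rule sum_mono)
    fix v assume v: "v \<in> V"
    show "x v * c v \<le> real_of_int (z v) * c v"
    proof (cases "0 \<le> c v")
      case True
      then show ?thesis using v by (intro mult_right_mono) (auto simp: z_def intro: less_imp_le)
    next
      case False
      then show ?thesis using v by (intro mult_right_mono_neg) (auto simp: z_def)
    qed
  qed
  ultimately show ?thesis by blast
qed

text \<open>A bilinear form attains its maximum over a box of the integer lattice at a corner, so that
  rounding to the lattice replaces an epsilon-net.\<close>

lemma norm_from_lattice:
  assumes V: "finite V" "real (card V) \<le> L" and L: "0 < L"
    and sym: "\<And>u v. u \<in> V \<Longrightarrow> v \<in> V \<Longrightarrow> W u v = W v u"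
    and \<tau>: "\<And>z z'. z \<in> intvecs V (4 * L) \<Longrightarrow> z' \<in> intvecs V (4 * L) \<Longrightarrow>
       ip V (\<lambda>v. real_of_int (z v)) (mv V W (\<lambda>v. real_of_int (z' v))) \<le> \<tau>"
  shows "ip V x (mv V W y) \<le> \<tau> / L * sqrt (sq V x) * sqrt (sq V y)"
proof -
  have main: "ip V x (mv V W y) \<le> \<tau>" if xy: "sq V x \<le> L" "sq V y \<le> L" for x y
  proof -
    obtain z where z: "z \<in> intvecs V (4 * L)" "(\<Sum>v\<in>V. x v * mv V W y v) \<le> (\<Sum>v\<in>V. real_of_int (z v) * mv V W y v)"
      using round_linear[OF V(1) xy(1) V(2)] by blast
    obtain z' where z': "z' \<in> intvecs V (4 * L)"
      "(\<Sum>v\<in>V. y v * mv V W (\<lambda>v. of_int (z v)) v) \<le> (\<Sum>v\<in>V. real_of_int (z' v) * mv V W (\<lambda>v. of_int (z v)) v)"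
      using round_linear[OF V(1) xy(2) V(2)] by blast
    have "ip V x (mv V W y) \<le> ip V (\<lambda>v. of_int (z v)) (mv V W y)" using z(2) by (simp add: ip_def)
    also have "\<dots> = ip V y (mv V W (\<lambda>v. of_int (z v)))"
      using ip_mv_symmetric[OF sym, where x = "\<lambda>v. of_int (z v)" and y = y] by (simp add: ip_def mult.commute)
    also have "\<dots> \<le> ip V (\<lambda>v. of_int (z' v)) (mv V W (\<lambda>v. of_int (z v)))" using z'(2) by (simp add: ip_def)
    also have "\<dots> \<le> \<tau>" by (rule \<tau>[OF z'(1) z(1)])
    finally show ?thesis .
  qed
  have zero: "v \<in> V \<Longrightarrow> y v = 0" if "sq V y = 0" for y v
    using that V(1) by (simp add: sq_def sum_nonneg_eq_0_iff)
  show ?thesis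
  proof (cases "sq V x = 0 \<or> sq V y = 0")
    case True
    then have "ip V x (mv V W y) = 0"
    proof
      assume "sq V x = 0"
      from zero[OF this] show ?thesis unfolding ip_def by (intro sum.neutral ballI) simp
    next
      assume "sq V y = 0"
      from zero[OF this] have "mv V W y u = 0" for u unfolding mv_def by (intro sum.neutral ballI) simp
      then show ?thesis by (simp add: ip_def)
    qed
    then show ?thesis using True by auto
  next
    case False
    \<comment> \<open>By homogeneity both vectors are scaled to squared norm L; at this scale the
      squared rounding error, at most \<open>card V\<close>, is no larger than the squared norm
      itself.\<close>
    define a b where "a = sqrt (sq V x)" and "b = sqrt (sq V y)"
    have ab: "0 < a" "0 < b" "a\<^sup>2 = sq V x" "b\<^sup>2 = sq V y"
      using False sq_nonneg[of V x] sq_nonneg[of V y] by (auto simp: a_def b_def)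
    define s where "s = sqrt L"
    have s: "0 < s" "s\<^sup>2 = L" using L by (auto simp: s_def)
    have "sq V (\<lambda>v. s / a * x v) = (s / a)\<^sup>2 * sq V x" "sq V (\<lambda>v. s / b * y v) = (s / b)\<^sup>2 * sq V y"
      by (simp_all only: sq_def power_mult_distrib sum_distrib_left)
    moreover have "(s / a)\<^sup>2 * sq V x = L" "(s / b)\<^sup>2 * sq V y = L"
      unfolding ab(3,4)[symmetric] power_divide s(2) using ab(1,2) by simp_all
    ultimately have "sq V (\<lambda>v. s / a * x v) \<le> L" "sq V (\<lambda>v. s / b * y v) \<le> L" by linarith+
    from main[OF this] have "ip V (\<lambda>v. s / a * x v) (mv V W (\<lambda>v. s / b * y v)) \<le> \<tau>" .
    also have "ip V (\<lambda>v. s / a * x v) (mv V W (\<lambda>v. s / b * y v)) = (s / a) * (s / b) * ip V x (mv V W y)"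
      by (simp only: ip_def mv_def sum_distrib_left sum_distrib_right mult_ac)
    also have "(s / a) * (s / b) = L / (a * b)" using s by (simp add: power2_eq_square)
    finally have "ip V x (mv V W y) \<le> \<tau> / L * a * b" using ab L by (simp add: field_simps)
    then show ?thesis by (simp add: a_def b_def)
  qed
qed

text \<open>An unordered pair collects the coefficients of its two orientations, which costs a
  factor 2 by Cauchy-Schwarz. The diagonal of \<open>Wm\<close> is zero, so only genuine pairs of V
  occur, and these avoid Q.\<close>

lemma bilinear_as_edge_sum:
  fixes z z' :: "nat \<Rightarrow> real"
  assumes V: "finite V" "V \<subseteq> {..<n}" and Q: "V \<inter> Q = {}"
  shows "\<exists>D a. D \<subseteq> all_pairs n \<and> (\<forall>e\<in>D. e \<inter> Q = {}) \<and> (\<Sum>e\<in>D. (a e)\<^sup>2) \<le> 2 * sq V z * sq V z'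
    \<and> (\<forall>E. ip V z (mv V (Wm E p) z') = (\<Sum>e\<in>D. a e * (of_bool (e \<in> E) - p)))"
proof -
  define S where "S = {x \<in> V \<times> V. fst x \<noteq> snd x}"
  define g where "g x = {fst x, snd x}" for x :: "nat \<times> nat"
  define f where "f x = z (fst x) * z' (snd x)" for x
  define D where "D = g ` S"
  define a where "a e = (\<Sum>x\<in>{x \<in> S. g x = e}. f x)" for e
  have fS: "finite S" using V by (simp add: S_def)
  have 1: "D \<subseteq> all_pairs n"
  proof
    fix e assume "e \<in> D"
    then obtain u v where "u \<in> V" "v \<in> V" "u \<noteq> v" "e = {u, v}" by (auto simp: D_def S_def g_def)
    moreover from this have "u < n" "v < n" using V by auto
    ultimately show "e \<in> all_pairs n" unfolding all_pairs_def by blast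
  qed
  have 2: "e \<inter> Q = {}" if "e \<in> D" for e using that Q by (auto simp: D_def S_def g_def)
  have "(\<Sum>e\<in>D. (a e)\<^sup>2) \<le> (\<Sum>e\<in>D. \<Sum>x\<in>{x \<in> S. g x = e}. 2 * (f x)\<^sup>2)"
  proof (rule sum_mono)
    fix e assume "e \<in> D"
    then obtain u v where uv: "e = {u, v}" by (auto simp: D_def g_def)
    have "{x \<in> S. g x = e} \<subseteq> {(u, v), (v, u)}"
      unfolding g_def uv doubleton_eq_iff by auto
    then have "card {x \<in> S. g x = e} \<le> card {(u, v), (v, u)}" by (rule card_mono[rotated]) simp
    also have "\<dots> \<le> 2" using card_length[of "[(u, v), (v, u)]"] by simp
    finally have c: "card {x \<in> S. g x = e} \<le> 2" .
    have "(a e)\<^sup>2 \<le> (\<Sum>x\<in>{x \<in> S. g x = e}. (f x)\<^sup>2) * card {x \<in> S. g x = e}"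
      unfolding a_def by (rule sum_squared_le_sum_of_squares)
    also have "\<dots> \<le> (\<Sum>x\<in>{x \<in> S. g x = e}. (f x)\<^sup>2) * 2"
      using c by (intro mult_left_mono sum_nonneg) auto
    finally show "(a e)\<^sup>2 \<le> (\<Sum>x\<in>{x \<in> S. g x = e}. 2 * (f x)\<^sup>2)"
      by (simp only: sum_distrib_left mult.commute)
  qed
  also have "\<dots> = (\<Sum>x\<in>S. 2 * (f x)\<^sup>2)" using fS by (intro sum.group) (auto simp: D_def)
  also have "\<dots> \<le> (\<Sum>x\<in>V \<times> V. 2 * (f x)\<^sup>2)" using V by (intro sum_mono2) (auto simp: S_def)
  also have "\<dots> = (\<Sum>u\<in>V. \<Sum>v\<in>V. 2 * ((z u)\<^sup>2 * (z' v)\<^sup>2))"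
    by (simp add: sum.cartesian_product f_def power_mult_distrib split_def)
  also have "\<dots> = 2 * (\<Sum>u\<in>V. \<Sum>v\<in>V. (z u)\<^sup>2 * (z' v)\<^sup>2)" by (simp only: sum_distrib_left)
  also have "\<dots> = 2 * sq V z * sq V z'" by (simp only: sq_def sum_product mult.assoc)
  finally have 3: "(\<Sum>e\<in>D. (a e)\<^sup>2) \<le> 2 * sq V z * sq V z'" .
  have 4: "ip V z (mv V (Wm E p) z') = (\<Sum>e\<in>D. a e * (of_bool (e \<in> E) - p))" for E
  proof -
    have "ip V z (mv V (Wm E p) z') = (\<Sum>x\<in>V \<times> V. z (fst x) * (Wm E p (fst x) (snd x) * z' (snd x)))"
      by (simp add: ip_def mv_def sum_distrib_left sum.cartesian_product split_def)
    also have "\<dots> = (\<Sum>x\<in>S. z (fst x) * (Wm E p (fst x) (snd x) * z' (snd x)))"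
      using V by (intro sum.mono_neutral_right) (auto simp: S_def Wm_def)
    also have "\<dots> = (\<Sum>x\<in>S. f x * (of_bool (g x \<in> E) - p))"
      by (intro sum.cong refl) (auto simp: S_def Wm_def f_def g_def)
    also have "\<dots> = (\<Sum>e\<in>D. \<Sum>x\<in>{x \<in> S. g x = e}. f x * (of_bool (g x \<in> E) - p))"
      using fS by (intro sum.group[symmetric]) (auto simp: D_def)
    also have "\<dots> = (\<Sum>e\<in>D. a e * (of_bool (e \<in> E) - p))"
      unfolding a_def sum_distrib_right by (intro sum.cong refl) auto
    finally show ?thesis .
  qed
  show ?thesis using 1 2 3 4 by blast
qed

lemma prob_bilinear_large:
  fixes x y :: "nat \<Rightarrow> real"
  assumes p: "0 \<le> p" "p \<le> 1" and L: "0 < L" and V: "V \<subseteq> {..<n}" "V \<inter> Q = {}"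
    and Q: "Q \<subseteq> {..<n}" "B \<subseteq> V" and sq: "sq V x \<le> 4 * L" "sq V y \<le> 4 * L"
  shows "measure_pmf.prob (gnp n p) {E. star_pairs Q B \<subseteq> E \<and> 16 * L * sqrt L \<le> ip V x (mv V (Wm E p) y)}
     \<le> (p ^ card Q) ^ card B * exp (- 16 * L)"
proof -
  have fV: "finite V" using V finite_subset by blast
  obtain D a where D: "D \<subseteq> all_pairs n \<and> (\<forall>e\<in>D. e \<inter> Q = {}) \<and> (\<Sum>e\<in>D. (a e)\<^sup>2) \<le> 2 * sq V x * sq V y
    \<and> (\<forall>E. ip V x (mv V (Wm E p) y) = (\<Sum>e\<in>D. a e * (of_bool (e \<in> E) - p)))"
    using bilinear_as_edge_sum[OF fV V(1,2), of x y p] by (elim exE) (rule that)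
  have F: "star_pairs Q B \<subseteq> all_pairs n" using V Q by (intro star_pairs_subset) auto
  have "e \<inter> Q \<noteq> {}" if "e \<in> star_pairs Q B" for e using that by (auto simp: star_pairs_def)
  \<comment> \<open>Pairs inside V avoid Q while the prescribed ones meet it; this is the
    independence that lets both factors multiply.\<close>
  then have disj: "D \<subseteq> all_pairs n - star_pairs Q B"
    using D[THEN conjunct1] D[THEN conjunct2, THEN conjunct1] by blast
  have "2 * sq V x * sq V y \<le> 2 * (4 * L) * (4 * L)"
    using sq L by (intro mult_mono) (auto simp: sq_nonneg)
  with D[THEN conjunct2, THEN conjunct2, THEN conjunct1]
  have a2: "(\<Sum>e\<in>D. (a e)\<^sup>2) \<le> 32 * L\<^sup>2" by (simp add: power2_eq_square)
  \<comment> \<open>This l makes the exponent at most 16 L - 32 L.\<close>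
  define l where "l = 2 / sqrt L"
  have l: "0 \<le> l" "l\<^sup>2 = 4 / L" "l * (16 * L * sqrt L) = 32 * L" using L by (auto simp: l_def power_divide)
  have "measure_pmf.prob (gnp n p) {E. star_pairs Q B \<subseteq> E \<and> 16 * L * sqrt L \<le> (\<Sum>e\<in>D. a e * (of_bool (e \<in> E) - p))}
     \<le> p ^ card (star_pairs Q B) * exp (l\<^sup>2 * (\<Sum>e\<in>D. (a e)\<^sup>2) / 8 - l * (16 * L * sqrt L))"
    by (rule gnp_prob_le[OF p F disj l(1)])
  also have "\<dots> \<le> p ^ card (star_pairs Q B) * exp (- 16 * L)"
  proof -
    have "l\<^sup>2 * (\<Sum>e\<in>D. (a e)\<^sup>2) \<le> 4 / L * (32 * L\<^sup>2)" unfolding l(2) using a2 L by (intro mult_left_mono) auto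
    also have "\<dots> = 128 * L" using L by (simp add: power2_eq_square)
    finally have "l\<^sup>2 * (\<Sum>e\<in>D. (a e)\<^sup>2) / 8 - l * (16 * L * sqrt L) \<le> - 16 * L" unfolding l(3) by simp
    then show ?thesis using p by (intro mult_left_mono) auto
  qed
  also have "card (star_pairs Q B) = card Q * card B" using V Q by (intro card_star_pairs) auto
  finally show ?thesis using D by (simp add: power_mult)
qed

text \<open>The budget of the union bound: two integer vectors cost exp (6 L) each, so exp (- 16 L)
  leaves exp (- 4 L) to pay for Q, B and K. Ranging over all K covers every adversary, and the
  prescribed edges from Q to B keep the sum over B at exp (n p^t).\<close>

lemma prob_norm:
  assumes p: "0 \<le> p" "p \<le> 1" and L: "0 < L"
  shows "measure_pmf.prob (gnp n p) {E. \<exists>Q\<in>{Q. Q \<subseteq> {..<n} \<and> card Q = t}.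
      \<exists>B\<in>{B \<in> Pow ({..<n} - Q). real (card B) + real m \<le> L}. \<exists>K\<in>{K. K \<subseteq> {..<n} \<and> card K = m}.
      \<exists>z\<in>intvecs (B \<union> K) (4 * L). \<exists>z'\<in>intvecs (B \<union> K) (4 * L). K \<inter> Q = {} \<and> star_pairs Q B \<subseteq> E \<and>
        16 * L * sqrt L \<le> ip (B \<union> K) (\<lambda>v. real_of_int (z v)) (mv (B \<union> K) (Wm E p) (\<lambda>v. real_of_int (z' v)))}
     \<le> real n ^ t * (exp (real n * p ^ t) * (real n ^ m * exp (- 4 * L)))"
proof -
  let ?S = "\<lambda>m. {D. D \<subseteq> {..<n} \<and> card D = m}"
  let ?Bs = "\<lambda>Q. {B \<in> Pow ({..<n} - Q). real (card B) + real m \<le> L}"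
  let ?P = "\<lambda>Q B K z z' E. K \<inter> Q = {} \<and> star_pairs Q B \<subseteq> E \<and>
        16 * L * sqrt L \<le> ip (B \<union> K) (\<lambda>v. real_of_int (z v)) (mv (B \<union> K) (Wm E p) (\<lambda>v. real_of_int (z' v)))"
  have fS: "finite (?S m)" for m by (rule finite_subset[of _ "Pow {..<n}"]) auto
  have single: "measure_pmf.prob (gnp n p) {E. ?P Q B K z z' E} \<le> (p ^ t) ^ card B * exp (- 16 * L)"
    if Q: "Q \<in> ?S t" and B: "B \<in> ?Bs Q" and K: "K \<in> ?S m" and z: "z \<in> intvecs (B \<union> K) (4 * L)" "z' \<in> intvecs (B \<union> K) (4 * L)"
    for Q B K z z'
  proof (cases "K \<inter> Q = {}")
    case False
    then show ?thesis using p by simp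
  next
    case True
    let ?V = "B \<union> K" and ?z = "\<lambda>v. real_of_int (z v)" and ?z' = "\<lambda>v. real_of_int (z' v)"
    have "measure_pmf.prob (gnp n p) {E. star_pairs Q B \<subseteq> E \<and> 16 * L * sqrt L \<le> ip ?V ?z (mv ?V (Wm E p) ?z')}
       \<le> (p ^ card Q) ^ card B * exp (- 16 * L)"
      using Q B K z True by (intro prob_bilinear_large[OF p L]) (auto simp: intvecs_def sq_def)
    then show ?thesis using True Q by simp
  qed
  have step: "measure_pmf.prob (gnp n p) {E. \<exists>z\<in>intvecs (B \<union> K) (4 * L). \<exists>z'\<in>intvecs (B \<union> K) (4 * L). ?P Q B K z z' E}
       \<le> (p ^ t) ^ card B * exp (- 4 * L)"
    if Q: "Q \<in> ?S t" and B: "B \<in> ?Bs Q" and K: "K \<in> ?S m" for Q B K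
  proof -
    let ?I = "intvecs (B \<union> K) (4 * L)"
    have fV: "finite (B \<union> K)" using B K finite_subset[of B "{..<n}"] finite_subset[of K "{..<n}"] by auto
    have "real (card (B \<union> K)) \<le> L" using B K card_Un_le[of B K] by (auto simp flip: of_nat_add)
    then have "exp (4 * L + 2 * real (card (B \<union> K))) \<le> exp (6 * L)" by simp
    then have c: "real (card ?I) \<le> exp (6 * L)" using card_intvecs(2)[OF fV, of "4 * L"] by linarith
    note fI = card_intvecs(1)[OF fV]
    have "measure_pmf.prob (gnp n p) {E. \<exists>z\<in>?I. \<exists>z'\<in>?I. ?P Q B K z z' E} \<le> (\<Sum>z\<in>?I. \<Sum>z'\<in>?I. (p ^ t) ^ card B * exp (- 16 * L))"
      by (rule prob_Bex_le[OF fI], rule prob_Bex_le[OF fI], rule single[OF that])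
    also have "\<dots> = (real (card ?I) * real (card ?I)) * ((p ^ t) ^ card B * exp (- 16 * L))" by simp
    also have "\<dots> \<le> (exp (6 * L) * exp (6 * L)) * ((p ^ t) ^ card B * exp (- 16 * L))"
      using c p by (intro mult_right_mono mult_mono) auto
    also have "\<dots> = (p ^ t) ^ card B * (exp (6 * L) * exp (6 * L) * exp (- 16 * L))" by simp
    also have "\<dots> = (p ^ t) ^ card B * exp (- 4 * L)" unfolding exp_add[symmetric] by simp
    finally show ?thesis .
  qed
  have "measure_pmf.prob (gnp n p) {E. \<exists>Q\<in>?S t. \<exists>B\<in>?Bs Q. \<exists>K\<in>?S m.
      \<exists>z\<in>intvecs (B \<union> K) (4 * L). \<exists>z'\<in>intvecs (B \<union> K) (4 * L). ?P Q B K z z' E}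
      \<le> (\<Sum>Q\<in>?S t. \<Sum>B\<in>?Bs Q. \<Sum>K\<in>?S m. (p ^ t) ^ card B * exp (- 4 * L))"
  proof (rule prob_Bex_le[OF fS])
    fix Q assume Q: "Q \<in> ?S t"
    have fB: "finite (?Bs Q)" by simp
    show "measure_pmf.prob (gnp n p) {E. \<exists>B\<in>?Bs Q. \<exists>K\<in>?S m.
      \<exists>z\<in>intvecs (B \<union> K) (4 * L). \<exists>z'\<in>intvecs (B \<union> K) (4 * L). ?P Q B K z z' E}
      \<le> (\<Sum>B\<in>?Bs Q. \<Sum>K\<in>?S m. (p ^ t) ^ card B * exp (- 4 * L))"
      by (rule prob_Bex_le[OF fB], rule prob_Bex_le[OF fS], rule step[OF Q])
  qed
  also have "\<dots> \<le> (\<Sum>Q\<in>?S t. exp (real n * p ^ t) * (real n ^ m * exp (- 4 * L)))"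
  proof (rule sum_mono)
    fix Q assume "Q \<in> ?S t"
    have "(\<Sum>B\<in>?Bs Q. \<Sum>K\<in>?S m. (p ^ t) ^ card B * exp (- 4 * L))
        = (\<Sum>B\<in>?Bs Q. (p ^ t) ^ card B) * (real (card (?S m)) * exp (- 4 * L))"
      unfolding sum_constant sum_distrib_right by (intro sum.cong refl) (simp add: mult_ac)
    also have "\<dots> \<le> exp (real n * p ^ t) * (real n ^ m * exp (- 4 * L))"
    proof (intro mult_mono)
      have "(\<Sum>B\<in>?Bs Q. (p ^ t) ^ card B) \<le> (\<Sum>B\<in>Pow ({..<n} - Q). (p ^ t) ^ card B)"
        using p by (intro sum_mono2) auto
      also have "\<dots> \<le> exp (real n * p ^ t)" using p by (intro sum_Pow_exp_le) auto
      finally show "(\<Sum>B\<in>?Bs Q. (p ^ t) ^ card B) \<le> exp (real n * p ^ t)" .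
    qed (use card_subsets_le[of n m] in \<open>auto simp flip: of_nat_power\<close>)
    finally show "(\<Sum>B\<in>?Bs Q. \<Sum>K\<in>?S m. (p ^ t) ^ card B * exp (- 4 * L)) \<le> exp (real n * p ^ t) * (real n ^ m * exp (- 4 * L))" .
  qed
  also have "\<dots> = real (card (?S t)) * (exp (real n * p ^ t) * (real n ^ m * exp (- 4 * L)))" by simp
  also have "\<dots> \<le> real n ^ t * (exp (real n * p ^ t) * (real n ^ m * exp (- 4 * L)))"
    using card_subsets_le[of n t] by (intro mult_right_mono) (auto simp flip: of_nat_power)
  finally show ?thesis .
qed

section \<open>Recovery of the planted clique\<close>

text \<open>The bilinear bound is tested with the vector R y itself.\<close>

lemma sq_from_bilinear:
  assumes "0 \<le> \<rho>" "\<And>x. ip V x (mv V R y) \<le> \<rho> * sqrt (sq V x) * sqrt (sq V y)"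
  shows "sq V (mv V R y) \<le> \<rho>\<^sup>2 * sq V y"
proof -
  define r where "r = sqrt (sq V (mv V R y))"
  have r: "0 \<le> r" "r * r = sq V (mv V R y)" by (simp_all add: r_def sq_nonneg)
  have "r * r \<le> \<rho> * r * sqrt (sq V y)"
    using assms(2)[of "mv V R y"] r(2) by (simp add: ip_def sq_def r_def power2_eq_square)
  then have "r \<le> \<rho> * sqrt (sq V y)"
    using r(1) assms(1) by (cases "r = 0") (auto simp: mult_ac sq_nonneg)
  then have "r\<^sup>2 \<le> (\<rho> * sqrt (sq V y))\<^sup>2" using r(1) by (intro power_mono)
  then show ?thesis by (simp add: power_mult_distrib r sq_nonneg power2_eq_square[of r])
qed

lemma sq_mono: "finite V \<Longrightarrow> K \<subseteq> V \<Longrightarrow> sq K x \<le> sq V x"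
  unfolding sq_def by (intro sum_mono2) auto

lemma sum_abs_le_sqrt:
  assumes "finite V"
  shows "(\<Sum>v\<in>V. \<bar>x v\<bar>) \<le> sqrt (card V) * sqrt (sq V x)"
proof -
  have "(\<Sum>v\<in>V. \<bar>x v\<bar>)\<^sup>2 \<le> (\<Sum>v\<in>V. \<bar>x v\<bar>\<^sup>2) * card V" by (rule sum_squared_le_sum_of_squares)
  then have "(\<Sum>v\<in>V. \<bar>x v\<bar>)\<^sup>2 \<le> card V * sq V x" by (simp add: sq_def mult.commute)
  then have "sqrt ((\<Sum>v\<in>V. \<bar>x v\<bar>)\<^sup>2) \<le> sqrt (card V * sq V x)" by (rule real_sqrt_le_mono)
  then show ?thesis by (simp add: real_sqrt_mult sum_nonneg)
qed

text \<open>R differs from W by three corrections: the block on K, which planting overwrites; the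
  error p - q off the block, of Frobenius norm at most 1 since each entry is at most 1/n; and a
  diagonal with entries in [0,1]. The four pieces cost \<rho>, \<rho>, 1 and 1.\<close>

lemma planted_noise_bound:
  fixes x y :: "nat \<Rightarrow> real"
  assumes V: "finite V" "card V \<le> n" "K \<subseteq> V" and W0: "0 \<le> \<rho>" and p: "0 \<le> p" "p \<le> 1" and n: "0 < n"
    and q: "\<bar>p - q\<bar> \<le> 1 / real n"
    and WV: "\<And>x y. ip V x (mv V W y) \<le> \<rho> * sqrt (sq V x) * sqrt (sq V y)"
    and WK: "\<And>x y. ip K x (mv K W y) \<le> \<rho> * sqrt (sq K x) * sqrt (sq K y)"
    and R: "\<And>u v. u \<in> V \<Longrightarrow> v \<in> V \<Longrightarrow> R u v = W u v - (if u \<in> K \<and> v \<in> K then W u v else 0)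
      + (p - q) * (1 - of_bool (u \<in> K \<and> v \<in> K)) - (if u = v then (if u \<in> K then 1 else p) else 0)"
  shows "ip V x (mv V R y) \<le> (2 * \<rho> + 2) * sqrt (sq V x) * sqrt (sq V y)"
proof -
  let ?nx = "sqrt (sq V x)" and ?ny = "sqrt (sq V y)"
  define T2 where "T2 = (\<Sum>u\<in>V. \<Sum>v\<in>V. x u * ((if u \<in> K \<and> v \<in> K then W u v else 0) * y v))"
  define T3 where "T3 = (\<Sum>u\<in>V. \<Sum>v\<in>V. x u * ((p - q) * (1 - of_bool (u \<in> K \<and> v \<in> K)) * y v))"
  define T4 where "T4 = (\<Sum>u\<in>V. \<Sum>v\<in>V. x u * ((if u = v then (if u \<in> K then 1 else p) else 0) * y v))"
  have "ip V x (mv V R y) = (\<Sum>u\<in>V. \<Sum>v\<in>V. x u * (R u v * y v))"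
    by (simp add: ip_def mv_def sum_distrib_left)
  also have "\<dots> = (\<Sum>u\<in>V. \<Sum>v\<in>V. x u * (W u v * y v) - x u * ((if u \<in> K \<and> v \<in> K then W u v else 0) * y v)
      + x u * ((p - q) * (1 - of_bool (u \<in> K \<and> v \<in> K)) * y v) - x u * ((if u = v then (if u \<in> K then 1 else p) else 0) * y v))"
    by (intro sum.cong refl) (simp only: R left_diff_distrib distrib_right right_diff_distrib distrib_left)
  also have "\<dots> = ip V x (mv V W y) - T2 + T3 - T4"
    by (simp only: sum_subtractf sum.distrib T2_def T3_def T4_def ip_def mv_def sum_distrib_left)
  finally have eq: "ip V x (mv V R y) = ip V x (mv V W y) - T2 + T3 - T4" .
  have nn: "0 \<le> ?nx" "0 \<le> ?ny" by (simp_all add: sq_nonneg)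
  have sK: "sqrt (sq K x) \<le> ?nx" "sqrt (sq K y) \<le> ?ny" using sq_mono[OF V(1,3)] by auto
  have "- T2 = ip K (\<lambda>v. - x v) (mv K W y)"
  proof -
    have "(\<Sum>v\<in>V. x u * ((if u \<in> K \<and> v \<in> K then W u v else 0) * y v)) = (if u \<in> K then x u * mv K W y u else 0)" for u
    proof (cases "u \<in> K")
      case True
      have "(\<Sum>v\<in>V. x u * ((if u \<in> K \<and> v \<in> K then W u v else 0) * y v)) = (\<Sum>v\<in>K. x u * (W u v * y v))"
        using True V by (intro sum.mono_neutral_cong_right) auto
      then show ?thesis using True by (simp add: mv_def sum_distrib_left)
    qed simp
    then have "T2 = (\<Sum>u\<in>V. if u \<in> K then x u * mv K W y u else 0)" by (simp add: T2_def)
    also have "\<dots> = (\<Sum>u\<in>K. x u * mv K W y u)" using V by (intro sum.mono_neutral_cong_right) auto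
    finally show ?thesis by (simp add: ip_def sum_negf)
  qed
  also have "\<dots> \<le> \<rho> * sqrt (sq K (\<lambda>v. - x v)) * sqrt (sq K y)" by (rule WK)
  also have "\<dots> = \<rho> * sqrt (sq K x) * sqrt (sq K y)" by (simp add: sq_def)
  also have "\<dots> \<le> \<rho> * ?nx * ?ny" using sK W0 nn by (intro mult_mono) (auto simp: sq_nonneg)
  finally have t2: "- T2 \<le> \<rho> * ?nx * ?ny" .
  have "T3 \<le> (\<Sum>u\<in>V. \<Sum>v\<in>V. 1 / real n * (\<bar>x u\<bar> * \<bar>y v\<bar>))"
    unfolding T3_def
  proof (intro sum_mono)
    fix u v
    let ?d = "(p - q) * (1 - of_bool (u \<in> K \<and> v \<in> K))"
    have "\<bar>?d\<bar> \<le> 1 / real n" using q n by auto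
    then have "\<bar>?d\<bar> * (\<bar>x u\<bar> * \<bar>y v\<bar>) \<le> 1 / real n * (\<bar>x u\<bar> * \<bar>y v\<bar>)" by (intro mult_right_mono) auto
    moreover have "x u * (?d * y v) \<le> \<bar>?d\<bar> * (\<bar>x u\<bar> * \<bar>y v\<bar>)"
      using abs_ge_self[of "x u * (?d * y v)"] by (simp add: abs_mult mult_ac)
    ultimately show "x u * (?d * y v) \<le> 1 / real n * (\<bar>x u\<bar> * \<bar>y v\<bar>)" by linarith
  qed
  also have "\<dots> = 1 / real n * ((\<Sum>u\<in>V. \<bar>x u\<bar>) * (\<Sum>v\<in>V. \<bar>y v\<bar>))"
    unfolding sum_product unfolding sum_distrib_left ..
  also have "\<dots> \<le> 1 / real n * ((sqrt (card V) * ?nx) * (sqrt (card V) * ?ny))"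
    using sum_abs_le_sqrt[OF V(1)] nn by (intro mult_left_mono mult_mono) (auto intro: sum_nonneg)
  also have "\<dots> = (card V / real n) * (?nx * ?ny)" by simp
  also have "\<dots> \<le> 1 * (?nx * ?ny)" using V n nn by (intro mult_right_mono) auto
  finally have t3: "T3 \<le> ?nx * ?ny" by simp
  have "- T4 \<le> (\<Sum>u\<in>V. \<bar>x u\<bar> * \<bar>y u\<bar>)"
  proof -
    have "T4 = (\<Sum>u\<in>V. x u * ((if u \<in> K then 1 else p) * y u))"
      unfolding T4_def
    proof (intro sum.cong refl)
      fix u assume "u \<in> V"
      have "(\<Sum>v\<in>V. x u * ((if u = v then (if u \<in> K then 1 else p) else 0) * y v))
        = (\<Sum>v\<in>V. if u = v then x u * ((if u \<in> K then 1 else p) * y v) else 0)" by (intro sum.cong refl) auto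
      also have "\<dots> = x u * ((if u \<in> K then 1 else p) * y u)" using \<open>u \<in> V\<close> V(1) by simp
      finally show "(\<Sum>v\<in>V. x u * ((if u = v then (if u \<in> K then 1 else p) else 0) * y v)) = x u * ((if u \<in> K then 1 else p) * y u)" .
    qed
    then have "- T4 = (\<Sum>u\<in>V. - (x u * ((if u \<in> K then 1 else p) * y u)))" by (simp add: sum_negf)
    also have "\<dots> \<le> (\<Sum>u\<in>V. \<bar>x u\<bar> * \<bar>y u\<bar>)"
    proof (rule sum_mono)
      fix u
      let ?d = "if u \<in> K then 1 else p"
      have "\<bar>?d\<bar> * (\<bar>x u\<bar> * \<bar>y u\<bar>) \<le> 1 * (\<bar>x u\<bar> * \<bar>y u\<bar>)" using p by (intro mult_right_mono) auto
      moreover have "- (x u * (?d * y u)) \<le> \<bar>?d\<bar> * (\<bar>x u\<bar> * \<bar>y u\<bar>)"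
        using abs_ge_minus_self[of "x u * (?d * y u)"] by (simp add: abs_mult mult_ac)
      ultimately show "- (x u * (?d * y u)) \<le> \<bar>x u\<bar> * \<bar>y u\<bar>" by linarith
    qed
    finally show ?thesis .
  qed
  also have "\<dots> \<le> ?nx * ?ny"
    using L2_set_mult_ineq[of x y V] by (simp add: L2_set_def sq_def)
  finally have t4: "- T4 \<le> ?nx * ?ny" .
  have "ip V x (mv V R y) \<le> \<rho> * ?nx * ?ny + \<rho> * ?nx * ?ny + ?nx * ?ny + ?nx * ?ny"
    using eq WV[of x y] t2 t3 t4 by linarith
  then show ?thesis by (simp add: algebra_simps)
qed

text \<open>The integer vectors of the program are the real iterates scaled by n^s; a common
  positive factor leaves every comparison of entries unchanged.\<close>

lemma pw_eq_iterate:
  assumes V: "V \<subseteq> {..<n}" "i \<in> V" and n: "0 < n"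
    and M: "\<And>u v. M u v = of_bool (adj E u v) - real j / real n"
  shows "v \<in> V \<Longrightarrow> real_of_int (pw n E V j i s v) = real n ^ s * (mv V M ^^ s) (\<lambda>v. of_bool (v = i)) v"
    and "v \<notin> V \<Longrightarrow> pw n E V j i s v = 0"
proof (induction s arbitrary: v)
  case 0
  { case 1 show ?case by simp }
  { case 2 then show ?case using V by auto }
next
  case (Suc s)
  { case 1
    have fV: "finite V" using V finite_subset by blast
    let ?c = "(mv V M ^^ s) (\<lambda>v. of_bool (v = i))"
    have "real_of_int (pw n E V j i (Suc s) v) = (\<Sum>w<n. (real n * of_bool (adj E v w) - real j) * real_of_int (pw n E V j i s w))"
      using 1 by simp
    also have "\<dots> = (\<Sum>w\<in>V. (real n * of_bool (adj E v w) - real j) * real_of_int (pw n E V j i s w))"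
      using V Suc(2) by (intro sum.mono_neutral_right) auto
    also have "\<dots> = (\<Sum>w\<in>V. real n ^ Suc s * (M v w * ?c w))"
    proof (intro sum.cong refl)
      fix w assume w: "w \<in> V"
      have "real n * of_bool (adj E v w) - real j = real n * M v w" using n by (simp add: M right_diff_distrib)
      then show "(real n * of_bool (adj E v w) - real j) * real_of_int (pw n E V j i s w) = real n ^ Suc s * (M v w * ?c w)"
        unfolding Suc(1)[OF w] by simp
    qed
    also have "\<dots> = real n ^ Suc s * (mv V M ^^ Suc s) (\<lambda>v. of_bool (v = i)) v"
      by (simp add: mv_def sum_distrib_left)
    finally show ?case . }
  { case 2 then show ?case by simp }
qed

section \<open>Spectral recovery in one planted graph\<close>

definition plant :: "nat \<Rightarrow> nat set set \<Rightarrow> nat set \<Rightarrow> nat set set" where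
  "plant n E' K = E' \<union> {e \<in> all_pairs n. e \<subseteq> K}"

lemma adj_plant_inside: "K \<subseteq> {..<n} \<Longrightarrow> u \<in> K \<Longrightarrow> v \<in> K \<Longrightarrow> u \<noteq> v \<Longrightarrow> adj (plant n E' K) u v"
  unfolding adj_def plant_def all_pairs_def by blast

lemma adj_plant_outside: "u \<notin> K \<Longrightarrow> adj (plant n E' K) u v \<longleftrightarrow> adj E' u v"
  by (auto simp: adj_def plant_def)

lemma adj_plant_outside': "v \<notin> K \<Longrightarrow> adj (plant n E' K) u v \<longleftrightarrow> adj E' u v"
  by (auto simp: adj_def plant_def)

text \<open>B stands for the common neighbours of Q outside the planted set, whose edges to Q belong
  to the random graph. Every K is covered, in particular one that depends on E. Taking B empty gives
  the bound for the block of K alone.\<close>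

definition norm_ok :: "nat \<Rightarrow> nat set set \<Rightarrow> real \<Rightarrow> nat \<Rightarrow> nat \<Rightarrow> real \<Rightarrow> bool" where
  "norm_ok n E p t m \<rho> \<longleftrightarrow> (\<forall>Q B K. Q \<subseteq> {..<n} \<longrightarrow> card Q = t \<longrightarrow> B \<subseteq> {..<n} - Q \<longrightarrow> star_pairs Q B \<subseteq> E \<longrightarrow>
     K \<subseteq> {..<n} \<longrightarrow> card K = m \<longrightarrow> K \<inter> Q = {} \<longrightarrow>
     (\<forall>x y. ip (B \<union> K) x (mv (B \<union> K) (Wm E p) y) \<le> \<rho> * sqrt (sq (B \<union> K) x) * sqrt (sq (B \<union> K) y)))"

lemma spectral_recovery:
  assumes K: "K \<subseteq> {..<n}" "card K = k" and t: "0 < t" "t < k" and p: "0 \<le> p" "p \<le> 1"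
    and j: "j < n" "\<bar>p - real j / real n\<bar> \<le> 1 / real n"
    and rh: "0 \<le> \<rho>" "2 * \<rho> + 2 \<le> \<epsilon> * ((1 - real j / real n) * real (k - t))"
    and ep: "0 < \<epsilon>" "\<epsilon> \<le> 1 / 10" "real n * (2 * \<epsilon>) ^ (2 * n) \<le> \<epsilon>\<^sup>2"
    and N: "norm_ok n E' p t (k - t) \<rho>"
  shows "\<exists>g Q. (\<forall>i<t+3. g i < n) \<and> Q \<subseteq> K \<and> card Q = t
    \<and> real (card (candT n (plant n E' K) t g - (K - Q))) \<le> 80 * \<epsilon>\<^sup>2 * real (k - t)
    \<and> real (card ((K - Q) - candT n (plant n E' K) t g)) \<le> 80 * \<epsilon>\<^sup>2 * real (k - t)"
proof -
  define E where "E = plant n E' K"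
  have n: "0 < n" using j by simp
  have fK: "finite K" using K finite_subset by blast
  obtain Q where Q: "Q \<subseteq> K" "card Q = t" "finite Q"
    using obtain_subset_with_card_n[of t K] t K by auto
  obtain b where b: "bij_betw b {0..<t} Q" using ex_bij_betw_nat_finite[OF Q(3)] Q(2) by auto
  have bQ: "b ` {..<t} = Q" using b by (simp add: bij_betw_def lessThan_atLeast0)
  define K' where "K' = K - Q"
  have cK': "card K' = k - t" using Q K fK by (simp add: K'_def card_Diff_subset)
  have K'ne: "K' \<noteq> {}" using cK' t by auto
  define V where "V = nbh n E t b"
  have V_def': "V = {v. v < n \<and> (\<forall>q\<in>Q. adj E v q)}"
    unfolding V_def nbh_def bQ[symmetric] by auto
  have Vn: "V \<subseteq> {..<n}" by (auto simp: V_def')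
  then have fV: "finite V" using finite_subset by blast
  have VQ: "V \<inter> Q = {}" by (auto simp: V_def' adj_def)
  have K'V: "K' \<subseteq> V"
  proof
    fix v assume v: "v \<in> K'"
    have "adj E v q" if "q \<in> Q" for q
      unfolding E_def using v that Q(1) by (intro adj_plant_inside[OF K(1)]) (auto simp: K'_def)
    then show "v \<in> V" using v K(1) by (auto simp: V_def' K'_def)
  qed
  define B where "B = V - K"
  have VB: "V = B \<union> K'" using K'V VQ by (auto simp: B_def K'_def)
  have BQ: "B \<subseteq> {..<n} - Q" using Vn VQ by (auto simp: B_def)
  \<comment> \<open>Planting adds only edges inside K, so a vertex outside K that is adjacent to Q
    in the planted graph was adjacent to Q before.\<close>
  have star: "star_pairs Q B \<subseteq> E'"
  proof
    fix e assume "e \<in> star_pairs Q B"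
    then obtain q v where qv: "q \<in> Q" "v \<in> B" "e = {q, v}" by (auto simp: star_pairs_def)
    then have "adj E v q" "v \<notin> K" by (auto simp: B_def V_def')
    then have "adj E' v q" unfolding E_def by (simp add: adj_plant_outside)
    then show "e \<in> E'" using qv(3) by (simp add: adj_def insert_commute)
  qed
  have K'Q: "K' \<inter> Q = {}" "K' \<subseteq> {..<n}" using K by (auto simp: K'_def)
  have Qn: "Q \<subseteq> {..<n}" using Q K by auto
  have ok: "ip (B0 \<union> K') x (mv (B0 \<union> K') (Wm E' p) y) \<le> \<rho> * sqrt (sq (B0 \<union> K') x) * sqrt (sq (B0 \<union> K') y)"
    if "B0 \<subseteq> {..<n} - Q" "star_pairs Q B0 \<subseteq> E'" for B0 x y
    using N[unfolded norm_ok_def, rule_format, OF Qn Q(2) that K'Q(2) cK' K'Q(1)] .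
  have NV: "ip V x (mv V (Wm E' p) y) \<le> \<rho> * sqrt (sq V x) * sqrt (sq V y)" for x y
    unfolding VB by (rule ok[OF BQ star])
  have NK: "ip K' x (mv K' (Wm E' p) y) \<le> \<rho> * sqrt (sq K' x) * sqrt (sq K' y)" for x y
    using ok[of "{}" x y] by (simp add: star_pairs_def)
  define q where "q = real j / real n"
  have q1: "0 \<le> q" "q < 1" using j by (auto simp: q_def)
  define k' where "k' = real (k - t)"
  have k': "0 < k'" using t by (simp add: k'_def)
  \<comment> \<open>Off the diagonal the centred matrix equals 1 - q on the planted block; the
    constant block, written with a unit vector, has eigenvalue 1 - q times its size.\<close>
  define \<kappa> where "\<kappa> = (1 - q) * k'"
  have \<kappa>: "0 < \<kappa>" using q1 k' by (simp add: \<kappa>_def)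
  define M where "M u v = of_bool (adj E u v) - real j / real n" for u v
  define u0 where "u0 v = (if v \<in> K' then 1 / sqrt (card K') else 0)" for v
  define R where "R u v = M u v - \<kappa> * u0 u * u0 v" for u v
  have uu: "\<kappa> * u0 u * u0 v = (if u \<in> K' \<and> v \<in> K' then 1 - q else 0)" for u v
  proof (cases "u \<in> K' \<and> v \<in> K'")
    case True
    then have "\<kappa> * u0 u * u0 v = (1 - q) * k' * (1 / sqrt k') * (1 / sqrt k')"
      by (simp only: u0_def \<kappa>_def cK' k'_def if_True)
    also have "\<dots> = 1 - q" using k' by (simp add: field_simps)
    finally show ?thesis using True by simp
  next
    case False
    then show ?thesis by (auto simp: u0_def)
  qed
  have R: "R u v = Wm E' p u v - (if u \<in> K' \<and> v \<in> K' then Wm E' p u v else 0)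
      + (p - q) * (1 - of_bool (u \<in> K' \<and> v \<in> K')) - (if u = v then (if u \<in> K' then 1 else p) else 0)"
    if uv: "u \<in> V" "v \<in> V" for u v
  proof -
    have notK: "w \<notin> K" if "w \<in> V" "w \<notin> K'" for w using that VQ by (auto simp: K'_def)
    consider "u = v" | "u \<noteq> v" "u \<in> K' \<and> v \<in> K'" | "u \<noteq> v" "u \<notin> K' \<or> v \<notin> K'" by blast
    then show ?thesis
    proof cases
      case 1
      then show ?thesis by (simp add: R_def uu M_def adj_def Wm_def q_def)
    next
      case 2
      then have "adj E u v" unfolding E_def by (intro adj_plant_inside[OF K(1)]) (auto simp: K'_def)
      then show ?thesis using 2 by (simp add: R_def uu M_def Wm_def q_def)
    next
      case 3
      then have "adj E u v = ({u, v} \<in> E')"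
        using notK uv adj_plant_outside[of u K n E' v] adj_plant_outside'[of v K n E' u] unfolding E_def
        by (auto simp: adj_def)
      then show ?thesis using 3 by (auto simp: R_def uu M_def Wm_def q_def)
    qed
  qed
  have cV: "card V \<le> n" using card_mono[OF _ Vn] by simp
  have bil: "ip V x (mv V R y) \<le> (2 * \<rho> + 2) * sqrt (sq V x) * sqrt (sq V y)" for x y
    by (rule planted_noise_bound[OF fV cV K'V rh(1) p n _ NV NK R]) (use j in \<open>auto simp: q_def\<close>)
  have unit: "sq V u0 = 1"
  proof -
    have "sq V u0 = (\<Sum>v\<in>K'. (1 / sqrt (card K'))\<^sup>2)"
      unfolding sq_def using fV K'V by (intro sum.mono_neutral_cong_right) (auto simp: u0_def)
    also have "\<dots> = 1" using k' by (simp add: cK' k'_def power_divide)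
    finally show ?thesis .
  qed
  interpret rank_one_noise V M R u0 \<kappa> "2 * \<rho> + 2" \<epsilon>
  proof
    show "sq V (mv V R y) \<le> (2 * \<rho> + 2)\<^sup>2 * sq V y" for y
      using bil rh(1) by (intro sq_from_bilinear) auto
    show "2 * \<rho> + 2 \<le> \<epsilon> * \<kappa>" using rh(2) by (simp add: \<kappa>_def q_def k'_def)
  qed (use fV unit rh(1) \<kappa> ep in \<open>auto simp: M_def R_def u0_def adj_commute\<close>)
  have "real (card V) * (2 * \<epsilon>) ^ (2 * n) \<le> real n * (2 * \<epsilon>) ^ (2 * n)"
    using cV ep by (intro mult_right_mono) auto
  with ep(3) have "real (card V) * (2 * \<epsilon>) ^ (2 * n) \<le> \<epsilon>\<^sup>2" by linarith
  then obtain i where i: "i \<in> V" "0 < Z n i" "sq V (\<lambda>v. col n i v - Z n i * u0 v) \<le> 20 * \<epsilon>\<^sup>2 * (Z n i)\<^sup>2"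
    by (rule good_column)
  have "\<epsilon>\<^sup>2 \<le> (1/10)\<^sup>2" using ep by (intro power_mono) auto
  then have e4: "20 * \<epsilon>\<^sup>2 * 4 < 1" by (simp add: power2_eq_square)
  have "\<exists>l\<in>V. real (card ({v \<in> V. col n i l \<le> col n i v} - K')) \<le> 80 * \<epsilon>\<^sup>2 * card K'
     \<and> real (card (K' - {v \<in> V. col n i l \<le> col n i v})) \<le> 80 * \<epsilon>\<^sup>2 * card K'"
    using i(3) by (intro threshold_recovers[OF fV K'V K'ne i(2) e4]) (simp add: u0_def)
  then obtain l where l: "l \<in> V" "real (card ({v \<in> V. col n i l \<le> col n i v} - K')) \<le> 80 * \<epsilon>\<^sup>2 * card K'"
    "real (card (K' - {v \<in> V. col n i l \<le> col n i v})) \<le> 80 * \<epsilon>\<^sup>2 * card K'" by blast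
  \<comment> \<open>The right guess: the members of Q, the density numerator j, the good column i
    and the threshold vertex l.\<close>
  define g where "g x = (if x < t then b x else if x = t then j else if x = t + 1 then i else l)" for x
  have gn: "g x < n" if "x < t + 3" for x
  proof -
    have "b x < n" if "x < t" using that bQ Qn by auto
    then show ?thesis using j i(1) l(1) Vn by (auto simp: g_def)
  qed
  have Vg: "nbh n E t g = V" unfolding V_def by (auto simp: nbh_def g_def)
  have pw: "real_of_int (pw n E V j i n v) = real n ^ n * col n i v" if "v \<in> V" for v
    using pw_eq_iterate(1)[OF Vn i(1) n _ that] M_def by blast
  have "pw n E V j i n l \<le> pw n E V j i n v \<longleftrightarrow> col n i l \<le> col n i v" if "v \<in> V" for v
  proof -
    have "pw n E V j i n l \<le> pw n E V j i n v \<longleftrightarrow> real_of_int (pw n E V j i n l) \<le> real_of_int (pw n E V j i n v)" by simp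
    also have "\<dots> \<longleftrightarrow> col n i l \<le> col n i v" unfolding pw[OF that] pw[OF l(1)] using n by simp
    finally show ?thesis .
  qed
  then have T: "candT n E t g = {v \<in> V. col n i l \<le> col n i v}"
    unfolding candT_def Vg by (auto simp: g_def)
  have "real (card (candT n E t g - (K - Q))) \<le> 80 * \<epsilon>\<^sup>2 * real (k - t)"
    "real (card ((K - Q) - candT n E t g)) \<le> 80 * \<epsilon>\<^sup>2 * real (k - t)"
    using l(2,3) unfolding cK' T[symmetric] unfolding K'_def by simp_all
  then show ?thesis unfolding E_def[symmetric]
    by (intro exI[of _ g] exI[of _ Q] conjI allI impI gn Q(1,2))
qed

section \<open>From the approximate set to a maximum clique\<close>

lemma near_contains_clique:
  assumes T: "finite T" "4 * h * card (T - K') \<le> card K'" "4 * h * card (K' - T) \<le> card K'" and h: "0 < h"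
    and K': "finite K'" and C: "is_clique n E C" "card (K' - C) \<le> m" "2 * h * m \<le> card K'"
  shows "C \<subseteq> near n E h T"
proof
  fix v assume v: "v \<in> C"
  let ?N = "{x \<in> T. v \<noteq> x \<and> \<not> adj E v x}"
  have "adj E v x" if "x \<in> C" "v \<noteq> x" for x using C(1) v that by (auto simp: is_clique_def adj_def)
  \<comment> \<open>A non-neighbour of v in T lies outside K' or outside C. These parts have at most
    1/(4h) and 1/(2h) of \<open>card K'\<close> members, together 3/(4h), while T has at least 3/4
    of \<open>card K'\<close>.\<close>
  then have "?N \<subseteq> (T - K') \<union> (K' - C)" by auto
  then have "card ?N \<le> card ((T - K') \<union> (K' - C))" using T K' by (intro card_mono) auto
  also have "\<dots> \<le> card (T - K') + card (K' - C)" by (rule card_Un_le)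
  also have "\<dots> \<le> card (T - K') + m" using C(2) by simp
  finally have "4 * h * card ?N \<le> 4 * h * (card (T - K') + m)" by (intro mult_le_mono2)
  also have "\<dots> = 4 * h * card (T - K') + 2 * (2 * h * m)" by (simp add: distrib_left)
  also have "\<dots> \<le> 3 * card K'" using T(2) C(3) by linarith
  finally have 1: "4 * h * card ?N \<le> 3 * card K'" .
  have "4 * card (K' - T) \<le> 4 * h * card (K' - T)" using h by (intro mult_le_mono1) simp
  then have "4 * card (K' - T) \<le> card K'" using T(3) by linarith
  moreover have "card K' \<le> card (K' - T) + card T"
    using card_mono[of "(K' - T) \<union> T" K'] card_Un_le[of "K' - T" T] T(1) K' by auto
  ultimately have "4 * (h * card ?N) \<le> 4 * card T" using 1 by simp
  then have "h * card ?N \<le> card T" by simp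
  moreover have "v < n" using v C(1) by (auto simp: is_clique_def)
  ultimately show "v \<in> near n E h T" by (simp add: near_def)
qed

text \<open>Vertices of K not adjacent to v lie in Q, in K - Q - T, or among the non-neighbours of v
  in T. These number at most 1/h, 1/(4h) and 5/(4h) of \<open>card K\<close>, the last because T has
  at most 5/4 of \<open>card K\<close> members; 3/h is a convenient bound for the sum.\<close>

lemma near_neighbours:
  assumes T: "finite T" "4 * h * card (T - (K - Q)) \<le> card (K - Q)" "4 * h * card (K - Q - T) \<le> card (K - Q)" and h: "0 < h"
    and K: "finite K" and Q: "Q \<subseteq> K" "h * card Q \<le> card K" and v: "v \<in> near n E h T" "v \<notin> K"
  shows "h * card K \<le> h * card {x \<in> K. adj E v x} + 3 * card K"
proof -
  let ?N = "{x \<in> T. v \<noteq> x \<and> \<not> adj E v x}" and ?K' = "K - Q"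
  have "K \<subseteq> {x \<in> K. adj E v x} \<union> (Q \<union> ((?K' - T) \<union> ?N))" using v(2) by auto
  then have "card K \<le> card ({x \<in> K. adj E v x} \<union> (Q \<union> ((?K' - T) \<union> ?N)))"
    using K Q T finite_subset[OF Q(1) K] by (intro card_mono) auto
  also have "\<dots> \<le> card {x \<in> K. adj E v x} + (card Q + (card (?K' - T) + card ?N))"
    using card_Un_le[of "{x \<in> K. adj E v x}" "Q \<union> ((?K' - T) \<union> ?N)"] card_Un_le[of Q "(?K' - T) \<union> ?N"]
      card_Un_le[of "?K' - T" ?N] by linarith
  finally have "4 * (h * card K) \<le> 4 * (h * (card {x \<in> K. adj E v x} + (card Q + (card (?K' - T) + card ?N))))"
    by (intro mult_le_mono2)
  also have "\<dots> = 4 * (h * card {x \<in> K. adj E v x}) + 4 * (h * card Q) + 4 * h * card (?K' - T) + 4 * (h * card ?N)"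
    by (simp add: distrib_left)
  finally have 1: "4 * (h * card K) \<le> 4 * (h * card {x \<in> K. adj E v x}) + 4 * (h * card Q) + 4 * h * card (?K' - T) + 4 * (h * card ?N)" .
  have "h * card ?N \<le> card T" using v(1) by (simp add: near_def)
  moreover have "card T \<le> card ?K' + card (T - ?K')"
    using card_mono[of "?K' \<union> (T - ?K')" T] card_Un_le[of ?K' "T - ?K'"] T(1) K by auto
  moreover have "4 * card (T - ?K') \<le> card ?K'"
  proof -
    have "4 * card (T - ?K') \<le> 4 * h * card (T - ?K')" using h by (intro mult_le_mono1) simp
    then show ?thesis using T(2) by linarith
  qed
  moreover have "card ?K' \<le> card K" using K by (intro card_mono) auto
  ultimately have "4 * (h * card K) \<le> 4 * (h * card {x \<in> K. adj E v x}) + 12 * card K"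
    using 1 T(3) Q(2) by linarith
  then show ?thesis by simp
qed

lemma card_star_pairs_Int:
  assumes "D \<inter> K = {}" "finite D" "finite K"
  shows "card (star_pairs D K \<inter> E) = (\<Sum>v\<in>D. card {x \<in> K. adj E v x})"
proof -
  let ?S = "SIGMA v:D. {x \<in> K. adj E v x}"
  have "star_pairs D K \<inter> E = (\<lambda>(q, b). {q, b}) ` ?S"
    using assms(1) by (auto simp: star_pairs_def adj_def image_iff)
  moreover have "inj_on (\<lambda>(q, b). {q, b}) ?S" using assms(1) by (auto simp: inj_on_def doubleton_eq_iff)
  ultimately have "card (star_pairs D K \<inter> E) = card ?S" by (simp add: card_image)
  also have "\<dots> = (\<Sum>v\<in>D. card {x \<in> K. adj E v x})" using assms by simp
  finally show ?thesis .
qed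

lemma ex_max_clique: "\<exists>C. is_max_clique n E C"
proof -
  let ?S = "{C. is_clique n E C}"
  have "?S \<subseteq> Pow {..<n}" by (auto simp: is_clique_def)
  then have "finite ?S" by (rule finite_subset) simp
  moreover have "{} \<in> ?S" by (simp add: is_clique_def)
  ultimately have "Max (card ` ?S) \<in> card ` ?S" by (intro Max_in) auto
  then obtain C where C: "is_clique n E C" "card C = Max (card ` ?S)" by auto
  then have "card D \<le> card C" if "is_clique n E D" for D using that \<open>finite ?S\<close> by auto
  then show ?thesis using C(1) by (auto simp: is_max_clique_def)
qed

text \<open>Cleared of fractions, this says that the edge density between D and K is below 1 -
  3/h.\<close>

definition sparse_ok :: "nat \<Rightarrow> nat set set \<Rightarrow> nat \<Rightarrow> nat \<Rightarrow> nat \<Rightarrow> bool" where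
  "sparse_ok n E h k m \<longleftrightarrow> (\<forall>D K. D \<subseteq> {..<n} \<longrightarrow> card D = m \<longrightarrow> K \<subseteq> {..<n} \<longrightarrow> card K = k \<longrightarrow> D \<inter> K = {} \<longrightarrow>
      h * card (star_pairs D K \<inter> E) + 3 * (m * k) < h * (m * k))"

definition clique_ok :: "nat \<Rightarrow> nat set set \<Rightarrow> nat \<Rightarrow> bool" where
  "clique_ok n E m \<longleftrightarrow> (\<forall>C. C \<subseteq> {..<n} \<longrightarrow> card C = m \<longrightarrow> \<not> {e. e \<subseteq> C \<and> card e = 2} \<subseteq> E)"

text \<open>A maximum clique C need not be K. Edges with an endpoint outside K are unplanted, so
  \<open>clique_ok\<close> leaves C fewer than m vertices outside K; as C is at least as large as K,
  it also misses at most m vertices of K and hence lies in the near set F. By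
  \<open>sparse_ok\<close> fewer than m vertices of F lie outside K, so F exceeds C by fewer than m
  vertices and m branching bits suffice.\<close>

lemma planted_recovery:
  assumes K: "K \<subseteq> {..<n}" "card K = k" and t: "0 < t" "t < k" and p: "0 \<le> p" "p \<le> 1"
    and j: "j < n" "\<bar>p - real j / real n\<bar> \<le> 1 / real n"
    and rh: "0 \<le> \<rho>" "2 * \<rho> + 2 \<le> \<epsilon> * ((1 - real j / real n) * real (k - t))"
    and ep: "0 < \<epsilon>" "\<epsilon> \<le> 1 / 10" "real n * (2 * \<epsilon>) ^ (2 * n) \<le> \<epsilon>\<^sup>2" "320 * real h * \<epsilon>\<^sup>2 \<le> 1"
    and h: "0 < h" "h * t \<le> k" "2 * h * m \<le> k - t"
    and ok: "norm_ok n E' p t (k - t) \<rho>" "sparse_ok n E' h k m" "clique_ok n E' m"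
  shows "\<exists>g y C. (\<forall>i<t+3. g i < n) \<and> y < 2 ^ m \<and> is_max_clique n (plant n E' K) C
    \<and> card C \<le> card (res n (plant n E' K) y (near n (plant n E' K) h (candT n (plant n E' K) t g)))"
proof -
  define E where "E = plant n E' K"
  have fK: "finite K" using K finite_subset by blast
  obtain g Q where g: "\<forall>i<t+3. g i < n" and Q: "Q \<subseteq> K" "card Q = t"
    and rec: "real (card (candT n E t g - (K - Q))) \<le> 80 * \<epsilon>\<^sup>2 * real (k - t)"
      "real (card ((K - Q) - candT n E t g)) \<le> 80 * \<epsilon>\<^sup>2 * real (k - t)"
    using spectral_recovery[OF K t p j rh ep(1-3) ok(1)] unfolding E_def by blast
  define T where "T = candT n E t g"
  define F where "F = near n E h T"
  have fQ: "finite Q" using Q fK finite_subset by blast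
  have cK': "card (K - Q) = k - t" using Q K fQ by (simp add: card_Diff_subset)
  have fT: "finite T" by (rule finite_subset[of _ "{..<n}"]) (auto simp: T_def candT_def nbh_def)
  \<comment> \<open>The condition on \<epsilon> and h turns the spectral error 80 \<epsilon>^2 into
    1/(4h).\<close>
  have scale: "4 * h * a \<le> k - t" if "real a \<le> 80 * \<epsilon>\<^sup>2 * real (k - t)" for a
  proof -
    have "real (4 * h * a) \<le> 4 * real h * (80 * \<epsilon>\<^sup>2 * real (k - t))" using mult_left_mono[OF that, of "4 * real h"] by simp
    also have "\<dots> = 320 * real h * \<epsilon>\<^sup>2 * real (k - t)" by simp
    also have "\<dots> \<le> 1 * real (k - t)" using ep(4) by (intro mult_right_mono) auto
    finally show ?thesis by (simp only: mult_1_left of_nat_le_iff)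
  qed
  have TK: "4 * h * card (T - (K - Q)) \<le> card (K - Q)" "4 * h * card (K - Q - T) \<le> card (K - Q)"
    unfolding cK' using scale[OF rec(1)] scale[OF rec(2)] by (simp_all add: T_def)
  have Kc: "is_clique n E K"
    unfolding is_clique_def using K(1) adj_plant_inside[OF K(1), of _ _ E'] by (auto simp: E_def adj_def)
  obtain C where C: "is_max_clique n E C" using ex_max_clique by blast
  then have Cc: "is_clique n E C" "k \<le> card C" using Kc K(2) by (auto simp: is_max_clique_def)
  have Cn: "C \<subseteq> {..<n}" using Cc by (simp add: is_clique_def)
  have fC: "finite C" using Cn finite_subset by blast
  have CK: "card (C - K) < m"
  proof (rule ccontr)
    assume "\<not> ?thesis"
    then obtain C' where C': "C' \<subseteq> C - K" "card C' = m" using obtain_subset_with_card_n[of m "C - K"] by auto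
    have "e \<in> E'" if e: "e \<subseteq> C'" "card e = 2" for e
    proof -
      obtain u v where uv: "e = {u, v}" "u \<noteq> v" using e(2) by (auto simp: card_2_iff)
      then have "u \<in> C" "v \<in> C" "u \<notin> K" using e(1) C'(1) by auto
      then have "adj E u v" using Cc(1) uv(2) by (auto simp: is_clique_def adj_def)
      then have "adj E' u v" using \<open>u \<notin> K\<close> unfolding E_def by (simp add: adj_plant_outside)
      then show "e \<in> E'" using uv by (simp add: adj_def)
    qed
    moreover have "C' \<subseteq> {..<n}" using C'(1) Cn by auto
    ultimately show False using ok(3) C'(2) unfolding clique_ok_def by blast
  qed
  have "card (K - C) + card (K \<inter> C) = k" "card (C - K) + card (K \<inter> C) = card C"
    using card_Diff_subset_Int[of K C] card_Diff_subset_Int[of C K] fK fC K(2)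
      card_mono[OF fK, of "K \<inter> C"] card_mono[OF fC, of "K \<inter> C"] by (auto simp: Int_commute)
  then have KC: "card (K - C) \<le> m" using CK Cc(2) by linarith
  have "card (K - Q - C) \<le> card (K - C)" using fK by (intro card_mono) auto
  then have CF: "C \<subseteq> F" unfolding F_def
    using fK TK fT h KC cK' by (intro near_contains_clique[where K' = "K - Q" and m = m, OF fT TK h(1) _ Cc(1)]) auto
  have KF: "K \<subseteq> F" unfolding F_def
  proof (rule near_contains_clique[where K' = "K - Q" and m = 0, OF fT TK h(1) _ Kc])
    have "K - Q - K = {}" by auto
    from arg_cong[OF this, of card] show "card (K - Q - K) \<le> 0" by (simp only: card.empty)
  qed (use fK in auto)
  have Fn: "F \<subseteq> {..<n}" by (auto simp: F_def near_def)
  then have fF: "finite F" using finite_subset by blast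
  have FK: "card (F - K) < m"
  proof (rule ccontr)
    assume "\<not> ?thesis"
    then obtain D where D: "D \<subseteq> F - K" "card D = m" using obtain_subset_with_card_n[of m "F - K"] by auto
    have fD: "finite D" using D(1) fF finite_subset by blast
    have DK: "D \<inter> K = {}" using D(1) by auto
    have "h * k \<le> h * card {x \<in> K. adj E' v x} + 3 * k" if v: "v \<in> D" for v
    proof -
      have vF: "v \<in> near n E h T" "v \<notin> K" using v D(1) by (auto simp: F_def)
      have "h * card K \<le> h * card {x \<in> K. adj E v x} + 3 * card K"
        using near_neighbours[OF fT TK h(1) fK Q(1) _ vF] h(2) K(2) Q(2) by simp
      moreover have "{x \<in> K. adj E v x} = {x \<in> K. adj E' v x}"
        using vF(2) unfolding E_def by (simp add: adj_plant_outside)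
      ultimately show ?thesis using K(2) by simp
    qed
    then have "(\<Sum>v\<in>D. h * k) \<le> (\<Sum>v\<in>D. h * card {x \<in> K. adj E' v x} + 3 * k)" by (intro sum_mono)
    also have "\<dots> = h * card (star_pairs D K \<inter> E') + 3 * (m * k)"
      using D(2) by (simp add: sum.distrib sum_distrib_left card_star_pairs_Int[OF DK fD fK])
    finally have "h * (m * k) \<le> h * card (star_pairs D K \<inter> E') + 3 * (m * k)"
      using D(2) by (simp add: mult_ac)
    moreover have Dn: "D \<subseteq> {..<n}" using D(1) Fn by auto
    ultimately show False using ok(2)[unfolded sparse_ok_def, rule_format, OF Dn D(2) K DK] by linarith
  qed
  have "card F = card (F - K) + k" using KF K(2) fK card_mono[OF fF KF] by (simp add: card_Diff_subset)
  moreover have "card (F - C) = card F - card C" using CF fC by (simp add: card_Diff_subset)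
  ultimately have "card (F - C) \<le> m" using FK Cc(2) by linarith
  then obtain y where y: "y < 2 ^ m" "C \<subseteq> res n E y F" using res_branch[OF Cc(1) CF fF] by blast
  have "finite (res n E y F)" using finite_subset[OF res_subset fF] .
  then have "card C \<le> card (res n E y F)" using y(2) by (rule card_mono)
  with y(1) C g show ?thesis unfolding E_def[symmetric] F_def T_def by blast
qed

lemma fold_brstep_nonempty: "snd yF \<noteq> {} \<Longrightarrow> snd (fold (brstep E) ps yF) \<noteq> {}"
proof (induction ps arbitrary: yF)
  case (Cons x ps)
  have "snd (brstep E x yF) \<noteq> {}" using Cons.prems by (auto simp: brstep_def split: prod.splits)
  then show ?case using Cons.IH[of "brstep E x yF"] by simp
qed simp

text \<open>The growth hypothesis divides by w n, so it does not exclude w n = 0; then the input is the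
  planted clique together with isolated vertices.\<close>

lemma empty_recovery:
  assumes K: "K \<subseteq> {..<n}" and t: "0 < t" and n: "0 < n" and h: "2 \<le> h"
  shows "\<exists>g y C. (\<forall>i<t+3. g i < n) \<and> y < 1 \<and> is_max_clique n (plant n {} K) C
    \<and> card C \<le> card (res n (plant n {} K) y (near n (plant n {} K) h (candT n (plant n {} K) t g)))"
proof -
  define E where "E = plant n {} K"
  have fK: "finite K" using K finite_subset by blast
  have adjE: "adj E u v \<longleftrightarrow> u \<in> K \<and> v \<in> K \<and> u \<noteq> v" for u v
    using adj_plant_inside[OF K, of u v "{}"] adj_plant_outside[of u K n "{}" v] adj_plant_outside'[of v K n "{}" u]
    unfolding E_def by (auto simp: adj_def)
  have clq: "D \<subseteq> K \<or> card D \<le> 1" if "is_clique n E D" for D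
  proof (rule ccontr)
    assume a: "\<not> ?thesis"
    then obtain v where v: "v \<in> D" "v \<notin> K" by auto
    have "D = {v}"
    proof (rule ccontr)
      assume "D \<noteq> {v}"
      then obtain x where "x \<in> D" "x \<noteq> v" using v by auto
      then have "adj E v x" using that v by (auto simp: is_clique_def adj_def)
      then show False using v by (simp add: adjE)
    qed
    then show False using a by simp
  qed
  show ?thesis unfolding E_def[symmetric]
  proof (cases "card K \<le> 1")
    case True
    have noadj: "\<not> adj E u v" for u v using True fK adjE card_le_Suc0_iff_eq[OF fK] by auto
    \<comment> \<open>With at most one planted vertex there are no edges. T is then empty, every
      vertex is near it, and any vertex left over by the branching is a maximum clique.\<close>
    define g :: "nat \<Rightarrow> nat" where "g = (\<lambda>_. 0)"
    have "nbh n E t g = {}" using noadj t by (auto simp: nbh_def)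
    then have "near n E h (candT n E t g) = {..<n}" by (auto simp: near_def candT_def)
    moreover have "res n E 0 {..<n} \<noteq> {}" unfolding res_def using n by (intro fold_brstep_nonempty) auto
    moreover have "finite (res n E 0 {..<n})" by (rule finite_subset[OF res_subset]) simp
    ultimately have "1 \<le> card (res n E 0 (near n E h (candT n E t g)))" by (simp add: Suc_le_eq card_gt_0_iff)
    moreover have "card D \<le> 1" if "is_clique n E D" for D
      using clq[OF that] True card_mono[OF fK, of D] by auto
    then have "is_max_clique n E {0}" using n by (simp add: is_max_clique_def is_clique_def)
    ultimately show "\<exists>g y C. (\<forall>i<t+3. g i < n) \<and> y < 1 \<and> is_max_clique n E C \<and> card C \<le> card (res n E y (near n E h (candT n E t g)))"
      using n by (intro exI[of _ g] exI[of _ 0] exI[of _ "{0}"]) (simp add: g_def)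
  next
    case False
    then obtain a where a: "a \<in> K" by fastforce
    have "K \<noteq> {a}" using False by auto
    then obtain l where l: "l \<in> K" "l \<noteq> a" using a by auto
    \<comment> \<open>All t members of Q are guessed as the same vertex a, whose neighbourhood is
      the rest of K. Density and column are guessed as 0; any column works, since the threshold
      vertex l keeps T nonempty and T stays inside K.\<close>
    define g where "g i = (if i < t then a else if i < t + 2 then 0 else l)" for i
    have an: "a < n" "l < n" using a l K by auto
    have V: "nbh n E t g = K - {a}" using t K by (auto simp: nbh_def g_def adjE a)
    define T where "T = candT n E t g"
    have T: "T \<subseteq> K" "l \<in> T" using l by (auto simp: T_def candT_def V g_def)
    have fT: "finite T" using T fK finite_subset by blast
    have "v \<in> near n E h T \<longleftrightarrow> v \<in> K" for v
    proof (cases "v \<in> K")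
      case True
      then have e: "{x \<in> T. v \<noteq> x \<and> \<not> adj E v x} = {}" using T by (auto simp: adjE)
      show ?thesis unfolding near_def mem_Collect_eq e card.empty using True K by auto
    next
      case False
      then have "{x \<in> T. v \<noteq> x \<and> \<not> adj E v x} = T" using T by (auto simp: adjE)
      moreover have "0 < card T" using T fT by (auto simp: card_gt_0_iff)
      ultimately show ?thesis using False h by (simp add: near_def)
    qed
    then have F: "near n E h T = K" by blast
    have Kc: "is_clique n E K" using K adjE by (auto simp: is_clique_def adj_def)
    obtain y where y: "y < 2 ^ 0" "K \<subseteq> res n E y K" using res_branch[OF Kc order.refl fK, of 0] by auto
    then have "res n E y K = K" using res_subset by blast
    moreover have "is_max_clique n E K"
      unfolding is_max_clique_def
    proof (intro conjI allI impI Kc)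
      fix D assume "is_clique n E D"
      then show "card D \<le> card K" using clq[of D] False card_mono[OF fK, of D] by auto
    qed
    ultimately show "\<exists>g y C. (\<forall>i<t+3. g i < n) \<and> y < 1 \<and> is_max_clique n E C \<and> card C \<le> card (res n E y (near n E h (candT n E t g)))"
      using y(1) an n F unfolding T_def by (intro exI[of _ g] exI[of _ y] exI[of _ K]) (simp add: g_def)
  qed
qed

section \<open>Asymptotics\<close>

text \<open>L bounds the size of V outside the bad events: fewer than 8 n p^t + k ln n common
  neighbours lie outside K, and another k ln n makes room for K. It also outweighs the price of
  choosing K in the union bound. The relation 2 \<gamma> = 1 - c makes 1 - 3/h at least p +
  \<gamma>, so excluding dense pairs gives \<open>sparse_ok\<close>. Each of four bad events has
  probability at most 1/n.\<close>

lemma prob_bad_graph: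
  fixes n t k m h :: nat and p \<gamma> c :: real
  assumes p: "0 \<le> p" "p \<le> c" "c < 1" "0 < c" and n: "3 \<le> n" and t: "0 < t" "2 * t \<le> k"
    and h: "0 < h" "3 / h \<le> \<gamma>" and \<gamma>: "2 * \<gamma> = 1 - c"
    and m: "2 * ln n \<le> \<gamma>\<^sup>2 * m" "2 * ln n \<le> \<gamma>\<^sup>2 * k" "4 * ln n \<le> (real m - 1) * ln (1 / c)" "0 < m"
    and L: "L = 8 * real n * p ^ t + 2 * (k * ln n)"
  shows "measure_pmf.prob (gnp n p) {E. \<not> (norm_ok n E p t (k - t) (16 * sqrt L) \<and> sparse_ok n E h k m \<and> clique_ok n E m)} \<le> 4 / n"
proof -
  have p1: "p \<le> 1" using p by simp
  have n1: "1 \<le> ln n"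
  proof -
    have "exp 1 \<le> real n" using e_less_272 n by linarith
    then show ?thesis using n by (simp add: ln_ge_iff)
  qed
  have k1: "1 \<le> real k" using t by simp
  define x where "x = k * ln n"
  have kx: "real k \<le> x" unfolding x_def using mult_left_mono[OF n1, of "real k"] by simp
  have x0: "ln n \<le> x" unfolding x_def using mult_right_mono[OF k1, of "ln n"] n1 by simp
  have tx: "2 * (t * ln n) \<le> x" unfolding x_def using mult_right_mono[of "2 * real t" "real k" "ln n"] t n1
    by (simp add: of_nat_mult[symmetric] del: of_nat_mult)
  define y where "y = real n * p ^ t"
  have y0: "0 \<le> y" using p by (simp add: y_def)
  have Ly: "L = 8 * y + 2 * x" by (simp add: L x_def y_def)
  have L0: "0 < L" using y0 kx k1 by (simp add: Ly)
  have pow: "real n ^ i = exp (i * ln n)" for i using n by (simp add: exp_of_nat_mult)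
  have en: "exp (- x) \<le> 1 / n"
  proof -
    have "exp (- x) \<le> exp (- ln n)" using x0 by simp
    also have "\<dots> = 1 / n" using n by (simp add: exp_minus inverse_eq_divide)
    finally show ?thesis .
  qed
  let ?P = "measure_pmf.prob (gnp n p)"
  let ?S = "\<lambda>m. {D. D \<subseteq> {..<n} \<and> card D = m}"
  let ?A = "{E. \<exists>Q\<in>?S t. \<exists>B\<in>{B \<in> Pow ({..<n} - Q). 8 * y + x \<le> real (card B)}. star_pairs Q B \<subseteq> E}"
  let ?B = "{E. \<exists>Q\<in>?S t. \<exists>B\<in>{B \<in> Pow ({..<n} - Q). real (card B) + real (k - t) \<le> L}. \<exists>K\<in>?S (k - t).
      \<exists>z\<in>intvecs (B \<union> K) (4 * L). \<exists>z'\<in>intvecs (B \<union> K) (4 * L). K \<inter> Q = {} \<and> star_pairs Q B \<subseteq> E \<and>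
        16 * L * sqrt L \<le> ip (B \<union> K) (\<lambda>v. real_of_int (z v)) (mv (B \<union> K) (Wm E p) (\<lambda>v. real_of_int (z' v)))}"
  let ?C = "{E. \<exists>D\<in>?S m. \<exists>K\<in>?S k. D \<inter> K = {} \<and> (p + \<gamma>) * (real m * real k) \<le> card (star_pairs D K \<inter> E)}"
  let ?D = "{E. \<exists>C\<in>?S m. {e. e \<subseteq> C \<and> card e = 2} \<subseteq> E}"
  have A: "?P ?A \<le> 1 / n"
  proof -
    have "?P ?A \<le> real n ^ t * exp (8 * real n * p ^ t - 2 * (8 * y + x))" by (rule prob_large_nbh[OF p(1) p1])
    also have "\<dots> = exp (t * ln n + (8 * y - 2 * (8 * y + x)))" by (simp add: pow exp_add y_def)
    also have "\<dots> \<le> exp (- x)" using tx y0 kx k1 by simp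
    finally show ?thesis using en by linarith
  qed
  have B: "?P ?B \<le> 1 / n"
  proof -
    have "?P ?B \<le> real n ^ t * (exp (real n * p ^ t) * (real n ^ (k - t) * exp (- 4 * L)))"
      by (rule prob_norm[OF p(1) p1 L0])
    also have "\<dots> = exp (t * ln n + (y + (real (k - t) * ln n + - 4 * L)))" by (simp only: pow exp_add y_def)
    also have "\<dots> \<le> exp (- x)"
    proof -
      have "real (k - t) * ln n \<le> x" unfolding x_def using n1 by (intro mult_right_mono) auto
      then show ?thesis using tx y0 kx k1 by (simp add: Ly)
    qed
    finally show ?thesis using en by linarith
  qed
  have \<gamma>0: "0 < \<gamma>" using \<gamma> p by simp
  have C: "?P ?C \<le> 1 / n"
  proof -
    have "?P ?C \<le> real n ^ m * (real n ^ k * exp (- 2 * \<gamma>\<^sup>2 * (real m * real k)))"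
      by (rule prob_dense_pair[OF p(1) p1]) (use \<gamma>0 in simp)
    also have "\<dots> = exp (m * ln n + (x + - 2 * \<gamma>\<^sup>2 * (real m * real k)))" by (simp only: pow exp_add x_def)
    also have "\<dots> \<le> exp (- x)"
    proof -
      have "k * (2 * ln n) \<le> k * (\<gamma>\<^sup>2 * m)" using m(1) by (intro mult_left_mono) auto
      moreover have "m * (2 * ln n) \<le> m * (\<gamma>\<^sup>2 * k)" using m(2) by (intro mult_left_mono) auto
      ultimately have "2 * x \<le> \<gamma>\<^sup>2 * (real m * real k)" "2 * (m * ln n) \<le> \<gamma>\<^sup>2 * (real m * real k)"
        by (simp_all add: x_def mult_ac)
      moreover have "- 2 * \<gamma>\<^sup>2 * (real m * real k) = - 2 * (\<gamma>\<^sup>2 * (real m * real k))" by simp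
      ultimately have "m * ln n + (x + - 2 * \<gamma>\<^sup>2 * (real m * real k)) \<le> - x" using kx k1 by linarith
      then show ?thesis by (simp only: exp_le_cancel_iff)
    qed
    finally show ?thesis using en by linarith
  qed
  have D: "?P ?D \<le> 1 / n"
  proof -
    have "?P ?D \<le> real n ^ m * p ^ (m choose 2)" by (rule prob_clique[OF p(1) p1])
    also have "\<dots> \<le> real n ^ m * c ^ (m choose 2)" using p by (intro mult_left_mono power_mono) auto
    also have "\<dots> = exp (m * ln n + real (m choose 2) * ln c)" using p(4) by (simp add: pow exp_add exp_of_nat_mult)
    also have "\<dots> \<le> exp (- ln n)"
    proof -
      have "real (m choose 2) = real m * (real m - 1) / 2" using m(4)
        by (simp add: choose_two real_of_nat_div of_nat_diff)
      then have "real (m choose 2) * ln c = - (real m / 2) * ((real m - 1) * ln (1 / c))" using p(4) by (simp add: ln_div)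
      also have "\<dots> \<le> - (real m / 2) * (4 * ln n)" using m(3) by (intro mult_left_mono_neg) auto
      finally have "m * ln n + real (m choose 2) * ln c \<le> - (m * ln n)" by simp
      moreover have "1 * ln n \<le> m * ln n" using m(4) n1 by (intro mult_right_mono) auto
      ultimately show ?thesis by simp
    qed
    also have "\<dots> = 1 / n" using n by (simp add: exp_minus inverse_eq_divide)
    finally show ?thesis .
  qed
  have "{E. \<not> (norm_ok n E p t (k - t) (16 * sqrt L) \<and> sparse_ok n E h k m \<and> clique_ok n E m)} \<subseteq> (?A \<union> ?B) \<union> (?C \<union> ?D)"
  proof
    fix E assume E: "E \<in> {E. \<not> (norm_ok n E p t (k - t) (16 * sqrt L) \<and> sparse_ok n E h k m \<and> clique_ok n E m)}"
    show "E \<in> (?A \<union> ?B) \<union> (?C \<union> ?D)"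
    proof (rule ccontr)
      assume nE: "E \<notin> (?A \<union> ?B) \<union> (?C \<union> ?D)"
      have "clique_ok n E m" using nE unfolding clique_ok_def by blast
      moreover have "sparse_ok n E h k m"
        unfolding sparse_ok_def
      proof (intro allI impI)
        fix D K assume DK: "D \<subseteq> {..<n}" "card D = m" "K \<subseteq> {..<n}" "card K = k" "D \<inter> K = {}"
        have "\<not> (p + \<gamma>) * (real m * real k) \<le> card (star_pairs D K \<inter> E)" using nE DK by blast
        moreover have "(1 - 3 / h) * (real m * real k) \<ge> (p + \<gamma>) * (real m * real k)"
          using h(2) \<gamma> p by (intro mult_right_mono) auto
        ultimately have "card (star_pairs D K \<inter> E) < (1 - 3 / h) * (real m * real k)" by linarith
        then have "real h * card (star_pairs D K \<inter> E) < real h * ((1 - 3 / h) * (real m * real k))"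
          using h(1) by (intro mult_strict_left_mono) auto
        also have "\<dots> = real h * (real m * real k) - 3 * (real m * real k)" using h(1) by (simp add: field_simps)
        finally have "real (h * card (star_pairs D K \<inter> E) + 3 * (m * k)) < real (h * (m * k))" by simp
        then show "h * card (star_pairs D K \<inter> E) + 3 * (m * k) < h * (m * k)" by (simp only: of_nat_less_iff)
      qed
      moreover have "norm_ok n E p t (k - t) (16 * sqrt L)"
        unfolding norm_ok_def
      proof (intro allI impI)
        fix Q B K x' y'
        assume Q: "Q \<subseteq> {..<n}" "card Q = t" and B: "B \<subseteq> {..<n} - Q" "star_pairs Q B \<subseteq> E"
          and K: "K \<subseteq> {..<n}" "card K = k - t" "K \<inter> Q = {}"
        have "\<not> 8 * y + x \<le> real (card B)" using nE Q B by blast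
        \<comment> \<open>Excluding the first event bounds B; since k is at most k ln n, the
          remaining planted vertices still fit into L, which makes the second event
          applicable.\<close>
        then have cB: "real (card B) + real (k - t) \<le> L" using kx by (simp add: Ly)
        have fin: "finite (B \<union> K)" using B K finite_subset[of B "{..<n}"] finite_subset[of K "{..<n}"] by auto
        have cV: "real (card (B \<union> K)) \<le> L" using card_Un_le[of B K] cB K(2) by linarith
        have "ip (B \<union> K) (\<lambda>v. real_of_int (z v)) (mv (B \<union> K) (Wm E p) (\<lambda>v. real_of_int (z' v))) \<le> 16 * L * sqrt L"
          if "z \<in> intvecs (B \<union> K) (4 * L)" "z' \<in> intvecs (B \<union> K) (4 * L)" for z z'
        proof (rule ccontr)
          assume "\<not> ?thesis"
          then have "16 * L * sqrt L \<le> ip (B \<union> K) (\<lambda>v. real_of_int (z v)) (mv (B \<union> K) (Wm E p) (\<lambda>v. real_of_int (z' v)))" by simp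
          note F = this
          have Qm: "Q \<in> ?S t" and Bm: "B \<in> {B \<in> Pow ({..<n} - Q). real (card B) + real (k - t) \<le> L}" and Km: "K \<in> ?S (k - t)"
            using Q B(1) cB K(1,2) by auto
          have "E \<in> ?B"
            by (intro CollectI bexI[OF _ Qm] bexI[OF _ Bm] bexI[OF _ Km] bexI[OF _ that(1)] bexI[OF _ that(2)] conjI K(3) B(2) F)
          then show False using nE by blast
        qed
        then have "ip (B \<union> K) x' (mv (B \<union> K) (Wm E p) y') \<le> 16 * L * sqrt L / L * sqrt (sq (B \<union> K) x') * sqrt (sq (B \<union> K) y')"
          by (intro norm_from_lattice[OF fin cV L0]) (auto simp: Wm_def insert_commute)
        then show "ip (B \<union> K) x' (mv (B \<union> K) (Wm E p) y') \<le> 16 * sqrt L * sqrt (sq (B \<union> K) x') * sqrt (sq (B \<union> K) y')"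
          using L0 by simp
      qed
      ultimately show False using E by blast
    qed
  qed
  then have "?P {E. \<not> (norm_ok n E p t (k - t) (16 * sqrt L) \<and> sparse_ok n E h k m \<and> clique_ok n E m)}
      \<le> ?P ((?A \<union> ?B) \<union> (?C \<union> ?D))"
    by (intro measure_pmf.finite_measure_mono) auto
  also have "\<dots> \<le> ?P (?A \<union> ?B) + ?P (?C \<union> ?D)" by (intro measure_Un_le) auto
  also have "\<dots> \<le> (?P ?A + ?P ?B) + (?P ?C + ?P ?D)"
    by (intro add_mono measure_Un_le) auto
  also have "\<dots> \<le> (1 / n + 1 / n) + (1 / n + 1 / n)" by (intro add_mono A B C D)
  finally show ?thesis by simp
qed

section \<open>Reduction to G(n,p) and the sizes of the parameters\<close>

lemma prob_AG:
  "measure_pmf.prob (AG n p S) {G. P G} = measure_pmf.prob (gnp n p) {E. P (plant n E (S E))}"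
  by (simp add: AG_def plant_def vimage_def)

lemma gnp_0: "set_pmf (gnp n 0) = {{}}"
proof -
  have "b e = False" if "b \<in> set_pmf (Pi_pmf (all_pairs n) False (\<lambda>_. bernoulli_pmf 0))" "e \<in> all_pairs n" for b e
  proof -
    have "b e \<in> set_pmf (bernoulli_pmf 0)"
      using that unfolding set_Pi_pmf[OF finite_all_pairs] PiE_dflt_def by auto
    then show ?thesis by (cases "b e") (auto simp: set_pmf_iff)
  qed
  then have e: "{e \<in> all_pairs n. b e} = {}" if "b \<in> set_pmf (Pi_pmf (all_pairs n) False (\<lambda>_. bernoulli_pmf 0))" for b
    using that by auto
  have "G = {}" if "G \<in> set_pmf (gnp n 0)" for G
    using that e unfolding gnp_def set_map_pmf by (elim imageE) simp
  then have "set_pmf (gnp n 0) \<subseteq> {{}}" by blast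
  then show ?thesis using subset_singletonD[of "set_pmf (gnp n 0)" "{}"] set_pmf_not_empty[of "gnp n 0"] by metis
qed

lemma max_clique_if_card_le:
  assumes "is_clique n E R" "is_max_clique n E C" "card C \<le> card R"
  shows "is_max_clique n E R"
  using assms by (auto simp: is_max_clique_def intro: order.trans)

text \<open>Eventually w exceeds n^(2/3), unless it is 0, where the quotient is 0 by convention. The
  factor 1/(1-p) is at least 1, so k is at least 5 sqrt w and exceeds 5 n^(1/3), which dominates ln
  n and all constants.\<close>

lemma eventually_sizes:
  fixes a b :: real and w :: "nat \<Rightarrow> real" and k :: "nat \<Rightarrow> nat"
  assumes w: "(\<lambda>n. real n powr (2/3) / w n) \<longlonglongrightarrow> 0" "\<And>n. 0 \<le> w n \<and> w n \<le> c * real n" and c: "0 < c" "c < 1"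
    and k: "\<forall>\<^sub>F n in sequentially. real (k n) \<ge> 5 / (1 - w n / real n) * sqrt (w n)"
    and a: "0 < a"
  shows "\<forall>\<^sub>F n in sequentially. w n = 0 \<or> (25 * w n \<le> (real (k n))\<^sup>2 \<and> b + ln n \<le> a * real (k n))"
proof -
  have "\<forall>\<^sub>F n in sequentially. real n powr (2/3) / w n < 1"
    using order_tendstoD(2)[OF w(1), of 1] by simp
  moreover have "(\<lambda>n. ln (real n) / real n powr (1/3)) \<longlonglongrightarrow> 0" by (rule lim_ln_over_power) simp
  then have "\<forall>\<^sub>F n in sequentially. ln (real n) / real n powr (1/3) < a" using a by (rule order_tendstoD(2))
  moreover define X where "X = max 1 (b / a)"
  have "\<forall>\<^sub>F n in sequentially. nat \<lceil>X ^ 3\<rceil> \<le> n" by (rule eventually_ge_at_top)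
  then have "\<forall>\<^sub>F n in sequentially. b / a \<le> real n powr (1/3)"
  proof eventually_elim
    case (elim n)
    have "(X ^ 3) powr (1/3) \<le> real n powr (1/3)" using elim by (intro powr_mono2) (auto simp: X_def)
    moreover have "(X ^ 3) powr (1/3) = X" by (simp add: X_def powr_powr flip: powr_numeral)
    ultimately show ?case by (simp add: X_def)
  qed
  ultimately show ?thesis using k eventually_gt_at_top[of "0::nat"]
  proof eventually_elim
    case (elim n)
    show ?case
    proof (cases "w n = 0")
      case False
      then have w0: "0 < w n" using w(2)[of n] by simp
      have "c * real n < 1 * real n" using c elim(5) by (intro mult_strict_right_mono) auto
      then have "w n < real n" using w(2)[of n] by linarith
      then have p: "0 \<le> w n / real n" "w n / real n < 1" using w0 elim(5) by auto
      have "5 * sqrt (w n) \<le> 5 / (1 - w n / real n) * sqrt (w n)"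
        using p w0 by (intro mult_right_mono) (auto simp: field_simps)
      then have ks: "5 * sqrt (w n) \<le> real (k n)" using elim(4) by linarith
      then have "(5 * sqrt (w n))\<^sup>2 \<le> (real (k n))\<^sup>2" using w0 by (intro power_mono) auto
      then have 1: "25 * w n \<le> (real (k n))\<^sup>2" using w0 by (simp add: power_mult_distrib)
      define z where "z = real n powr (1/3)"
      have z: "0 < z" "z\<^sup>2 = real n powr (2/3)"
        using elim(5) by (auto simp: z_def powr_powr[symmetric] power2_eq_square powr_add[symmetric])
      have "z\<^sup>2 < w n" using elim(1) w0 z by (simp add: field_simps)
      then have "z < sqrt (w n)" by (rule real_less_rsqrt)
      then have kz: "5 * z < real (k n)" using ks by simp
      have "ln (real n) < a * z" "b \<le> a * z"
        using elim(2,3) z a by (auto simp: z_def[symmetric] field_simps)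
      moreover have "a * (5 * z) \<le> a * real (k n)" using kz a by (intro mult_left_mono) auto
      moreover have "0 < a * z" using a z by simp
      ultimately have "b + ln n \<le> a * real (k n)" by simp
      with 1 show ?thesis by simp
    qed simp
  qed
qed

text \<open>Here t takes effect: n p^t is n p times p^(t-1), hence at most k^2 / 25 times s^2. As ln
  n is at most s^2 k / 4, the radicand is at most (s k)^2. The factor 1/128 in s makes 64 s k equal
  to \<epsilon> (1 - c) k / 2, a lower bound for \<epsilon> times the signal.\<close>

lemma noise_below_signal:
  fixes n t k j :: nat and p c \<epsilon> s :: real
  assumes n: "3 \<le> n" and c: "0 < c" "c < 1" and p: "0 \<le> p" "p \<le> c" and j: "real j / real n \<le> p"
    and k: "25 * (real n * p) \<le> (real k)\<^sup>2" "2 * t \<le> k" and \<epsilon>: "0 < \<epsilon>"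
    and s: "s = \<epsilon> * (1 - c) / 128" "c ^ (t - 1) \<le> s\<^sup>2" "0 < t" "4 * ln n \<le> s\<^sup>2 * k" "1 \<le> 16 * s * k"
  shows "2 * (16 * sqrt (8 * real n * p ^ t + 2 * (k * ln n))) + 2 \<le> \<epsilon> * ((1 - real j / real n) * real (k - t))"
proof -
  have s0: "0 < s" unfolding s(1) using \<epsilon> c by (intro divide_pos_pos mult_pos_pos) auto
  have "p ^ t = p * p ^ (t - 1)" using s(3) by (cases t) auto
  then have "real n * p ^ t = (real n * p) * p ^ (t - 1)" by simp
  also have "\<dots> \<le> ((real k)\<^sup>2 / 25) * s\<^sup>2"
  proof (intro mult_mono)
    have "p ^ (t - 1) \<le> c ^ (t - 1)" using p by (intro power_mono)
    then show "p ^ (t - 1) \<le> s\<^sup>2" using s(2) by linarith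
  qed (use k p in auto)
  finally have 1: "8 * real n * p ^ t \<le> 8 / 25 * (s\<^sup>2 * (real k)\<^sup>2)" by (simp add: mult_ac)
  have "k * (4 * ln n) \<le> k * (s\<^sup>2 * k)" using s(4) by (intro mult_left_mono) auto
  then have 2: "2 * (k * ln n) \<le> 1 / 2 * (s\<^sup>2 * (real k)\<^sup>2)" by (simp add: power2_eq_square mult_ac)
  have "0 \<le> s\<^sup>2 * (real k)\<^sup>2" by simp
  then have "8 * real n * p ^ t + 2 * (k * ln n) \<le> s\<^sup>2 * (real k)\<^sup>2" using 1 2 by linarith
  then have "8 * real n * p ^ t + 2 * (k * ln n) \<le> (s * k)\<^sup>2" by (simp add: power_mult_distrib)
  then have "sqrt (8 * real n * p ^ t + 2 * (k * ln n)) \<le> s * k" using s0 by (intro real_le_lsqrt) auto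
  then have "2 * (16 * sqrt (8 * real n * p ^ t + 2 * (k * ln n))) + 2 \<le> 64 * (s * k)" using s(5) by simp
  also have "\<dots> = \<epsilon> * ((1 - c) * (k / 2))" by (simp add: s(1))
  also have "\<dots> \<le> \<epsilon> * ((1 - real j / real n) * real (k - t))"
    using \<epsilon> j p c k(2) by (intro mult_left_mono mult_mono) auto
  finally show ?thesis .
qed

lemma two_power_le:
  fixes A :: real
  assumes "0 \<le> A" "2 \<le> n" "real m \<le> A * ln n + 2" "A + 2 \<le> real a"
  shows "(2::nat) ^ m \<le> n ^ a"
proof -
  have l: "ln 2 \<le> ln (real n)" "0 \<le> ln (real n)" "ln 2 \<le> (1::real)" "0 < ln (2::real)" using assms(2) ln_2_less_1 by auto
  have Al: "0 \<le> A * ln n" using assms(1) l(2) by (rule mult_nonneg_nonneg)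
  have "real m * ln 2 \<le> (A * ln n + 2) * ln 2" using assms(3) l by (intro mult_right_mono) auto
  also have "\<dots> = (A * ln n) * ln 2 + 2 * ln 2" by (simp add: algebra_simps)
  also have "\<dots> \<le> (A * ln n) * 1 + 2 * ln n" using l Al by (intro add_mono mult_left_mono) auto
  also have "\<dots> = (A + 2) * ln n" by (simp add: algebra_simps)
  also have "\<dots> \<le> a * ln n" using assms(4) l(2) by (rule mult_right_mono)
  finally have "exp (m * ln 2) \<le> exp (a * ln n)" by simp
  then have "(2::real) ^ m \<le> real n ^ a" using assms(2) by (simp add: exp_of_nat_mult)
  then have "real (2 ^ m) \<le> real (n ^ a)" by simp
  then show ?thesis by (simp only: of_nat_le_iff)
qed

theorem theoremB2:
  fixes c :: real and w :: "nat \<Rightarrow> real" and k :: "nat \<Rightarrow> nat"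
  assumes c: "0 < c" "c < 1"
    and w_growth: "(\<lambda>n. real n powr (2/3) / w n) \<longlonglongrightarrow> 0"
    and w_bounds: "\<And>n. 0 \<le> w n \<and> w n \<le> c * real n"
    and k_le_n: "\<And>n. k n \<le> n"
    and k_lower: "\<forall>\<^sub>F n in sequentially.
                    real (k n) \<ge> 5 / (1 - w n / real n) * sqrt (w n)"
  shows "\<exists>(P :: instr list) (C :: nat) (d :: nat).
           (\<forall>n E. E \<subseteq> all_pairs n \<longrightarrow> ram_halts_within P (C * (n + 1) ^ d) n E) \<and>
           (\<forall>S :: nat \<Rightarrow> nat set set \<Rightarrow> nat set.
              (\<forall>n. valid_strategy n (k n) (S n)) \<longrightarrow>
              (\<lambda>n. measure_pmf.prob (AG n (w n / real n) (S n))
                     {G. is_max_clique n G (ram_output P (C * (n + 1) ^ d) n G)})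
                \<longlonglongrightarrow> 1)"
proof -
  define \<gamma> where "\<gamma> = (1 - c) / 2"
  \<comment> \<open>The near set tolerates a fraction 1/h of missing edges; three such losses add
    up, and 3/h must not exceed \<gamma>.\<close>
  define h where "h = nat \<lceil>6 / (1 - c)\<rceil>"
  \<comment> \<open>With this value 320 h \<epsilon>^2 equals \<epsilon>, which is below 1.\<close>
  define \<epsilon> where "\<epsilon> = 1 / (320 * real h)"
  define s where "s = \<epsilon> * (1 - c) / 128"
  have \<gamma>: "0 < \<gamma>" "2 * \<gamma> = 1 - c" using c by (auto simp: \<gamma>_def)
  have h6: "6 / (1 - c) \<le> real h" unfolding h_def by linarith
  have "6 \<le> 6 / (1 - c)" using c by (simp add: field_simps)
  then have h: "6 \<le> h" "0 < real h" using h6 by linarith+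
  have h3: "3 / real h \<le> \<gamma>" using h6 h c by (simp add: \<gamma>_def field_simps)
  have ep: "0 < \<epsilon>" "\<epsilon> \<le> 1 / 10" "320 * real h * \<epsilon>\<^sup>2 \<le> 1"
  proof -
    show e0: "0 < \<epsilon>" using h by (simp add: \<epsilon>_def)
    show e1: "\<epsilon> \<le> 1 / 10" using h by (simp add: \<epsilon>_def field_simps)
    have "320 * real h * \<epsilon>\<^sup>2 = \<epsilon>" using h by (simp add: \<epsilon>_def power2_eq_square)
    then show "320 * real h * \<epsilon>\<^sup>2 \<le> 1" using e1 by simp
  qed
  have s0: "0 < s" using ep c by (simp add: s_def)
  obtain N where "c ^ N < s\<^sup>2" using real_arch_pow_inv[of "s\<^sup>2" c] s0 c by auto
  define t where "t = Suc N"
  have t: "0 < t" "c ^ (t - 1) \<le> s\<^sup>2" using \<open>c ^ N < s\<^sup>2\<close> by (auto simp: t_def)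
  have lc: "0 < ln (1 / c)" using c by simp
  \<comment> \<open>The size m is about A ln n: the first summand makes dense pairs with m vertices
    on one side unlikely, the second makes cliques of size m unlikely.\<close>
  define A where "A = 2 / \<gamma>\<^sup>2 + 4 / ln (1 / c)"
  have A: "0 < A" "2 / \<gamma>\<^sup>2 \<le> A" "4 / ln (1 / c) \<le> A" using \<gamma> lc by (auto simp: A_def add_pos_pos)
  define a where "a = nat \<lceil>A\<rceil> + 2"
  have a: "1 \<le> a" "A + 2 \<le> real a" unfolding a_def by (simp, linarith)
  obtain C d where halts: "\<And>n E. ram_halts_within (clique_prog t h a) (C * (n + 1) ^ d) n E"
    and out: "\<And>n E. 55 + 2 * t \<le> n \<Longrightarrow> is_clique n E (ram_output (clique_prog t h a) (C * (n + 1) ^ d) n E)"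
    "\<And>n E g y. 55 + 2 * t \<le> n \<Longrightarrow> \<forall>i<t+3. g i < n \<Longrightarrow> y < n ^ a \<Longrightarrow>
       card (res n E y (near n E h (candT n E t g))) \<le> card (ram_output (clique_prog t h a) (C * (n + 1) ^ d) n E)"
    using clique_prog[OF a(1), of t h] by blast
  define R where "R n E = ram_output (clique_prog t h a) (C * (n + 1) ^ d) n E" for n E
  define m where "m n = nat \<lceil>A * ln (real n)\<rceil> + 1" for n :: nat
  \<comment> \<open>One constant for four demands on k: the dense pairs, the noise, the size m, and
    the constants collected in b.\<close>
  define \<alpha> where "\<alpha> = min (min (\<gamma>\<^sup>2 / 2) (s\<^sup>2 / 4)) (min (1 / (4 * real h * A)) 1)"
  have al: "0 < \<alpha>" "\<alpha> \<le> \<gamma>\<^sup>2 / 2" "\<alpha> \<le> s\<^sup>2 / 4" "\<alpha> \<le> 1 / (4 * real h * A)" "\<alpha> \<le> 1"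
    using \<gamma> s0 h A by (auto simp: \<alpha>_def)
  define b where "b = 1 / (16 * s) + real (h * t) + 2 * real (4 * h + t) + 1"
  have b0: "0 \<le> b" using s0 by (simp add: b_def)
  have lim0: "(\<lambda>n. real n * ((2 * \<epsilon>)\<^sup>2) ^ n) \<longlonglongrightarrow> 0"
  proof (rule powser_times_n_limit_0)
    have "(2 * \<epsilon>)\<^sup>2 \<le> (1/5)\<^sup>2" using ep by (intro power_mono) auto
    then show "norm ((2 * \<epsilon>)\<^sup>2) < 1" by (simp add: power2_eq_square)
  qed
  have ev1: "\<forall>\<^sub>F n in sequentially. real n * ((2 * \<epsilon>)\<^sup>2) ^ n < \<epsilon>\<^sup>2"
    using ep by (intro order_tendstoD(2)[OF lim0]) simp
  note ev2 = eventually_sizes[OF w_growth w_bounds c k_lower al(1), of b]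
  \<comment> \<open>The bound holds for all valid strategies at once, from a threshold on n that
    does not depend on the strategy.\<close>
  have main: "\<forall>\<^sub>F n in sequentially. \<forall>S. valid_strategy n (k n) S \<longrightarrow>
      1 - 4 / real n \<le> measure_pmf.prob (AG n (w n / real n) S) {G. is_max_clique n G (R n G)}"
    using ev1 ev2 eventually_ge_at_top[of "55 + 2 * t"]
  proof eventually_elim
    case (elim n)
    show ?case
    proof (intro allI impI)
      fix S assume S: "valid_strategy n (k n) S"
      have SK: "S E \<subseteq> {..<n}" "card (S E) = k n" for E using S by (auto simp: valid_strategy_def)
      have n3: "3 \<le> n" using elim(3) by simp
      have max: "is_max_clique n E (R n E)"
        if "\<forall>i<t+3. g i < n" "y < n ^ a" "is_max_clique n E D" "card D \<le> card (res n E y (near n E h (candT n E t g)))"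
        for E g y D
        unfolding R_def using out(1)[OF elim(3)] that(3)
        by (rule max_clique_if_card_le) (use that(4) out(2)[OF elim(3) that(1,2), of E] in linarith)
      show "1 - 4 / real n \<le> measure_pmf.prob (AG n (w n / real n) S) {G. is_max_clique n G (R n G)}"
      proof (cases "w n = 0")
        case True
        have "is_max_clique n (plant n {} (S {})) (R n (plant n {} (S {})))"
        proof -
          have nh: "0 < n" "2 \<le> h" using n3 h by auto
          obtain g y D where gy: "\<forall>i<t+3. g i < n" "y < 1" "is_max_clique n (plant n {} (S {})) D"
            "card D \<le> card (res n (plant n {} (S {})) y (near n (plant n {} (S {})) h (candT n (plant n {} (S {})) t g)))"
            using empty_recovery[OF SK(1)[of "{}"] t(1) nh] by blast
          have "1 \<le> n ^ a" using n3 by simp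
          then have "y < n ^ a" using gy(2) by linarith
          from max[OF gy(1) this gy(3,4)] show ?thesis .
        qed
        then have "measure_pmf.prob (gnp n 0) {E. is_max_clique n (plant n E (S E)) (R n (plant n E (S E)))} = 1"
          by (intro measure_pmf.prob_eq_1[THEN iffD2]) (auto simp: AE_measure_pmf_iff gnp_0)
        then show ?thesis using True by (simp add: prob_AG)
      next
        case False
        define p where "p = w n / real n"
        define K where "K = k n"
        \<comment> \<open>Rounding p down to a multiple of 1/n keeps j/n at most p, hence 1 - j/n at
          least 1 - c.\<close>
        define j where "j = nat \<lfloor>w n\<rfloor>"
        have szs: "25 * w n \<le> (real K)\<^sup>2" "b + ln n \<le> \<alpha> * real K" using elim(2) False by (auto simp: K_def)
        have p: "0 \<le> p" "p \<le> c" using w_bounds[of n] n3 by (auto simp: p_def field_simps)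
        have np: "real n * p = w n" using n3 by (simp add: p_def)
        have ln1: "0 \<le> ln (real n)" using n3 by simp
        have ak: "\<alpha> * K \<le> x * K" if "\<alpha> \<le> x" for x using that by (intro mult_right_mono) auto
        note ak = ak[OF al(5)] ak[OF al(2)] ak[OF al(3)] ak[OF al(4)]
        have bK: "b \<le> K" using szs(2) ln1 ak(1) by linarith
        have pos: "0 \<le> 1 / (16 * s)" "0 \<le> real (h * t)" "0 \<le> real (4 * h + t)" using s0 by auto
        have K1: "1 / (16 * s) \<le> K" "real (h * t) \<le> K" "2 * real (4 * h + t) + 1 \<le> K"
          using bK pos unfolding b_def by linarith+
        have htK: "h * t \<le> K" using K1(2) by (simp only: of_nat_le_iff)
        have "real (2 * (4 * h + t) + 1) \<le> real K" using K1(3) by simp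
        then have tK: "2 * (4 * h + t) + 1 \<le> K" by (simp only: of_nat_le_iff)
        have lnK: "2 * ln n \<le> \<gamma>\<^sup>2 * K" "4 * ln n \<le> s\<^sup>2 * K" using szs(2) b0 ak(2,3) by auto
        have sK: "1 \<le> 16 * s * K" using K1(1) s0 by (simp add: field_simps)
        have "0 \<le> A * ln n" using A ln1 by simp
        then have mA: "A * ln n \<le> real (m n) - 1" "real (m n) \<le> A * ln n + 2" unfolding m_def by linarith+
        have m1: "2 * ln n \<le> \<gamma>\<^sup>2 * m n"
        proof -
          have "2 / \<gamma>\<^sup>2 * ln n \<le> m n" using mA(1) mult_right_mono[OF A(2) ln1] by linarith
          then show ?thesis using \<gamma> by (simp add: field_simps)
        qed
        have m2: "4 * ln n \<le> (real (m n) - 1) * ln (1 / c)"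
        proof -
          have "4 / ln (1 / c) * ln n \<le> real (m n) - 1" using mA(1) mult_right_mono[OF A(3) ln1] by linarith
          then show ?thesis using lc by (simp add: field_simps)
        qed
        have m3: "2 * h * m n \<le> K - t"
        proof -
          have "ln n \<le> 1 / (4 * real h * A) * K" using szs(2) b0 ak(4) by linarith
          then have "4 * real h * (A * ln n) \<le> K" using h A by (simp add: field_simps)
          moreover have "2 * real h * m n \<le> 2 * real h * (A * ln n + 2)" using mA(2) by (intro mult_left_mono) auto
          ultimately have "2 * (2 * real h * m n) \<le> K + 8 * h" by (simp add: distrib_left)
          moreover have "2 * (real (4 * h + t)) + 1 \<le> K" by (rule K1(3))
          ultimately have "real (2 * h * m n + t) \<le> real K" by simp
          then show ?thesis by (simp only: of_nat_le_iff)
        qed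
        have j: "real j \<le> w n" "w n < real j + 1" using w_bounds[of n] unfolding j_def by linarith+
        have jn: "j < n"
        proof -
          have "c * real n < 1 * real n" using c n3 by (intro mult_strict_right_mono) auto
          then have "real j < real n" using j(1) w_bounds[of n] by linarith
          then show ?thesis by simp
        qed
        have jp: "real j / real n \<le> p" "\<bar>p - real j / real n\<bar> \<le> 1 / real n"
        proof -
          show 1: "real j / real n \<le> p" using j(1) n3 by (simp add: p_def divide_right_mono)
          have "p - real j / real n = (w n - real j) / real n" by (simp add: p_def diff_divide_distrib)
          also have "\<dots> \<le> 1 / real n" using j(2) by (intro divide_right_mono) auto
          finally show "\<bar>p - real j / real n\<bar> \<le> 1 / real n" using 1 by simp
        qed
        define L where "L = 8 * real n * p ^ t + 2 * (K * ln n)"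
        have L0: "0 \<le> L" using p ln1 by (simp add: L_def)
        have noise: "2 * (16 * sqrt L) + 2 \<le> \<epsilon> * ((1 - real j / real n) * real (K - t))"
          unfolding L_def
          by (rule noise_below_signal[OF n3 c p jp(1) _ _ ep(1) s_def t(2,1) lnK(2) sK]) (use szs(1) np tK in auto)
        have conv: "real n * (2 * \<epsilon>) ^ (2 * n) \<le> \<epsilon>\<^sup>2" using elim(1) by (simp add: power_mult)
        have "1 - 4 / real n \<le> 1 - measure_pmf.prob (gnp n p) {E. \<not> (norm_ok n E p t (K - t) (16 * sqrt L) \<and> sparse_ok n E h K (m n) \<and> clique_ok n E (m n))}"
        proof -
          have "measure_pmf.prob (gnp n p) {E. \<not> (norm_ok n E p t (K - t) (16 * sqrt L) \<and> sparse_ok n E h K (m n) \<and> clique_ok n E (m n))} \<le> 4 / real n"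
            by (rule prob_bad_graph[OF p c(2,1) n3 t(1) _ _ h3 \<gamma>(2) m1 lnK(1) m2 _ L_def])
              (use tK h in \<open>auto simp: m_def\<close>)
          then show ?thesis by linarith
        qed
        also have "\<dots> = measure_pmf.prob (gnp n p) {E. norm_ok n E p t (K - t) (16 * sqrt L) \<and> sparse_ok n E h K (m n) \<and> clique_ok n E (m n)}"
          by (subst measure_pmf.prob_compl[symmetric]) (auto intro!: arg_cong[where f = "measure_pmf.prob (gnp n p)"])
        also have "\<dots> \<le> measure_pmf.prob (gnp n p) {E. is_max_clique n (plant n E (S E)) (R n (plant n E (S E)))}"
        proof (rule measure_pmf.finite_measure_mono, rule subsetI)
          fix E assume "E \<in> {E. norm_ok n E p t (K - t) (16 * sqrt L) \<and> sparse_ok n E h K (m n) \<and> clique_ok n E (m n)}"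
          then have ok: "norm_ok n E p t (K - t) (16 * sqrt L)" "sparse_ok n E h K (m n)" "clique_ok n E (m n)" by auto
          have tlt: "t < K" "0 < h" using tK h by auto
          have p1: "p \<le> 1" using p c by linarith
          have "0 \<le> 16 * sqrt L" using L0 by simp
          from planted_recovery[OF SK[folded K_def] t(1) tlt(1) p(1) p1 jn jp(2) this noise ep(1,2) conv ep(3) tlt(2) htK m3 ok]
          obtain g y D where gy: "\<forall>i<t+3. g i < n" "y < 2 ^ m n" "is_max_clique n (plant n E (S E)) D"
            "card D \<le> card (res n (plant n E (S E)) y (near n (plant n E (S E)) h (candT n (plant n E (S E)) t g)))" by blast
          have "2 ^ m n \<le> n ^ a" using A(1) n3 mA(2) a(2) by (intro two_power_le[of A]) auto
          then have "y < n ^ a" using gy(2) by linarith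
          from max[OF gy(1) this gy(3,4)]
          show "E \<in> {E. is_max_clique n (plant n E (S E)) (R n (plant n E (S E)))}" by simp
        qed simp
        finally show ?thesis by (simp add: prob_AG p_def)
      qed
    qed
  qed
  show ?thesis
  proof (rule exI[of _ "clique_prog t h a"], rule exI[of _ C], rule exI[of _ d], intro conjI allI impI)
    show "ram_halts_within (clique_prog t h a) (C * (n + 1) ^ d) n E" for n E by (rule halts)
    fix S :: "nat \<Rightarrow> nat set set \<Rightarrow> nat set"
    assume S: "\<forall>n. valid_strategy n (k n) (S n)"
    show "(\<lambda>n. measure_pmf.prob (AG n (w n / real n) (S n))
        {G. is_max_clique n G (ram_output (clique_prog t h a) (C * (n + 1) ^ d) n G)}) \<longlonglongrightarrow> 1"
      unfolding R_def[symmetric]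
    proof (rule tendsto_sandwich)
      show "\<forall>\<^sub>F n in sequentially. 1 - 4 / real n \<le> measure_pmf.prob (AG n (w n / real n) (S n)) {G. is_max_clique n G (R n G)}"
        using main by eventually_elim (use S in auto)
      show "\<forall>\<^sub>F n in sequentially. measure_pmf.prob (AG n (w n / real n) (S n)) {G. is_max_clique n G (R n G)} \<le> 1"
        by simp
      have "(\<lambda>n. 1 - 4 / real n) \<longlonglongrightarrow> 1 - 0" by (intro tendsto_intros lim_const_over_n)
      then show "(\<lambda>n. 1 - 4 / real n) \<longlonglongrightarrow> 1" by simp
    qed simp
  qed
qed

end
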